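(* Let $d\ge1$, $p>2$, $x\in\mathbb{R}^d$, $t>0$, $R\in(0,1)$, $\tau\in(0,t)$. There exists $\bar\epsilon\in(0,\min[R,\tau])$ such that for all $\epsilon\in(0,\bar\epsilon)$ the quantity $\mathcal{A}_\epsilon[\varphi](x,t)$ is well defined for any bounded measurable function $\varphi$ in $B_R(x)\times[t-\tau,t+\tau]$. Moreover, if $\varphi\in C^2(B_R(x)\times[t-\tau,t+\tau])$, then $$\mathcal{A}_\epsilon[\varphi](x,t)=\varphi\Big(x,t+\frac{\epsilon^2}{2}\Big)+\frac{\epsilon^2}{2}\Big(\left(\Delta_p\varphi(x,t)\right)^{\frac1{p-1}}-\partial_t\varphi(x,t)\Big)+\epsilon^2\widehat E(\epsilon,\varphi,x,t),$$ where: (a) If $\varphi\in C^2(B_R(x)\times[t-\tau,t+\tau])$, then $\widehat E(\epsilon,\varphi,x,t)=o_\epsilon(1)$ as $\epsilon\to0^+$. (b) If $\varphi\in C^3(B_R(x)\times[t-\tau,t+\tau])$ and $\nabla\varphi(x,t)\ne0$, there exist constants $k_1=k_1(d,p)>0$, $k_2=k_2(d,p)>0$ such that $$|\widehat E(\epsilon,\varphi,x,t)|\le\epsilon^2\|\partial_{tt}\varphi\|_{L^\infty([t-\bar\epsilon^2/2,t+\bar\epsilon^2/2])}+k_1\epsilon^{2-\frac4p}\|D^2\varphi\|_{L^\infty(B_{\bar\epsilon}(x))}+k_2\epsilon^{\frac2{3p-4}}\left(\|\nabla\varphi\|_{L^\infty(B_{\bar\epsilon}(x))}+\|D^3\varphi\|_{L^\infty(B_{\bar\epsilon}(x))}+\frac{|D^2\varphi(x,t)|^2}{|\nabla\varphi(x,t)|}\right).$$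 (c) If $\varphi\in C^2(B_R(x)\times[t-\tau,t+\tau])$, there exists a constant $k_3=k_3(d,p)>0$ such that $$|\widehat E(\epsilon,\varphi,x,t)|\le\epsilon^2\|\partial_{tt}\varphi\|_{L^\infty([t-\bar\epsilon^2/2,t+\bar\epsilon^2/2])}+k_3\left(\|D^2\varphi\|_{L^\infty(B_{\bar\epsilon}(x))}^{\frac1{p-1}}|\nabla\varphi(x,t)|^{\frac{p-2}{p-1}}+\epsilon^{2-\frac4p}\|D^2\varphi\|_{L^\infty(B_{\bar\epsilon}(x))}+\epsilon^{\frac2{3p-4}}|\nabla\varphi(x,t)|\right).$$
   Context: Signed powers: $(s)^q=\operatorname{sgn}(s)|s|^q$ for $s\in\mathbb{R}$, $q>0$. $B_r(x)$ is the ball of radius $r$ centered at $x$. $\nabla,D^2,D^3,\Delta_p$ act on the space variable; norms over $B_{\bar\epsilon}(x)$ are of the spatial derivatives of $\varphi(\cdot,t)$, and the norm over the time interval is of $\partial_{tt}\varphi(x,\cdot)$. The $p$-Laplacian is $\Delta_p\varphi=\nabla\cdot(|\nabla\varphi|^{p-2}\nabla\varphi)$, i.e. for $\varphi\in C^2$, $\Delta_p\varphi=|\nabla\varphi|^{p-2}\big(\Delta\varphi+(p-2)\langle D^2\varphi\frac{\nabla\varphi}{|\nabla\varphi|},\frac{\nabla\varphi}{|\nabla\varphi|}\rangle\big)$ where $\nabla\varphi\ne0$, and $\Delta_p\varphi=0$ where $\nabla\varphi=0$. Set $\alpha=\frac{p-2}{p-1}$, $\beta=\frac{p-2}{p+d}$,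 $\gamma=\sqrt{2(p+d)}$, $m(\epsilon)=\epsilon^{\frac{2(p-1)}{3p-4}}$, $M(\epsilon)=\epsilon^{-2+\frac2p}$. For $\rho>0$, $$M_\rho[\varphi](x)=\frac\beta2\Big(\sup_{B_{\gamma\rho}(x)}\varphi+\inf_{B_{\gamma\rho}(x)}\varphi\Big)+(1-\beta)\frac{1}{|B_{\gamma\rho}(x)|}\int_{B_{\gamma\rho}(x)}\varphi(y)\,dy,$$ and $$\mathcal{A}_\epsilon[\varphi](x)=\frac12\max\Big[\inf_{c\in[m(\epsilon),M(\epsilon)]}\Big\{\alpha\sup_{B_{\epsilon^2c^{1-\alpha}}(x)}\varphi+(1-\alpha)M_{\epsilon c^{-\alpha/2}}[\varphi](x)\Big\},\varphi(x)\Big]+\frac12\min\Big[\sup_{c\in[m(\epsilon),M(\epsilon)]}\Big\{\alpha\inf_{B_{\epsilon^2c^{1-\alpha}}(x)}\varphi+(1-\alpha)M_{\epsilon c^{-\alpha/2}}[\varphi](x)\Big\},\varphi(x)\Big].$$ For $\varphi$ depending on $(x,t)$, $\mathcal{A}_\epsilon[\varphi](x,t)=\mathcal{A}_\epsilon[\varphi(\cdot,t)](x)$. "Well defined" means that all balls involved lie in $B_R(x)$, so that all suprema, infima and averages make sense.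
   Formalization: In (b) and (c) the space norms are taken over B_r(x), for any r in [ε̄,R) such that all balls in A_ε lie in B_r(x), not always over B_ε̄(x): for ε near ε̄ these balls leave B_ε̄(x) and the bound fails. "Measurable" is read as Borel measurable. *)

theory Defs
  imports "HOL-Analysis.Analysis" "HOL-Probability.Essential_Supremum"
begin

definition signed_power :: "real \<Rightarrow> real \<Rightarrow> real" where
  "signed_power s q = sgn s * \<bar>s\<bar> powr q"

definition pd :: "'a::euclidean_space \<Rightarrow> ('a \<Rightarrow> real) \<Rightarrow> 'a \<Rightarrow> real" where
  "pd b f y = frechet_derivative f (at y) b"

definition grad :: "('a::euclidean_space \<Rightarrow> real) \<Rightarrow> 'a \<Rightarrow> 'a" where
  "grad f y = (\<Sum>b\<in>Basis. pd b f y *\<^sub>R b)"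

text \<open>Euclidean (Frobenius) norms of the tensors of second and third partial derivatives.\<close>

definition norm_D2 :: "('a::euclidean_space \<Rightarrow> real) \<Rightarrow> 'a \<Rightarrow> real" where
  "norm_D2 f y = sqrt (\<Sum>b\<in>Basis. \<Sum>c\<in>Basis. (pd b (pd c f) y)\<^sup>2)"

definition norm_D3 :: "('a::euclidean_space \<Rightarrow> real) \<Rightarrow> 'a \<Rightarrow> real" where
  "norm_D3 f y = sqrt (\<Sum>a\<in>Basis. \<Sum>b\<in>Basis. \<Sum>c\<in>Basis. (pd a (pd b (pd c f)) y)\<^sup>2)"

definition divergence :: "('a::euclidean_space \<Rightarrow> 'a) \<Rightarrow> 'a \<Rightarrow> real" where
  "divergence F y = (\<Sum>b\<in>Basis. pd b (\<lambda>z. F z \<bullet> b) y)"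

definition p_laplacian :: "real \<Rightarrow> ('a::euclidean_space \<Rightarrow> real) \<Rightarrow> 'a \<Rightarrow> real" where
  "p_laplacian p f = divergence (\<lambda>y. norm (grad f y) powr (p - 2) *\<^sub>R grad f y)"

text \<open>Continuous differentiability of order \<open>k\<close> on \<open>S\<close>, for sets such as an open ball times a
  closed interval: the derivatives are taken within \<open>S\<close> (one-sided in time at the two end times)
  and are continuous on all of \<open>S\<close>. On such sets the derivative within \<open>S\<close> is unique.\<close>

primrec C_k_on :: "nat \<Rightarrow> 'a::euclidean_space set \<Rightarrow> ('a \<Rightarrow> real) \<Rightarrow> bool" where
  "C_k_on 0 S f \<longleftrightarrow> continuous_on S f"
| "C_k_on (Suc k) S f \<longleftrightarrow> f differentiable_on S \<and>
     (\<forall>b\<in>Basis. C_k_on k S (\<lambda>z. frechet_derivative f (at z within S) b))"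

text \<open>The norm of \<open>L\<^sup>\<infinity>(S)\<close> for essentially bounded functions.\<close>

definition Linf_norm :: "'a::euclidean_space set \<Rightarrow> ('a \<Rightarrow> real) \<Rightarrow> real" where
  "Linf_norm S g = real_of_ereal (esssup (restrict_space lborel S) (\<lambda>y. ereal \<bar>g y\<bar>))"

definition alpha :: "real \<Rightarrow> real" where
  "alpha p = (p - 2) / (p - 1)"

definition beta :: "nat \<Rightarrow> real \<Rightarrow> real" where
  "beta d p = (p - 2) / (p + real d)"

definition gamma :: "nat \<Rightarrow> real \<Rightarrow> real" where
  "gamma d p = sqrt (2 * (p + real d))"

definition c_lo :: "real \<Rightarrow> real \<Rightarrow> real" where
  "c_lo p \<epsilon> = \<epsilon> powr (2 * (p - 1) / (3 * p - 4))"

definition c_hi :: "real \<Rightarrow> real \<Rightarrow> real" where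
  "c_hi p \<epsilon> = \<epsilon> powr (- 2 + 2 / p)"

definition mean_op :: "real \<Rightarrow> real \<Rightarrow> ('a::euclidean_space \<Rightarrow> real) \<Rightarrow> 'a \<Rightarrow> real" where
  "mean_op p \<rho> f x =
     (let b = beta DIM('a) p; B = ball x (gamma DIM('a) p * \<rho>)
      in b / 2 * ((SUP y\<in>B. f y) + (INF y\<in>B. f y))
         + (1 - b) * (1 / measure lborel B * (LINT y:B|lborel. f y)))"

definition upper_val :: "real \<Rightarrow> real \<Rightarrow> ('a::euclidean_space \<Rightarrow> real) \<Rightarrow> 'a \<Rightarrow> real \<Rightarrow> real" where
  "upper_val p \<epsilon> f x c =
     alpha p * (SUP y\<in>ball x (\<epsilon>\<^sup>2 * c powr (1 - alpha p)). f y)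
     + (1 - alpha p) * mean_op p (\<epsilon> * c powr (- alpha p / 2)) f x"

definition lower_val :: "real \<Rightarrow> real \<Rightarrow> ('a::euclidean_space \<Rightarrow> real) \<Rightarrow> 'a \<Rightarrow> real \<Rightarrow> real" where
  "lower_val p \<epsilon> f x c =
     alpha p * (INF y\<in>ball x (\<epsilon>\<^sup>2 * c powr (1 - alpha p)). f y)
     + (1 - alpha p) * mean_op p (\<epsilon> * c powr (- alpha p / 2)) f x"

definition A_op :: "real \<Rightarrow> real \<Rightarrow> ('a::euclidean_space \<Rightarrow> real) \<Rightarrow> 'a \<Rightarrow> real" where
  "A_op p \<epsilon> f x =
     1/2 * max (INF c\<in>{c_lo p \<epsilon>..c_hi p \<epsilon>}. upper_val p \<epsilon> f x c) (f x)
   + 1/2 * min (SUP c\<in>{c_lo p \<epsilon>..c_hi p \<epsilon>}. lower_val p \<epsilon> f x c) (f x)"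

text \<open>All balls that occur in \<open>A_op p \<epsilon> f x\<close> lie in \<open>ball x r\<close>.\<close>

definition balls_inside :: "real \<Rightarrow> real \<Rightarrow> 'a::euclidean_space \<Rightarrow> real \<Rightarrow> bool" where
  "balls_inside p \<epsilon> x r \<longleftrightarrow>
     (\<forall>c\<in>{c_lo p \<epsilon>..c_hi p \<epsilon>}.
        ball x (\<epsilon>\<^sup>2 * c powr (1 - alpha p)) \<subseteq> ball x r \<and>
        ball x (gamma DIM('a) p * (\<epsilon> * c powr (- alpha p / 2))) \<subseteq> ball x r)"

text \<open>Besides the inclusion of the balls: every supremum, infimum and average in \<open>A_op p \<epsilon> f x\<close>
  is over a nonempty set on which the function is bounded, respectively integrable.\<close>

definition A_well_defined ::
  "real \<Rightarrow> real \<Rightarrow> real \<Rightarrow> ('a::euclidean_space \<Rightarrow> real) \<Rightarrow> 'a \<Rightarrow> bool" where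
  "A_well_defined p \<epsilon> R f x \<longleftrightarrow>
     c_lo p \<epsilon> \<le> c_hi p \<epsilon> \<and> balls_inside p \<epsilon> x R \<and>
     (\<forall>c\<in>{c_lo p \<epsilon>..c_hi p \<epsilon>}.
        (\<forall>r\<in>{\<epsilon>\<^sup>2 * c powr (1 - alpha p), gamma DIM('a) p * (\<epsilon> * c powr (- alpha p / 2))}.
           0 < r \<and> bounded (f ` ball x r)) \<and>
        set_integrable lborel (ball x (gamma DIM('a) p * (\<epsilon> * c powr (- alpha p / 2)))) f) \<and>
     bounded (upper_val p \<epsilon> f x ` {c_lo p \<epsilon>..c_hi p \<epsilon>}) \<and>
     bounded (lower_val p \<epsilon> f x ` {c_lo p \<epsilon>..c_hi p \<epsilon>})"

lemma eventually_balls_inside: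
  fixes x :: "'a::euclidean_space"
  assumes p: "p > 2" and r: "r > 0"
  shows "eventually (\<lambda>\<epsilon>. balls_inside p \<epsilon> x r) (at_right 0)"
proof -
  have lim: "((\<lambda>\<epsilon>::real. k * \<epsilon> powr a) \<longlongrightarrow> 0) (at_right 0)" if "a > 0" for k a :: real
  proof -
    have "((\<lambda>\<epsilon>::real. \<epsilon> powr a) \<longlongrightarrow> 0 powr a) (at_right 0)"
      by (rule tendsto_powr')
        (use that in \<open>auto intro!: tendsto_eq_intros simp: eventually_at_right_less
           intro: eventually_at_right_less[THEN eventually_mono]\<close>)
    then show ?thesis
      using tendsto_mult_left[of _ "0 powr a" _ k] that by simp
  qed
  let ?g = "gamma DIM('a) p"
  have e1: "2 - 2 / p > 0" and e2: "(2 * p - 2) / (3 * p - 4) > 0"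
    using p by (auto simp: field_simps)
  have a: "1 - alpha p = 1 / (p - 1)" "- alpha p / 2 \<le> 0"
    using p by (auto simp: alpha_def field_simps)
  have g: "?g \<ge> 0" using p by (simp add: gamma_def)
  have "eventually (\<lambda>\<epsilon>. 1 * \<epsilon> powr (2 - 2 / p) < r) (at_right 0)"
    using order_tendstoD(2)[OF lim[OF e1] r] .
  moreover have "eventually (\<lambda>\<epsilon>. ?g * \<epsilon> powr ((2 * p - 2) / (3 * p - 4)) < r) (at_right 0)"
    using order_tendstoD(2)[OF lim[OF e2] r] .
  moreover have "eventually (\<lambda>\<epsilon>::real. \<epsilon> > 0) (at_right 0)"
    by (rule eventually_at_right_less)
  ultimately show ?thesis
  proof eventually_elim
    case (elim \<epsilon>)
    have "\<epsilon>\<^sup>2 * c powr (1 - alpha p) \<le> r \<and> ?g * (\<epsilon> * c powr (- alpha p / 2)) \<le> r"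
      if c: "c_lo p \<epsilon> \<le> c" "c \<le> c_hi p \<epsilon>" for c
    proof
      have lo: "c_lo p \<epsilon> > 0" using elim by (simp add: c_lo_def)
      have "\<epsilon>\<^sup>2 * c powr (1 - alpha p) \<le> \<epsilon>\<^sup>2 * c_hi p \<epsilon> powr (1 - alpha p)"
        using c lo p a by (intro mult_left_mono powr_mono2) auto
      also have "\<dots> = \<epsilon> powr 2 * \<epsilon> powr ((- 2 + 2 / p) * (1 / (p - 1)))"
        using elim by (simp add: a c_hi_def powr_powr)
      also have "\<dots> = \<epsilon> powr (2 + (- 2 + 2 / p) * (1 / (p - 1)))"
        by (rule powr_add [symmetric])
      also have "2 + (- 2 + 2 / p) * (1 / (p - 1)) = 2 - 2 / p"
        using p by (simp add: divide_simps) (simp add: algebra_simps)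
      finally show "\<epsilon>\<^sup>2 * c powr (1 - alpha p) \<le> r" using elim by simp
      have "\<epsilon> * c powr (- alpha p / 2) \<le> \<epsilon> * c_lo p \<epsilon> powr (- alpha p / 2)"
        using c lo elim a by (intro mult_left_mono powr_mono2') auto
      also have "\<dots> = \<epsilon> powr 1 * \<epsilon> powr (2 * (p - 1) / (3 * p - 4) * (- alpha p / 2))"
        using elim by (simp add: c_lo_def powr_powr)
      also have "\<dots> = \<epsilon> powr (1 + 2 * (p - 1) / (3 * p - 4) * (- alpha p / 2))"
        by (rule powr_add [symmetric])
      also have "1 + 2 * (p - 1) / (3 * p - 4) * (- alpha p / 2) = (2 * p - 2) / (3 * p - 4)"
        using p by (simp add: alpha_def divide_simps) (simp add: algebra_simps)
      finally have "?g * (\<epsilon> * c powr (- alpha p / 2)) \<le> ?g * \<epsilon> powr ((2 * p - 2) / (3 * p - 4))"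
        using g by (rule mult_left_mono)
      then show "?g * (\<epsilon> * c powr (- alpha p / 2)) \<le> r" using elim by simp
    qed
    then show ?case
      unfolding balls_inside_def by (auto intro!: subset_ball)
  qed
qed

end

theory Submission
  imports Defs
begin

text \<open>Write \<open>f = \<phi>(\<cdot>,t)\<close>, \<open>a = |\<nabla>f(x)|\<close>, \<open>\<nu> = \<nabla>f(x)/a\<close>, and let \<open>L = \<Delta>f + (p - 2) D\<^sup>2f \<nu>\<cdot>\<nu>\<close> be the normalized
  \<open>p\<close>-Laplacian at \<open>x\<close>. By Taylor's formula the expression in the infimum is, up to small errors,
  \<open>f(x) + \<epsilon>\<^sup>2 (\<alpha> c\<^bsup>1-\<alpha>\<^esup> a + (1 - \<alpha>) c\<^bsup>-\<alpha>\<^esup> L)\<close>, because the second moments of a ball turn the weighted average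
  into \<open>f(x) + \<rho>\<^sup>2 L\<close>. Young's inequality identifies the infimum over \<open>c > 0\<close> as
  \<open>a\<^bsup>\<alpha>\<^esup> L\<^bsup>1-\<alpha>\<^esup> = (\<Delta>\<^sub>p f)\<^bsup>1/(p-1)\<^esup>\<close> if \<open>L > 0\<close>; if \<open>L \<le> 0\<close>, the maximum with \<open>f(x)\<close> cuts it off at \<open>f(x)\<close>.
  Restricting \<open>c\<close> to \<open>[m(\<epsilon>), M(\<epsilon>)]\<close> costs at most \<open>m\<^bsup>1-\<alpha>\<^esup> a + M\<^bsup>-\<alpha>\<^esup> L\<close>. The second half of the operator is
  the first half for \<open>-f\<close>.

  The error of the average is kept inside the minimization, as a perturbation \<open>L \<plusminus> \<eta>\<close>: a bound uniform in \<open>c\<close>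
  would be multiplied by \<open>c\<^bsup>-\<alpha>\<^esup>\<close>, which is unbounded as \<open>\<epsilon> \<rightarrow> 0\<close>. Part (c) is the case \<open>L = 0\<close>,
  \<open>\<eta> = (p + d) \<parallel>D\<^sup>2f\<parallel>\<close>; part (b) has \<open>\<eta> = 0\<close>; in part (a) \<open>\<eta>\<close> is arbitrarily small.\<close>

subsection \<open>Second moments of a ball\<close>



text \<open>The endpoints m(\<epsilon>) and M(\<epsilon>) each balance two errors. Lowering m
  reduces the truncation cost m^(1-\<alpha>) a but enlarges the averaging radius \<rho> = \<epsilon>
  c^(-\<alpha>/2) and with it the third-order error \<rho>^3 / \<epsilon>^2; at c = m the cost
  factor and this error both have order \<epsilon>^(2/(3p-4)). Raising M reduces M^(-\<alpha>) L but
  enlarges the radius \<epsilon>^2 c^(1-\<alpha>) of the outer supremum and infimum; at c = M the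
  squared radius divided by \<epsilon>^2 and M^(-\<alpha>) both have order \<epsilon>^(2-4/p). These
  are the two rates in (b) and (c). The quotient |D^2 f|^2 / |\<nabla>f| in (b) is not a Taylor
  remainder. It bounds the gain from moving the maximizer of a quadratic polynomial over a ball away
  from the gradient direction. Since it degenerates at critical points, (a) is proved there from the
  estimate (c), whose terms without a positive power of \<epsilon> vanish with the gradient.\<close>

lemma lborel_distr_reflect:
  fixes b :: "'a::euclidean_space"
  assumes b: "b \<in> Basis"
  shows "distr lborel borel (\<lambda>v. v - (2 * (v \<bullet> b)) *\<^sub>R b) = (lborel :: 'a measure)"
proof -
  \<comment> \<open>Diagonal entries of the reflection in the hyperplane orthogonal to
    \<open>b\<close>; their absolute values have product 1.\<close>
  let ?c = "\<lambda>j::'a. if j = b then -1 else (1::real)"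
  have eq: "(\<Sum>j\<in>Basis. (?c j * (v \<bullet> j)) *\<^sub>R j) = v - (2 * (v \<bullet> b)) *\<^sub>R b" for v :: 'a
    by (rule euclidean_eqI)
      (use b in \<open>auto simp: inner_sum_left_Basis inner_diff_left inner_Basis\<close>)
  have "lborel = density (distr lborel borel (\<lambda>x. 0 + (\<Sum>j\<in>Basis. (?c j * (x \<bullet> j)) *\<^sub>R j)))
      (\<lambda>_. \<Prod>j\<in>Basis. \<bar>?c j\<bar>)"
    by (rule lborel_affine_euclidean) auto
  moreover have "(\<Prod>j\<in>(Basis :: 'a set). \<bar>?c j\<bar>) = 1"
    by (intro prod.neutral) auto
  ultimately show ?thesis by (simp add: eq density_1)
qed

text \<open>The map interchanges the coordinates along \<open>b\<close> and \<open>c\<close>, and is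
  the identity if \<open>b = c\<close>. It permutes the side lengths of a box, so it preserves the
  volumes of boxes, which determine \<open>lborel\<close>.\<close>

lemma lborel_distr_swap:
  fixes b c :: "'a::euclidean_space"
  assumes b: "b \<in> Basis" and c: "c \<in> Basis"
  shows "distr lborel borel (\<lambda>v. v - ((v \<bullet> b) - (v \<bullet> c)) *\<^sub>R (b - c)) = (lborel :: 'a measure)"
proof (rule lborel_eqI[symmetric])
  let ?T = "\<lambda>v::'a. v - ((v \<bullet> b) - (v \<bullet> c)) *\<^sub>R (b - c)"
  define p where "p j = (if j = b then c else if j = c then b else j)" for j
  have p: "p j \<in> Basis" if "j \<in> Basis" for j using that b c by (auto simp: p_def)
  have T: "?T v \<bullet> j = v \<bullet> p j" if "j \<in> Basis" for v j
    using that b c by (auto simp: p_def inner_diff_left inner_diff_right inner_Basis algebra_simps)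
  have inv: "p (p j) = j" for j by (auto simp: p_def)
  fix l u :: 'a
  assume le: "\<And>b. b \<in> Basis \<Longrightarrow> l \<bullet> b \<le> u \<bullet> b"
  have meas: "?T \<in> borel_measurable borel" by (intro borel_measurable_continuous_onI continuous_intros)
  have "?T -` box l u = box (?T l) (?T u)"
  proof (intro set_eqI iffI)
    fix v assume "v \<in> ?T -` box l u"
    then have *: "l \<bullet> j < v \<bullet> p j" "v \<bullet> p j < u \<bullet> j" if "j \<in> Basis" for j
      using T that by (auto simp: mem_box)
    show "v \<in> box (?T l) (?T u)"
      unfolding mem_box using *[OF p] by (auto simp: T inv)
  next
    fix v assume "v \<in> box (?T l) (?T u)"
    then have *: "l \<bullet> p j < v \<bullet> j" "v \<bullet> j < u \<bullet> p j" if "j \<in> Basis" for j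
      using T that by (auto simp: mem_box)
    show "v \<in> ?T -` box l u"
      using *[OF p] by (auto simp: T inv mem_box)
  qed
  then have "emeasure (distr lborel borel ?T) (box l u) = emeasure lborel (box (?T l) (?T u))"
    using meas by (subst emeasure_distr) auto
  also have "\<dots> = ennreal (\<Prod>j\<in>Basis. (?T u - ?T l) \<bullet> j)"
    using le p T by (subst emeasure_lborel_box_eq) (auto simp: inner_diff_left)
  also have "(\<Prod>j\<in>Basis. (?T u - ?T l) \<bullet> j) = (\<Prod>j\<in>Basis. (u - l) \<bullet> p j)"
    by (intro prod.cong refl) (metis T inner_diff_left)
  also have "\<dots> = (\<Prod>j\<in>Basis. (u - l) \<bullet> j)"
    by (rule prod.reindex_bij_witness[of _ p p]) (use p inv in auto)
  finally show "emeasure (distr lborel borel ?T) (box l u) = ennreal (\<Prod>j\<in>Basis. (u - l) \<bullet> j)" 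
    by simp
qed simp

lemma ball_integral_invariant:
  fixes h :: "'a::euclidean_space \<Rightarrow> real"
  assumes T: "distr lborel borel T = (lborel :: 'a measure)" "T \<in> borel_measurable borel"
    and n: "\<And>v. norm (T v) = norm v" and h: "h \<in> borel_measurable borel"
  shows "(LINT v:ball 0 s|lborel. h (T v)) = (LINT v:ball 0 s|lborel. h v)"
proof -
  have "(LINT v:ball 0 s|lborel. h v) = (LINT v|distr lborel borel T. indicator (ball 0 s) v *\<^sub>R h v)"
    by (simp add: T set_lebesgue_integral_def)
  also have "\<dots> = (LINT v|lborel. indicator (ball 0 s) (T v) *\<^sub>R h (T v))"
    using T h by (intro integral_distr) (auto intro!: borel_measurable_times borel_measurable_indicator)
  also have "\<dots> = (LINT v:ball 0 s|lborel. h (T v))"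
    using n by (simp add: set_lebesgue_integral_def indicator_def)
  finally show ?thesis ..
qed

lemma set_lebesgue_integral_sum:
  fixes f :: "'i \<Rightarrow> 'a \<Rightarrow> real"
  assumes "\<And>i. i \<in> I \<Longrightarrow> set_integrable M A (f i)"
  shows "(LINT x:A|M. (\<Sum>i\<in>I. f i x)) = (\<Sum>i\<in>I. LINT x:A|M. f i x)"
  using assms unfolding set_lebesgue_integral_def set_integrable_def
  by (simp add: sum_distrib_left Bochner_Integration.integral_sum)

lemma set_integrable_continuous_ball:
  fixes h :: "'a::euclidean_space \<Rightarrow> real"
  assumes "continuous_on UNIV h"
  shows "set_integrable lborel (ball x s) h"
proof (rule set_integrable_subset)
  show "set_integrable lborel (cball x s) h"
    unfolding set_integrable_def
    using assms by (intro borel_integrable_compact) (auto intro: continuous_on_subset)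
qed auto

text \<open>Layer-cake argument in place of polar coordinates: |v|^2 is the integral of 2u over 0
  \<le> u \<le> |v|. Exchanging the integrals leaves, for each u, the volume of the shell
  \<open>ball 0 s - ball 0 u\<close>, so only the volumes of balls enter.\<close>

lemma norm_sq_ball_integral:
  fixes s :: real
  assumes s: "s > 0"
  shows "(LINT v:ball (0::'a::euclidean_space) s|lborel. (norm v)\<^sup>2) =
     DIM('a) * s\<^sup>2 / (DIM('a) + 2) * measure lborel (ball (0::'a) s)"
proof -
  let ?d = "DIM('a)"
  define w where "w = unit_ball_vol ?d"
  have w: "w \<ge> 0" by (simp add: w_def)
  \<comment> \<open>Chosen so that k u^(d+2) has derivative 2 u^(d+1), the term subtracted in the
    radial integrand.\<close>
  define k where "k = 2 / real (?d + 2)"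
  have k: "k * real (?d + 2) = 2"
    by (rule nonzero_eq_divide_eq[THEN iffD1]) (simp_all only: k_def of_nat_eq_0_iff)
  have sq: "(\<integral>\<^sup>+u. ennreal (2 * u) * indicator {0..a} u \<partial>lborel) = ennreal (a\<^sup>2)" if "a \<ge> 0" for a :: real
  proof -
    have "(\<integral>\<^sup>+u. ennreal (2 * u) * indicator {0..a} u \<partial>lborel) = ennreal (a\<^sup>2 - 0\<^sup>2)"
      by (rule nn_integral_FTC_Icc) (use that in \<open>auto intro!: derivative_eq_intros\<close>)
    then show ?thesis by simp
  qed
  have vol: "emeasure lborel (ball (0::'a) s - ball 0 u) = ennreal (w * (s ^ ?d - u ^ ?d))"
    if "0 \<le> u" "u \<le> s" for u
  proof -
    have "emeasure lborel (ball (0::'a) s - ball 0 u) = emeasure lborel (ball (0::'a) s) - emeasure lborel (ball (0::'a) u)"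
      using that emeasure_lborel_ball_finite[of "0::'a" u]
      by (intro emeasure_Diff subset_ball) auto
    then show ?thesis using that s
      by (simp add: emeasure_ball w_def ennreal_minus algebra_simps)
  qed
  have m2[measurable]: "(\<lambda>(v::'a,u::real). indicator (ball 0 s) v * (ennreal (2 * u) * indicator {0..norm v} u)) \<in> borel_measurable (lborel \<Otimes>\<^sub>M lborel)"
  proof -
    have "(\<lambda>(v::'a,u::real). (if norm v < s then 1 else 0) * (ennreal (2 * u) * (if 0 \<le> u \<and> u \<le> norm v then 1 else 0))) \<in> borel_measurable (lborel \<Otimes>\<^sub>M lborel)"
      by measurable
    then show ?thesis by (simp add: indicator_def of_bool_def)
  qed
  have "(\<integral>\<^sup>+v. ennreal ((norm v)\<^sup>2) * indicator (ball (0::'a) s) v \<partial>lborel)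
      = (\<integral>\<^sup>+v. (\<integral>\<^sup>+u. indicator (ball (0::'a) s) v * (ennreal (2 * u) * indicator {0..norm v} u) \<partial>lborel) \<partial>lborel)"
  proof (intro nn_integral_cong)
    fix v :: 'a
    show "ennreal ((norm v)\<^sup>2) * indicator (ball 0 s) v
        = (\<integral>\<^sup>+u. indicator (ball 0 s) v * (ennreal (2 * u) * indicator {0..norm v} u) \<partial>lborel)"
      by (subst nn_integral_cmult, simp, subst sq) (auto simp: mult.commute)
  qed
  also have "\<dots> = (\<integral>\<^sup>+u. (\<integral>\<^sup>+v. indicator (ball (0::'a) s) v * (ennreal (2 * u) * indicator {0..norm v} u) \<partial>lborel) \<partial>lborel)"
    by (rule lborel_pair.Fubini'[symmetric]) (use m2 in simp)
  also have "\<dots> = (\<integral>\<^sup>+u. ennreal (2 * u * (w * (s ^ ?d - u ^ ?d))) * indicator {0..s} u \<partial>lborel)"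
  proof (intro nn_integral_cong)
    fix u :: real
    have "(\<integral>\<^sup>+v. indicator (ball (0::'a) s) v * (ennreal (2 * u) * indicator {0..norm v} u) \<partial>lborel)
      = (\<integral>\<^sup>+v. ennreal (2 * u) * indicator {0..} u * indicator (ball (0::'a) s - ball 0 u) v \<partial>lborel)"
      by (intro nn_integral_cong) (auto simp: indicator_def)
    also have "\<dots> = ennreal (2 * u) * indicator {0..} u * emeasure lborel (ball (0::'a) s - ball 0 u)"
      by (rule nn_integral_cmult_indicator) auto
    also have "\<dots> = ennreal (2 * u * (w * (s ^ ?d - u ^ ?d))) * indicator {0..s} u"
    proof (cases "0 \<le> u \<and> u \<le> s")
      case True
      then have "s ^ ?d - u ^ ?d \<ge> 0" by (simp add: power_mono)
      with True w show ?thesis by (simp add: vol ennreal_mult'' mult.assoc)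
    next
      case False
      then have "ball (0::'a) s - ball 0 u = {} \<or> u < 0" by auto
      then show ?thesis using False s by (auto simp only: emeasure_empty) (auto simp: indicator_def)
    qed
    finally show "(\<integral>\<^sup>+v. indicator (ball (0::'a) s) v * (ennreal (2 * u) * indicator {0..norm v} u) \<partial>lborel) = 
      ennreal (2 * u * (w * (s ^ ?d - u ^ ?d))) * indicator {0..s} u" .
  qed
  also have "\<dots> = ennreal (w * (s\<^sup>2 * s ^ ?d - k * s ^ (?d + 2)) - w * (0\<^sup>2 * s ^ ?d - k * 0 ^ (?d + 2)))"
  proof (rule nn_integral_FTC_Icc[where F = "\<lambda>u. w * (u\<^sup>2 * s ^ ?d - k * u ^ (?d + 2))"])
    fix u :: real assume "u \<in> {0..s}"
    then have u: "0 \<le> u" "u \<le> s" by auto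
    have "((\<lambda>u. w * (u\<^sup>2 * s ^ ?d - k * u ^ (?d + 2))) has_real_derivative
        w * (2 * u * s ^ ?d - k * (real (?d + 2) * u ^ (?d + 1)))) (at u)"
      by (rule derivative_eq_intros refl | simp)+
    also have "k * (real (?d + 2) * u ^ (?d + 1)) = 2 * u * u ^ ?d"
      using k by (simp flip: mult.assoc)
    finally show "((\<lambda>u. w * (u\<^sup>2 * s ^ ?d - k * u ^ (?d + 2))) has_real_derivative
        2 * u * (w * (s ^ ?d - u ^ ?d))) (at u)"
      by (simp add: algebra_simps)
    show "0 \<le> 2 * u * (w * (s ^ ?d - u ^ ?d))"
      using u w by (simp add: power_mono)
  qed (use s in auto)
  also have "w * (s\<^sup>2 * s ^ ?d - k * s ^ (?d + 2)) - w * (0\<^sup>2 * s ^ ?d - k * 0 ^ (?d + 2))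
     = (1 - k) * s\<^sup>2 * (w * s ^ ?d)" by (simp add: algebra_simps power2_eq_square)
  also have "(1 - k) * s\<^sup>2 = ?d * s\<^sup>2 / (?d + 2)" by (simp add: k_def field_simps)
  finally have *: "(\<integral>\<^sup>+v. ennreal ((norm v)\<^sup>2) * indicator (ball (0::'a) s) v \<partial>lborel) = ennreal (?d * s\<^sup>2 / (?d + 2) * (w * s ^ ?d))" .
  have "(LINT v:ball (0::'a) s|lborel. (norm v)\<^sup>2) = enn2real (\<integral>\<^sup>+v. ennreal (indicator (ball (0::'a) s) v * (norm v)\<^sup>2) \<partial>lborel)"
    unfolding set_lebesgue_integral_def
    by (subst integral_eq_nn_integral) (auto intro!: borel_measurable_times borel_measurable_indicator)
  also have "(\<integral>\<^sup>+v. ennreal (indicator (ball (0::'a) s) v * (norm v)\<^sup>2) \<partial>lborel) = (\<integral>\<^sup>+v. ennreal ((norm v)\<^sup>2) * indicator (ball (0::'a) s) v \<partial>lborel)"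
    by (intro nn_integral_cong) (auto simp: indicator_def)
  finally show ?thesis using s w by (simp add: * content_ball w_def)
qed

text \<open>The reflection along a basis vector \<open>b\<close> preserves the ball and changes the
  sign of \<open>v \<bullet> b\<close>, so each coordinate integral equals its own negative.\<close>

lemma ball_integral_inner:
  fixes g :: "'a::euclidean_space"
  shows "(LINT v:ball 0 s|lborel. g \<bullet> v) = 0"
proof -
  have "(LINT v:ball (0::'a) s|lborel. v \<bullet> b) = 0" if b: "b \<in> Basis" for b
  proof -
    let ?T = "\<lambda>v. v - (2 * (v \<bullet> b)) *\<^sub>R b"
    have bb: "b \<bullet> b = 1" using b by simp
    have "(norm (?T v))\<^sup>2 = (norm v)\<^sup>2" for v
      using bb unfolding power2_norm_eq_inner
      by (simp add: inner_diff_left inner_diff_right inner_commute power2_eq_square algebra_simps)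
    then have n: "norm (?T v) = norm v" for v by (metis norm_ge_zero power2_eq_iff_nonneg)
    have "(LINT v:ball 0 s|lborel. ?T v \<bullet> b) = (LINT v:ball 0 s|lborel. v \<bullet> b)"
      by (rule ball_integral_invariant[OF lborel_distr_reflect[OF b]])
        (auto simp: n intro!: borel_measurable_continuous_onI continuous_intros)
    moreover have "?T v \<bullet> b = - (v \<bullet> b)" for v by (simp add: inner_diff_left bb)
    ultimately show ?thesis by (simp add: set_lebesgue_integral_def)
  qed
  note lin = this
  have "(LINT v:ball (0::'a) s|lborel. g \<bullet> v) = (LINT v:ball (0::'a) s|lborel. (\<Sum>b\<in>Basis. (g \<bullet> b) * (v \<bullet> b)))"
    by (simp flip: euclidean_inner)
  also have "\<dots> = (\<Sum>b\<in>Basis. (LINT v:ball (0::'a) s|lborel. (g \<bullet> b) * (v \<bullet> b)))"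
    by (rule set_lebesgue_integral_sum) (auto intro!: set_integrable_continuous_ball continuous_intros)
  also have "\<dots> = 0" by (simp add: lin)
  finally show ?thesis .
qed

text \<open>For \<open>b \<noteq> c\<close> the reflection along \<open>b\<close> changes the sign
  of the product. For \<open>b = c\<close>, swaps of coordinates make all d second moments equal,
  and their sum, the integral of |v|^2, fixes the common value.\<close>

lemma ball_integral_coordinates:
  fixes b c :: "'a::euclidean_space"
  assumes s: "s > 0" and b: "b \<in> Basis" and c: "c \<in> Basis"
  shows "(LINT v:ball 0 s|lborel. (v \<bullet> b) * (v \<bullet> c)) =
    (if b = c then s\<^sup>2 / (DIM('a) + 2) * measure lborel (ball (0::'a) s) else 0)"
proof (cases "b = c")
  case False
  let ?T = "\<lambda>v. v - (2 * (v \<bullet> b)) *\<^sub>R b"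
  have bb: "b \<bullet> b = 1" and bc: "b \<bullet> c = 0" using b c False by (auto simp: inner_Basis)
  have "(norm (?T v))\<^sup>2 = (norm v)\<^sup>2" for v
    using bb unfolding power2_norm_eq_inner
    by (simp add: inner_diff_left inner_diff_right inner_commute power2_eq_square algebra_simps)
  then have n: "norm (?T v) = norm v" for v by (metis norm_ge_zero power2_eq_iff_nonneg)
  have "(LINT v:ball 0 s|lborel. (?T v \<bullet> b) * (?T v \<bullet> c)) = (LINT v:ball 0 s|lborel. (v \<bullet> b) * (v \<bullet> c))"
    by (rule ball_integral_invariant[OF lborel_distr_reflect[OF b], where h = "\<lambda>v. (v \<bullet> b) * (v \<bullet> c)"])
      (auto simp: n intro!: borel_measurable_continuous_onI continuous_intros)
  moreover have "(?T v \<bullet> b) * (?T v \<bullet> c) = - ((v \<bullet> b) * (v \<bullet> c))" for v by (simp add: inner_diff_left bb bc)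
  ultimately show ?thesis using False by (simp add: set_lebesgue_integral_def)
next
  case True
  have eq: "(LINT v:ball 0 s|lborel. (v \<bullet> j)\<^sup>2) = (LINT v:ball 0 s|lborel. (v \<bullet> b)\<^sup>2)" 
    if j: "j \<in> Basis" for j :: 'a
  proof -
    let ?T = "\<lambda>v::'a. v - ((v \<bullet> b) - (v \<bullet> j)) *\<^sub>R (b - j)"
    have bb: "b \<bullet> b = 1" "j \<bullet> j = 1" using b j by auto
    have Tb: "?T v \<bullet> b = v \<bullet> j" for v using b j
      by (cases "b = j") (auto simp: inner_diff_left inner_diff_right inner_Basis)
    have "(norm (?T v))\<^sup>2 = (norm v)\<^sup>2" for v
    proof (cases "b = j")
      case False
      then have "b \<bullet> j = 0" "j \<bullet> b = 0" using b j by (auto simp: inner_Basis)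
      then show ?thesis using bb unfolding power2_norm_eq_inner
       by (simp add: inner_diff_left inner_diff_right inner_commute power2_eq_square algebra_simps)
    qed simp
    then have n: "norm (?T v) = norm v" for v by (metis norm_ge_zero power2_eq_iff_nonneg)
    have "(LINT v:ball 0 s|lborel. (?T v \<bullet> b)\<^sup>2) = (LINT v:ball 0 s|lborel. (v \<bullet> b)\<^sup>2)"
      by (rule ball_integral_invariant[OF lborel_distr_swap[OF b j], where h = "\<lambda>v. (v \<bullet> b)\<^sup>2"])
        (auto simp: n intro!: borel_measurable_continuous_onI continuous_intros)
    then show ?thesis by (simp add: Tb)
  qed
  have "(LINT v:ball (0::'a) s|lborel. (norm v)\<^sup>2) = (LINT v:ball (0::'a) s|lborel. (\<Sum>j\<in>Basis. (v \<bullet> j)\<^sup>2))"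
    unfolding power2_norm_eq_inner by (subst euclidean_inner) (simp add: power2_eq_square)
  also have "\<dots> = (\<Sum>j\<in>Basis. LINT v:ball (0::'a) s|lborel. (v \<bullet> j)\<^sup>2)"
    by (rule set_lebesgue_integral_sum) (auto intro!: set_integrable_continuous_ball continuous_intros)
  also have "\<dots> = DIM('a) * (LINT v:ball 0 s|lborel. (v \<bullet> b)\<^sup>2)" by (simp add: eq)
  finally have "real DIM('a) * (LINT v:ball 0 s|lborel. (v \<bullet> b)\<^sup>2)
      = real DIM('a) * (s\<^sup>2 / (DIM('a) + 2) * measure lborel (ball (0::'a) s))"
    unfolding norm_sq_ball_integral[OF s] by simp
  then have "(LINT v:ball 0 s|lborel. (v \<bullet> b)\<^sup>2) = s\<^sup>2 / (DIM('a) + 2) * measure lborel (ball (0::'a) s)"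
    by (subst (asm) mult_cancel_left) simp
  then show ?thesis using True by (simp add: power2_eq_square)
qed

lemma ball_average_quadratic:
  fixes g :: "'a::euclidean_space" and H :: "'a \<Rightarrow> 'a \<Rightarrow> real"
  assumes s: "s > 0"
  shows "(LINT v:ball 0 s|lborel. a + g \<bullet> v + (\<Sum>b\<in>Basis. \<Sum>c\<in>Basis. (v \<bullet> b) * (v \<bullet> c) * H b c) / 2)
      = (a + s\<^sup>2 / (2 * (DIM('a) + 2)) * (\<Sum>b\<in>Basis. H b b)) * measure lborel (ball (0::'a) s)"
proof -
  note I = set_integrable_continuous_ball
  let ?V = "measure lborel (ball (0::'a) s)"
  have "(LINT v:ball 0 s|lborel. (\<Sum>b\<in>Basis. \<Sum>c\<in>Basis. (v \<bullet> b) * (v \<bullet> c) * H b c))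
      = (\<Sum>b\<in>Basis. LINT v:ball 0 s|lborel. (\<Sum>c\<in>Basis. (v \<bullet> b) * (v \<bullet> c) * H b c))"
    by (rule set_lebesgue_integral_sum) (auto intro!: I continuous_intros)
  also have "\<dots> = (\<Sum>b\<in>Basis. \<Sum>c\<in>Basis. (LINT v:ball 0 s|lborel. (v \<bullet> b) * (v \<bullet> c)) * H b c)"
    by (intro sum.cong refl, subst set_lebesgue_integral_sum) (auto intro!: I continuous_intros)
  also have "\<dots> = (\<Sum>b\<in>Basis. \<Sum>c\<in>Basis. (if b = c then s\<^sup>2 / (DIM('a) + 2) * ?V * H b b else 0))"
    using s by (intro sum.cong refl) (simp add: ball_integral_coordinates)
  also have "\<dots> = s\<^sup>2 / (DIM('a) + 2) * ?V * (\<Sum>b\<in>Basis. H b b)"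
    by (simp add: sum_distrib_left)
  finally have 1: "(LINT v:ball 0 s|lborel. (\<Sum>b\<in>Basis. \<Sum>c\<in>Basis. (v \<bullet> b) * (v \<bullet> c) * H b c)) = s\<^sup>2 / (DIM('a) + 2) * ?V * (\<Sum>b\<in>Basis. H b b)" .
  have 2: "(LINT v:ball (0::'a) s|lborel. a) = a * ?V"
    by (simp add: set_lebesgue_integral_def)
  show "(LINT v:ball 0 s|lborel. a + g \<bullet> v + (\<Sum>b\<in>Basis. \<Sum>c\<in>Basis. (v \<bullet> b) * (v \<bullet> c) * H b c) / 2)
      = (a + s\<^sup>2 / (2 * (DIM('a) + 2)) * (\<Sum>b\<in>Basis. H b b)) * ?V"
  proof -
    have i: "set_integrable lborel (ball 0 s) (\<lambda>v. \<Sum>b\<in>Basis. \<Sum>c\<in>Basis. (v \<bullet> b) * (v \<bullet> c) * H b c)"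
      "set_integrable lborel (ball 0 s) (\<lambda>v. a + g \<bullet> v)" "set_integrable lborel (ball 0 s) (\<lambda>v. g \<bullet> v)"
      "set_integrable lborel (ball (0::'a) s) (\<lambda>v. a)"
      by (auto intro!: I continuous_intros)
    show ?thesis
      by (simp only: set_integral_add(2)[OF i(2) set_integrable_divide[OF i(1)]] set_integral_add(2)[OF i(4,3)]
          set_integral_divide_zero 1 2 ball_integral_inner) (simp add: algebra_simps)
  qed
qed



subsection \<open>Minimization over the parameter\<close>

text \<open>The maximum with \<open>f x\<close> cuts off negative increments, so one half of the
  operator sees only the positive part of its argument. The signed power reappears as the difference
  of the two halves.\<close>

definition pos_powr :: "real \<Rightarrow> real \<Rightarrow> real" where
  "pos_powr b q = max b 0 powr q"

lemma signed_power_eq_pos_powr: "signed_power s q = pos_powr s q - pos_powr (- s) q"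
  by (auto simp: signed_power_def pos_powr_def max_def sgn_if)

lemma pos_powr_nonneg: "pos_powr b q \<ge> 0"
  by (simp add: pos_powr_def)

lemma tendsto_pos_powr:
  assumes "q > 0" "(f \<longlongrightarrow> b) F"
  shows "((\<lambda>x. pos_powr (f x) q) \<longlongrightarrow> pos_powr b q) F"
  unfolding pos_powr_def
  by (rule tendsto_powr') (use assms in \<open>auto intro!: tendsto_intros\<close>)

text \<open>With weights \<alpha> and 1 - \<alpha> the powers of \<open>c\<close> cancel in the
  geometric mean, which makes the lower bound independent of \<open>c\<close>.\<close>

lemma weighted_young:
  fixes a b c \<alpha> :: real
  assumes al: "0 < \<alpha>" "\<alpha> < 1" and c: "c > 0" and a: "a \<ge> 0"
  shows "a powr \<alpha> * pos_powr b (1 - \<alpha>) \<le> \<alpha> * (c powr (1 - \<alpha>) * a) + (1 - \<alpha>) * (c powr (- \<alpha>) * max b 0)"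
proof (cases "a = 0 \<or> b \<le> 0")
  case True
  then show ?thesis using assms by (auto simp: pos_powr_def max_def)
next
  case False
  then have ab: "a > 0" "b > 0" using a by auto
  have "(c powr (1 - \<alpha>) * a) powr \<alpha> * (c powr (- \<alpha>) * b) powr (1 - \<alpha>)
      \<le> \<alpha> * (c powr (1 - \<alpha>) * a) + (1 - \<alpha>) * (c powr (- \<alpha>) * b)"
    by (rule Youngs_inequality_0) (use ab al c in auto)
  also have "(c powr (1 - \<alpha>) * a) powr \<alpha> * (c powr (- \<alpha>) * b) powr (1 - \<alpha>)
      = (c powr ((1 - \<alpha>) * \<alpha>) * c powr (- \<alpha> * (1 - \<alpha>))) * (a powr \<alpha> * b powr (1 - \<alpha>))"
    using ab c by (simp add: powr_mult powr_powr)
  also have "c powr ((1 - \<alpha>) * \<alpha>) * c powr (- \<alpha> * (1 - \<alpha>)) = 1"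
    using c by (simp add: algebra_simps flip: powr_add)
  finally show ?thesis using ab by (simp add: pos_powr_def)
qed

text \<open>The minimum over all \<open>c > 0\<close> is attained at \<open>c = b / a\<close>, which is truncated to \<open>[m, M]\<close>.\<close>

lemma weighted_young_truncated:
  fixes a b m M \<alpha> :: real
  assumes al: "0 < \<alpha>" "\<alpha> < 1" and m: "0 < m" "m \<le> M" and a: "a \<ge> 0"
  shows "\<exists>c\<in>{m..M}. \<alpha> * (c powr (1 - \<alpha>) * a) + (1 - \<alpha>) * (c powr (- \<alpha>) * b)
    \<le> a powr \<alpha> * pos_powr b (1 - \<alpha>) + m powr (1 - \<alpha>) * a + M powr (- \<alpha>) * max b 0"
proof -
  \<comment> \<open>The weights sum to 1, so in each case it suffices to bound both unweighted terms
    by the same number.\<close>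
  have convex: "\<alpha> * u + (1 - \<alpha>) * v \<le> w" if "u \<le> w" "v \<le> w" for u v w :: real
    using convex_bound_le[of u w v \<alpha> "1 - \<alpha>"] that al by simp
  have nn: "a powr \<alpha> * pos_powr b (1 - \<alpha>) \<ge> 0" "m powr (1 - \<alpha>) * a \<ge> 0" "M powr (- \<alpha>) * max b 0 \<ge> 0"
    using a by (auto simp: pos_powr_nonneg)
  have split: "c powr (1 - \<alpha>) * y = c powr (- \<alpha>) * (c * y)" if "c > 0" for c y
    using that by (simp add: powr_add[of c 1 "- \<alpha>", simplified])
  \<comment> \<open>The cases place \<open>b / a\<close> to the left of, to the right of, or inside
    the interval. They are phrased without division and so include \<open>a = 0\<close>. In the
    first two, \<open>split\<close> shows which term dominates at the endpoint.\<close>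
  consider "b \<le> m * a" | "b > m * a" "b \<ge> M * a" | "b > m * a" "b < M * a" by linarith
  then show ?thesis
  proof cases
    case 1
    have "m powr (- \<alpha>) * b \<le> m powr (1 - \<alpha>) * a"
      using 1 m by (simp add: split mult_left_mono)
    then have "\<alpha> * (m powr (1 - \<alpha>) * a) + (1 - \<alpha>) * (m powr (- \<alpha>) * b) \<le> m powr (1 - \<alpha>) * a"
      by (intro convex) auto
    then show ?thesis using nn m by (intro bexI[of _ m]) (linarith, simp)
  next
    case 2
    then have "b > 0" using a m by (smt (verit) mult_nonneg_nonneg)
    have "M powr (1 - \<alpha>) * a \<le> M powr (- \<alpha>) * b"
      using 2 m by (simp add: split mult_left_mono)
    then have "\<alpha> * (M powr (1 - \<alpha>) * a) + (1 - \<alpha>) * (M powr (- \<alpha>) * b) \<le> M powr (- \<alpha>) * max b 0"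
      using \<open>b > 0\<close> by (intro convex) auto
    then show ?thesis using nn m by (intro bexI[of _ M]) (linarith, simp)
  next
    case 3
    then have ab: "a > 0" "b > 0" using a m 
      by (smt (verit) mult_nonneg_nonneg mult_eq_0_iff)+
    have "(b / a) powr (1 - \<alpha>) * a = a powr \<alpha> * b powr (1 - \<alpha>)"
      using ab by (simp add: powr_divide powr_diff)
    moreover have "(b / a) powr (- \<alpha>) * b = a powr \<alpha> * b powr (1 - \<alpha>)"
      using ab by (simp add: powr_divide powr_diff powr_minus field_simps)
    ultimately have "\<alpha> * ((b / a) powr (1 - \<alpha>) * a) + (1 - \<alpha>) * ((b / a) powr (- \<alpha>) * b)
        \<le> a powr \<alpha> * pos_powr b (1 - \<alpha>)"
      using ab by (intro convex) (auto simp: pos_powr_def)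
    moreover have "b / a \<in> {m..M}" using 3 ab by (auto simp: field_simps)
    ultimately show ?thesis using nn by (intro bexI[of _ "b / a"]) linarith
  qed
qed



subsection \<open>Extrema and averages over a ball\<close>

text \<open>A matrix is a function of two basis vectors, so that \<open>hess f y\<close> can serve
  directly as \<open>H\<close>.\<close>

definition bilinear_form :: "('a::euclidean_space \<Rightarrow> 'a \<Rightarrow> real) \<Rightarrow> 'a \<Rightarrow> 'a \<Rightarrow> real" where
  "bilinear_form H v w = (\<Sum>b\<in>Basis. \<Sum>c\<in>Basis. (v \<bullet> b) * (w \<bullet> c) * H b c)"

lemma bilinear_bilinear_form: "bilinear (bilinear_form H)"
  unfolding bilinear_def
  by (intro conjI allI linearI)
    (simp_all add: bilinear_form_def algebra_simps sum.distrib sum_distrib_left)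

text \<open>Moving from \<open>s \<nu>\<close> to \<open>s \<nu> + w\<close> inside the ball loses at least \<open>a |w|\<^sup>2 / (2s)\<close> in the linear term
  and gains at most \<open>2 s h |w|\<close> in the quadratic one.
  The assumption on \<open>a = 0\<close> makes the last summand, then \<open>0\<close>, correct; it covers expansions without
  quadratic term at a critical point.\<close>

lemma quadratic_le_on_ball:
  fixes Q :: "'a::euclidean_space \<Rightarrow> 'a \<Rightarrow> real"
  assumes s: "s > 0" and Q: "bilinear Q" and h: "\<And>v w. \<bar>Q v w\<bar> \<le> h * norm v * norm w"
    and \<nu>: "norm \<nu> = 1" and a: "a \<ge> 0" "a = 0 \<Longrightarrow> h = 0" and v: "norm v \<le> s"
  shows "a * (\<nu> \<bullet> v) + Q v v / 2 \<le> s * a + s\<^sup>2 / 2 * Q \<nu> \<nu> + 2 * s ^ 3 * h\<^sup>2 / a"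
proof -
  define w where "w = v - s *\<^sub>R \<nu>"
  have v_eq: "v = s *\<^sub>R \<nu> + w" by (simp add: w_def)
  have h0: "h \<ge> 0" using h[of \<nu> \<nu>] \<nu> by simp
  have \<nu>\<nu>: "\<nu> \<bullet> \<nu> = 1" using \<nu> by (simp add: norm_eq_1)
  have "norm w \<le> norm v + norm (s *\<^sub>R \<nu>)" unfolding w_def by (rule norm_triangle_ineq4)
  then have w2: "norm w \<le> 2 * s" using v s \<nu> by simp
  \<comment> \<open>The constraint |s \<nu> + w| \<le> s expands to 2 s (\<nu> \<bullet> w) \<le>
    -|w|^2, which is where the quadratic loss comes from.\<close>
  have "v \<bullet> v \<le> s\<^sup>2"
    using v by (simp add: power2_norm_eq_inner[symmetric] power_mono)
  then have "2 * s * (\<nu> \<bullet> w) \<le> - (w \<bullet> w)"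
    unfolding v_eq by (simp add: inner_add_left inner_add_right \<nu>\<nu> inner_commute power2_eq_square)
  then have "2 * s * (\<nu> \<bullet> w) \<le> - (norm w)\<^sup>2" by (simp add: power2_norm_eq_inner)
  then have "\<nu> \<bullet> w \<le> - (norm w)\<^sup>2 / (2 * s)" using s by (simp add: field_simps)
  then have 1: "a * (\<nu> \<bullet> v) \<le> s * a - a * ((norm w)\<^sup>2 / (2 * s))"
    unfolding v_eq using mult_left_mono[OF _ a(1)] by (fastforce simp: inner_add_right \<nu>\<nu> algebra_simps)
  have "Q v v = s\<^sup>2 * Q \<nu> \<nu> + s * (Q \<nu> w + Q w \<nu>) + Q w w"
    unfolding v_eq using Q by (simp add: bilinear_ladd bilinear_radd bilinear_lmul bilinear_rmul power2_eq_square algebra_simps)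
  moreover have "Q \<nu> w + Q w \<nu> \<le> 2 * h * norm w" using h[of \<nu> w] h[of w \<nu>] \<nu> by simp
  then have "s * (Q \<nu> w + Q w \<nu>) \<le> s * (2 * h * norm w)" using s by simp
  moreover have "Q w w \<le> h * norm w * (2 * s)"
    using h[of w w] mult_left_mono[OF w2, of "h * norm w"] h0 by simp
  ultimately have 2: "Q v v / 2 \<le> s\<^sup>2 / 2 * Q \<nu> \<nu> + 2 * s * h * norm w" by (simp add: algebra_simps)
  \<comment> \<open>Completing the square in |w|; the worst case is |w| = 2 s^2 h / a. If
    \<open>a = 0\<close>, then \<open>h = 0\<close> and both sides are 0.\<close>
  have 3: "2 * s * h * norm w - a * ((norm w)\<^sup>2 / (2 * s)) \<le> 2 * s ^ 3 * h\<^sup>2 / a"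
  proof (cases "a = 0")
    case False
    then have a0: "a > 0" using a by simp
    have "2 * s ^ 3 * h\<^sup>2 / a - (2 * s * h * norm w - a * ((norm w)\<^sup>2 / (2 * s))) = (a * norm w - 2 * s\<^sup>2 * h)\<^sup>2 / (2 * s * a)"
      using s a0 by (simp add: field_simps power2_eq_square power3_eq_cube)
    also have "\<dots> \<ge> 0" using s a0 by simp
    finally show ?thesis by simp
  qed (use a in simp)
  show ?thesis using 1 2 3 by linarith
qed

text \<open>\<open>quadratic_le_on_ball\<close> gives the upper bound, test points in the direction
  \<nu> the lower one. Taking \<open>Q\<close> and \<open>h\<close> zero yields a first-order
  expansion, and taking \<open>a\<close> zero as well yields a mere bound; both cases occur
  below.\<close>

lemma SUP_ball_expansion:
  fixes f :: "'a::euclidean_space \<Rightarrow> real"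
  assumes s: "s > 0" and Q: "bilinear Q" and h: "\<And>v w. \<bar>Q v w\<bar> \<le> h * norm v * norm w"
    and \<nu>: "norm \<nu> = 1" and a: "a \<ge> 0" "a = 0 \<Longrightarrow> h = 0"
    and f: "\<And>v. norm v < s \<Longrightarrow> \<bar>f (x + v) - (y0 + a * (\<nu> \<bullet> v) + Q v v / 2)\<bar> \<le> \<omega>"
  shows "\<bar>(SUP y\<in>ball x s. f y) - (y0 + s * a + s\<^sup>2 / 2 * Q \<nu> \<nu>)\<bar> \<le> \<omega> + 2 * s ^ 3 * h\<^sup>2 / a"
proof -
  have up: "f y \<le> y0 + s * a + s\<^sup>2 / 2 * Q \<nu> \<nu> + (\<omega> + 2 * s ^ 3 * h\<^sup>2 / a)" if "y \<in> ball x s" for y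
  proof -
    have n: "norm (y - x) < s" using that by (simp add: dist_norm norm_minus_commute)
    show ?thesis
      using f[OF n] quadratic_le_on_ball[OF s Q h \<nu> a less_imp_le[OF n]] by simp
  qed
  have bdd: "bdd_above (f ` ball x s)" using up by (intro bdd_aboveI2)
  have 1: "(SUP y\<in>ball x s. f y) \<le> y0 + s * a + s\<^sup>2 / 2 * Q \<nu> \<nu> + (\<omega> + 2 * s ^ 3 * h\<^sup>2 / a)"
    using s up by (intro cSUP_least) auto
  \<comment> \<open>The ball is open, so s \<nu> itself is not admissible. The test points are u s
    \<nu> with u < 1, and then u tends to 1.\<close>
  have low: "y0 + a * (u * s) + (u * s)\<^sup>2 / 2 * Q \<nu> \<nu> - \<omega> \<le> (SUP y\<in>ball x s. f y)" if u: "u \<in> {0<..<1}" for u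
  proof -
    let ?v = "(u * s) *\<^sub>R \<nu>"
    have n: "norm ?v < s" using u s \<nu> by (simp add: abs_mult)
    have "f (x + ?v) \<le> (SUP y\<in>ball x s. f y)"
      using n by (intro cSUP_upper[OF _ bdd]) (simp add: dist_norm)
    moreover have "a * (\<nu> \<bullet> ?v) = a * (u * s)" using \<nu> by (simp add: norm_eq_1)
    moreover have "Q ?v ?v / 2 = (u * s)\<^sup>2 / 2 * Q \<nu> \<nu>"
      using Q by (simp add: bilinear_lmul bilinear_rmul power2_eq_square)
    ultimately show ?thesis using f[OF n] by linarith
  qed
  have "((\<lambda>u. y0 + a * (u * s) + (u * s)\<^sup>2 / 2 * Q \<nu> \<nu> - \<omega>) \<longlongrightarrow>
      y0 + a * (1 * s) + (1 * s)\<^sup>2 / 2 * Q \<nu> \<nu> - \<omega>) (at_left 1)"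
    by (intro tendsto_intros) auto
  moreover have "eventually (\<lambda>u. y0 + a * (u * s) + (u * s)\<^sup>2 / 2 * Q \<nu> \<nu> - \<omega> \<le> (SUP y\<in>ball x s. f y)) (at_left 1)"
    unfolding eventually_at_left_field by (rule exI[of _ 0]) (use low in auto)
  ultimately have "y0 + a * (1 * s) + (1 * s)\<^sup>2 / 2 * Q \<nu> \<nu> - \<omega> \<le> (SUP y\<in>ball x s. f y)"
    by (rule tendsto_upperbound) simp
  moreover have "0 \<le> 2 * s ^ 3 * h\<^sup>2 / a" using s a by simp
  ultimately show ?thesis using 1 by (simp add: abs_le_iff algebra_simps)
qed

text \<open>\<open>Inf\<close> on the reals is defined through \<open>Sup\<close> in this way, so
  the identity holds for unbounded sets too. It makes the passage from f to -f exact.\<close>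

lemma INF_eq_uminus_SUP: "(INF y\<in>B. f y :: real) = - (SUP y\<in>B. - f y)"
  by (simp add: Inf_real_def image_image)

lemma INF_ball_expansion:
  fixes f :: "'a::euclidean_space \<Rightarrow> real"
  assumes s: "s > 0" and Q: "bilinear Q" and h: "\<And>v w. \<bar>Q v w\<bar> \<le> h * norm v * norm w"
    and \<nu>: "norm \<nu> = 1" and a: "a \<ge> 0" "a = 0 \<Longrightarrow> h = 0"
    and f: "\<And>v. norm v < s \<Longrightarrow> \<bar>f (x + v) - (y0 + a * (\<nu> \<bullet> v) + Q v v / 2)\<bar> \<le> \<omega>"
  shows "\<bar>(INF y\<in>ball x s. f y) - (y0 - s * a + s\<^sup>2 / 2 * Q \<nu> \<nu>)\<bar> \<le> \<omega> + 2 * s ^ 3 * h\<^sup>2 / a"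
proof -
  have Q': "bilinear (\<lambda>v w. - Q v w)"
    using Q by (simp add: bilinear_def linear_compose_neg)
  \<comment> \<open>For -f the gradient points along -\<nu>, while \<open>a\<close>,
    \<open>h\<close> and \<open>\<omega>\<close> stay the same.\<close>
  have "\<bar>(SUP y\<in>ball x s. - f y) - (- y0 + s * a + s\<^sup>2 / 2 * (- Q (- \<nu>) (- \<nu>)))\<bar> \<le> \<omega> + 2 * s ^ 3 * h\<^sup>2 / a"
  proof (rule SUP_ball_expansion[OF s Q'])
    fix v :: 'a assume "norm v < s"
    from f[OF this] show "\<bar>- f (x + v) - (- y0 + a * (- \<nu> \<bullet> v) + - Q v v / 2)\<bar> \<le> \<omega>"
      by (simp add: abs_le_iff)
  qed (use h \<nu> a in auto)
  then show ?thesis unfolding INF_eq_uminus_SUP using Q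
    by (simp add: bilinear_lneg bilinear_rneg abs_le_iff)
qed

lemma LINT_ball_shift:
  fixes h :: "'a::euclidean_space \<Rightarrow> real"
  assumes h: "h \<in> borel_measurable borel"
  shows "(LINT y:ball x s|lborel. h (y - x)) = (LINT v:ball 0 s|lborel. h v)"
proof -
  have "(LINT y:ball x s|lborel. h (y - x)) = (LINT y|distr lborel borel ((+) x). indicator (ball x s) y *\<^sub>R h (y - x))"
    by (simp add: lborel_distr_plus set_lebesgue_integral_def)
  also have "\<dots> = (LINT v|lborel. indicator (ball x s) (x + v) *\<^sub>R h (x + v - x))"
  proof (rule integral_distr)
    have "(\<lambda>y. h (y - x)) \<in> borel_measurable borel" using h by measurable
    then show "(\<lambda>y. indicator (ball x s) y *\<^sub>R h (y - x)) \<in> borel_measurable borel"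
      by (intro borel_measurable_scaleR borel_measurable_indicator) auto
  qed auto
  also have "\<dots> = (LINT v:ball 0 s|lborel. h v)"
    by (simp add: set_lebesgue_integral_def indicator_def dist_norm)
  finally show ?thesis .
qed

text \<open>The quadratic polynomial is integrated exactly, and averaging an error bounded by
  \<open>\<omega>\<close> does not enlarge it.\<close>

lemma ball_average_expansion:
  fixes f :: "'a::euclidean_space \<Rightarrow> real"
  assumes s: "s > 0" and int: "set_integrable lborel (ball x s) f"
    and f: "\<And>v. norm v < s \<Longrightarrow> \<bar>f (x + v) - (y0 + a * (\<nu> \<bullet> v) + bilinear_form H v v / 2)\<bar> \<le> \<omega>"
  shows "\<bar>1 / measure lborel (ball x s) * (LINT y:ball x s|lborel. f y)
      - (y0 + s\<^sup>2 / (2 * (DIM('a) + 2)) * (\<Sum>b\<in>Basis. H b b))\<bar> \<le> \<omega>"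
proof -
  let ?V = "measure lborel (ball x s)"
  define q where "q v = y0 + (a *\<^sub>R \<nu>) \<bullet> v + (\<Sum>b\<in>Basis. \<Sum>c\<in>Basis. (v \<bullet> b) * (v \<bullet> c) * H b c) / 2" for v
  have V: "?V > 0" using s by simp
  have V0: "measure lborel (ball (0::'a) s) = ?V" using s by (simp add: content_ball)
  have q: "continuous_on UNIV q" unfolding q_def by (intro continuous_intros) auto
  have iq: "set_integrable lborel (ball x s) (\<lambda>y. q (y - x))"
    by (rule set_integrable_continuous_ball) (intro continuous_intros continuous_on_compose2[OF q], auto)
  have Iq: "(LINT y:ball x s|lborel. q (y - x)) = (y0 + s\<^sup>2 / (2 * (DIM('a) + 2)) * (\<Sum>b\<in>Basis. H b b)) * ?V"
    unfolding LINT_ball_shift[OF borel_measurable_continuous_onI[OF q]] unfolding q_def V0[symmetric]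
    by (rule ball_average_quadratic[OF s])
  have id: "set_integrable lborel (ball x s) (\<lambda>y. f y - q (y - x))"
    using int iq by (rule set_integral_diff)
  have ic: "set_integrable lborel (ball x s) (\<lambda>y. \<omega>)"
    by (rule set_integrable_continuous_ball) (intro continuous_intros)
  have "\<bar>LINT y:ball x s|lborel. f y - q (y - x)\<bar> \<le> (LINT y:ball x s|lborel. \<bar>f y - q (y - x)\<bar>)"
    using set_integral_norm_bound[OF id] by simp
  also have "\<dots> \<le> (LINT y:ball x s|lborel. \<omega>)"
  proof (rule set_integral_mono)
    show "set_integrable lborel (ball x s) (\<lambda>y. \<bar>f y - q (y - x)\<bar>)" 
      using set_integrable_norm[OF id] by simp
    fix y assume "y \<in> ball x s"
    then have "norm (y - x) < s" by (simp add: dist_norm norm_minus_commute)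
    from f[OF this] show "\<bar>f y - q (y - x)\<bar> \<le> \<omega>" by (simp add: q_def bilinear_form_def)
  qed (rule ic)
  also have "\<dots> = \<omega> * ?V" by (simp add: set_lebesgue_integral_def)
  finally have "\<bar>(LINT y:ball x s|lborel. f y) - (LINT y:ball x s|lborel. q (y - x))\<bar> \<le> \<omega> * ?V"
    by (simp add: set_integral_diff(2)[OF int iq])
  then have "\<bar>(LINT y:ball x s|lborel. f y) - (LINT y:ball x s|lborel. q (y - x))\<bar> / ?V \<le> \<omega>"
    using V by (simp add: pos_divide_le_eq)
  also have "\<bar>(LINT y:ball x s|lborel. f y) - (LINT y:ball x s|lborel. q (y - x))\<bar> / ?V
     = \<bar>1 / ?V * (LINT y:ball x s|lborel. f y) - (y0 + s\<^sup>2 / (2 * (DIM('a) + 2)) * (\<Sum>b\<in>Basis. H b b))\<bar>"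
  proof -
    have "\<bar>I - c * V\<bar> / V = \<bar>1 / V * I - c\<bar>" if "V > 0" for I c V :: real
    proof -
      have "1 / V * I - c = (I - c * V) / V" using that by (simp add: field_simps)
      then show ?thesis using that by simp
    qed
    then show ?thesis unfolding Iq using V by blast
  qed
  finally show ?thesis .
qed

text \<open>The terms s a and -s a cancel between supremum and infimum. The values of
  \<open>beta\<close> and \<open>gamma\<close> are those for which the remaining coefficients become
  \<rho>^2 for the trace and (p - 2) \<rho>^2 for the second derivative along \<nu>; see
  \<open>bs\<close> and \<open>cs\<close>.\<close>

lemma mean_op_expansion:
  fixes f :: "'a::euclidean_space \<Rightarrow> real" and p \<rho> :: real
  defines "s \<equiv> gamma DIM('a) p * \<rho>"
  assumes p: "p > 2" and \<rho>: "\<rho> > 0" and int: "set_integrable lborel (ball x s) f"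
    and h: "\<And>v w. \<bar>bilinear_form H v w\<bar> \<le> h * norm v * norm w"
    and \<nu>: "norm \<nu> = 1" and a: "a \<ge> 0" "a = 0 \<Longrightarrow> h = 0"
    and f: "\<And>v. norm v < s \<Longrightarrow> \<bar>f (x + v) - (y0 + a * (\<nu> \<bullet> v) + bilinear_form H v v / 2)\<bar> \<le> \<omega>"
  shows "\<bar>mean_op p \<rho> f x - (y0 + \<rho>\<^sup>2 * ((\<Sum>b\<in>Basis. H b b) + (p - 2) * bilinear_form H \<nu> \<nu>))\<bar>
    \<le> \<omega> + 2 * s ^ 3 * h\<^sup>2 / a"
proof -
  let ?d = "real DIM('a)" and ?Q = "bilinear_form H \<nu> \<nu>" and ?tr = "\<Sum>b\<in>Basis. H b b"
  define b where "b = beta DIM('a) p"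
  define A where "A = 1 / measure lborel (ball x s) * (LINT y:ball x s|lborel. f y)"
  define S where "S = (SUP y\<in>ball x s. f y)"
  define I where "I = (INF y\<in>ball x s. f y)"
  define e where "e = 2 * s ^ 3 * h\<^sup>2 / a"
  have b: "0 \<le> b" "b \<le> 1" using p by (auto simp: b_def beta_def field_simps)
  have s: "s > 0" using p \<rho> by (simp add: s_def gamma_def)
  have s2: "s\<^sup>2 = 2 * (p + ?d) * \<rho>\<^sup>2" using p by (simp add: s_def gamma_def power_mult_distrib)
  have e: "e \<ge> 0" using s a by (simp add: e_def)
  have bs: "b * s\<^sup>2 / 2 = (p - 2) * \<rho>\<^sup>2" unfolding s2 b_def beta_def using p by (simp add: field_simps)
  have cs: "(1 - b) * (s\<^sup>2 / (2 * (?d + 2))) = \<rho>\<^sup>2"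
  proof -
    have "1 - b = (?d + 2) / (p + ?d)" using p by (simp add: b_def beta_def field_simps)
    then show ?thesis using p unfolding s2 by (simp add: divide_simps) (simp add: algebra_simps)
  qed
  note ex = s bilinear_bilinear_form h \<nu> a f
  have S: "\<bar>S - (y0 + s * a + s\<^sup>2 / 2 * ?Q)\<bar> \<le> \<omega> + e"
    unfolding S_def e_def by (rule SUP_ball_expansion[OF ex])
  have I: "\<bar>I - (y0 - s * a + s\<^sup>2 / 2 * ?Q)\<bar> \<le> \<omega> + e"
    unfolding I_def e_def by (rule INF_ball_expansion[OF ex])
  have A: "\<bar>A - (y0 + s\<^sup>2 / (2 * (?d + 2)) * ?tr)\<bar> \<le> \<omega>"
    unfolding A_def using ball_average_expansion[OF s int f] by (simp add: add.commute)
  have "mean_op p \<rho> f x - (y0 + \<rho>\<^sup>2 * (?tr + (p - 2) * ?Q))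
     = b * ((S + I) / 2) + (1 - b) * A - (y0 + ((1 - b) * (s\<^sup>2 / (2 * (?d + 2)))) * ?tr + (b * s\<^sup>2 / 2) * ?Q)"
    unfolding bs cs by (simp add: mean_op_def Let_def S_def I_def A_def b_def s_def algebra_simps)
  also have "\<dots> = b * ((S + I) / 2 - (y0 + s\<^sup>2 / 2 * ?Q)) + (1 - b) * (A - (y0 + s\<^sup>2 / (2 * (?d + 2)) * ?tr))"
    by (simp add: algebra_simps)
  finally have eq: "mean_op p \<rho> f x - (y0 + \<rho>\<^sup>2 * (?tr + (p - 2) * ?Q))
     = b * ((S + I) / 2 - (y0 + s\<^sup>2 / 2 * ?Q)) + (1 - b) * (A - (y0 + s\<^sup>2 / (2 * (?d + 2)) * ?tr))" .
  have "\<bar>(S + I) / 2 - (y0 + s\<^sup>2 / 2 * ?Q)\<bar> \<le> \<omega> + e" using S I by (simp add: abs_le_iff field_simps)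
  then have 1: "\<bar>b * ((S + I) / 2 - (y0 + s\<^sup>2 / 2 * ?Q))\<bar> \<le> b * (\<omega> + e)"
    using b by (simp add: abs_mult mult_left_mono)
  have 2: "\<bar>(1 - b) * (A - (y0 + s\<^sup>2 / (2 * (?d + 2)) * ?tr))\<bar> \<le> (1 - b) * (\<omega> + e)"
    using b A e by (simp add: abs_mult mult_left_mono)
  have "b * (\<omega> + e) + (1 - b) * (\<omega> + e) = \<omega> + e" by (simp add: algebra_simps)
  then show ?thesis unfolding eq using 1 2 by (fold e_def) linarith
qed



subsection \<open>The operator\<close>

lemma alpha_bounds:
  assumes "p > 2"
  shows "0 < alpha p" "alpha p < 1" "1 - alpha p = 1 / (p - 1)"
  using assms by (auto simp: alpha_def field_simps)

lemma c_lo_le_c_hi: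
  assumes p: "p > 2" and \<epsilon>: "0 < \<epsilon>" "\<epsilon> < 1"
  shows "c_lo p \<epsilon> \<le> c_hi p \<epsilon>" "0 < c_lo p \<epsilon>"
proof -
  have "- 2 + 2 / p \<le> 2 * (p - 1) / (3 * p - 4)"
  proof -
    have "2 / p \<le> 1" "0 \<le> 2 * (p - 1) / (3 * p - 4)" using p by auto
    then show ?thesis by linarith
  qed
  then show "c_lo p \<epsilon> \<le> c_hi p \<epsilon>" unfolding c_lo_def c_hi_def
    using \<epsilon> by (intro powr_mono') auto
  show "0 < c_lo p \<epsilon>" using \<epsilon> by (simp add: c_lo_def)
qed

section \<open>Truncation costs and radii at the endpoints of the parameter interval\<close>

lemma c_lo_powr:
  assumes p: "p > 2" and \<epsilon>: "0 < \<epsilon>"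
  shows "c_lo p \<epsilon> powr (1 - alpha p) = \<epsilon> powr (2 / (3 * p - 4))"
proof -
  have "2 * (p - 1) / (3 * p - 4) * (1 - alpha p) = 2 / (3 * p - 4)"
    unfolding alpha_bounds(3)[OF p] using p by (simp add: divide_simps)
  then show ?thesis by (simp only: c_lo_def powr_powr)
qed

lemma c_hi_powr:
  assumes p: "p > 2" and \<epsilon>: "0 < \<epsilon>"
  shows "c_hi p \<epsilon> powr (- alpha p) = \<epsilon> powr (2 - 4 / p)"
proof -
  have "(- 2 + 2 / p) * - alpha p = 2 - 4 / p"
    unfolding alpha_def using p by (simp add: divide_simps) (simp add: algebra_simps)
  then show ?thesis by (simp add: c_hi_def powr_powr)
qed

text \<open>This radius increases with \<open>c\<close>, so \<open>c_hi\<close> is the worst case.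
  The exponent 2 - 4/p is the one of \<open>c_hi_powr\<close>, which is the balance that determines
  \<open>c_hi\<close>.\<close>

lemma sup_radius_sq_le:
  assumes p: "p > 2" and \<epsilon>: "0 < \<epsilon>" "\<epsilon> < 1" and c: "c \<in> {c_lo p \<epsilon>..c_hi p \<epsilon>}"
  shows "(\<epsilon>\<^sup>2 * c powr (1 - alpha p))\<^sup>2 \<le> \<epsilon>\<^sup>2 * \<epsilon> powr (2 - 4 / p)"
proof -
  have "c powr (1 - alpha p) \<le> c_hi p \<epsilon> powr (1 - alpha p)"
    using c c_lo_le_c_hi[OF p \<epsilon>] alpha_bounds(1,2)[OF p] by (intro powr_mono2) auto
  also have "\<dots> = \<epsilon> powr ((- 2 + 2 / p) * (1 - alpha p))" by (simp add: c_hi_def powr_powr)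
  also have "(- 2 + 2 / p) * (1 - alpha p) = - 2 / p"
    unfolding alpha_bounds(3)[OF p] using p by (simp add: divide_simps)
  finally have "(c powr (1 - alpha p))\<^sup>2 \<le> (\<epsilon> powr (- 2 / p))\<^sup>2" by (intro power_mono) auto
  also have "(\<epsilon> powr (- 2 / p))\<^sup>2 = \<epsilon> powr (- 4 / p)"
    by (simp add: power2_eq_square flip: powr_add)
  finally have "\<epsilon>\<^sup>2 * (\<epsilon>\<^sup>2 * (c powr (1 - alpha p))\<^sup>2) \<le> \<epsilon>\<^sup>2 * (\<epsilon>\<^sup>2 * \<epsilon> powr (- 4 / p))"
    using \<epsilon> by simp
  also have "\<epsilon>\<^sup>2 * \<epsilon> powr (- 4 / p) = \<epsilon> powr (2 - 4 / p)"
    using \<epsilon> by (simp add: powr_diff powr_minus powr_numeral field_simps)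
  finally show ?thesis by (simp add: power_mult_distrib power2_eq_square mult_ac)
qed

text \<open>This radius decreases with \<open>c\<close>, so \<open>c_lo\<close> is the worst case.
  The cube is the order of the remainders of the average in the C^3 case, and the exponent agrees
  with \<open>c_lo_powr\<close>.\<close>

lemma mean_radius_cube_le:
  assumes p: "p > 2" and \<epsilon>: "0 < \<epsilon>" "\<epsilon> < 1" and c: "c \<in> {c_lo p \<epsilon>..c_hi p \<epsilon>}"
  shows "(\<epsilon> * c powr (- alpha p / 2)) ^ 3 \<le> \<epsilon>\<^sup>2 * \<epsilon> powr (2 / (3 * p - 4))"
proof -
  have "c powr (- alpha p / 2) \<le> c_lo p \<epsilon> powr (- alpha p / 2)"
    using c c_lo_le_c_hi[OF p \<epsilon>] alpha_bounds[OF p] by (intro powr_mono2') auto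
  also have "\<dots> = \<epsilon> powr (2 * (p - 1) / (3 * p - 4) * (- alpha p / 2))" by (simp add: c_lo_def powr_powr)
  also have "2 * (p - 1) / (3 * p - 4) * (- alpha p / 2) = - (p - 2) / (3 * p - 4)"
    unfolding alpha_def using p by (simp add: divide_simps) (simp add: algebra_simps)
  finally have "\<epsilon> * c powr (- alpha p / 2) \<le> \<epsilon> powr 1 * \<epsilon> powr (- (p - 2) / (3 * p - 4))"
    using \<epsilon> by simp
  also have "\<dots> = \<epsilon> powr (1 + - (p - 2) / (3 * p - 4))" by (rule powr_add[symmetric])
  finally have "(\<epsilon> * c powr (- alpha p / 2)) ^ 3 \<le> (\<epsilon> powr (1 + - (p - 2) / (3 * p - 4))) ^ 3"
    using \<epsilon> by (intro power_mono) auto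
  also have "\<dots> = \<epsilon> powr (3 * (1 + - (p - 2) / (3 * p - 4)))"
    using \<epsilon> by (simp add: powr_powr mult.commute flip: powr_realpow)
  also have "3 * (1 + - (p - 2) / (3 * p - 4)) = 2 + 2 / (3 * p - 4)"
    using p by (simp add: divide_simps)
  also have "\<epsilon> powr \<dots> = \<epsilon>\<^sup>2 * \<epsilon> powr (2 / (3 * p - 4))" using \<epsilon> by (simp add: powr_add powr_numeral)
  finally show ?thesis .
qed

lemma mean_radius_sq:
  assumes "c > 0"
  shows "(\<epsilon> * c powr (- alpha p / 2))\<^sup>2 = \<epsilon>\<^sup>2 * c powr (- alpha p)"
  using assms by (simp add: power_mult_distrib power2_eq_square flip: powr_add)

section \<open>Reduction to one half of the operator, and its two-sided bounds\<close>

lemma mean_op_uminus: "mean_op p \<rho> (\<lambda>y. - f y) x = - mean_op p \<rho> f x"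
proof -
  have "(INF y\<in>B. - f y) = - (SUP y\<in>B. f y)" for B using INF_eq_uminus_SUP[of "\<lambda>y. - f y" B] by simp
  moreover have "(SUP y\<in>B. - f y) = - (INF y\<in>B. f y)" for B using INF_eq_uminus_SUP[of f B] by simp
  moreover have "(LINT y:B|lborel. - f y) = - (LINT y:B|lborel. f y)" for B
    by (simp add: set_lebesgue_integral_def)
  ultimately show ?thesis by (simp add: mean_op_def Let_def algebra_simps)
qed

lemma lower_val_eq: "lower_val p \<epsilon> f x c = - upper_val p \<epsilon> (\<lambda>y. - f y) x c"
  by (simp add: lower_val_def upper_val_def mean_op_uminus INF_eq_uminus_SUP[of f] algebra_simps)

definition upper_part :: "real \<Rightarrow> real \<Rightarrow> ('a::euclidean_space \<Rightarrow> real) \<Rightarrow> 'a \<Rightarrow> real" where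
  "upper_part p \<epsilon> f x = max (INF c\<in>{c_lo p \<epsilon>..c_hi p \<epsilon>}. upper_val p \<epsilon> f x c) (f x)"

lemma A_op_eq_upper_part: "A_op p \<epsilon> f x = (upper_part p \<epsilon> f x - upper_part p \<epsilon> (\<lambda>y. - f y) x) / 2"
proof -
  have "min (SUP c\<in>{c_lo p \<epsilon>..c_hi p \<epsilon>}. lower_val p \<epsilon> f x c) (f x) = - upper_part p \<epsilon> (\<lambda>y. - f y) x"
    unfolding upper_part_def INF_eq_uminus_SUP by (simp add: lower_val_eq)
  then show ?thesis by (simp add: A_op_def upper_part_def)
qed

text \<open>Two kinds of error are separated: one proportional to \<rho>^2 = \<epsilon>^2
  c^(-\<alpha>) scales in \<open>c\<close> exactly as \<open>L\<close> does and merges with it,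
  while \<epsilon>^2 \<theta> is uniform in \<open>c\<close> and is added at the end. The lower
  bound uses Young's inequality at every \<open>c\<close>; the upper bound uses one good
  \<open>c\<close>.\<close>

lemma upper_part_expansion:
  fixes f :: "'a::euclidean_space \<Rightarrow> real"
  assumes p: "p > 2" and \<epsilon>: "0 < \<epsilon>" "\<epsilon> < 1"
    and a: "a \<ge> 0" and K: "K \<ge> 0" and \<eta>: "\<eta> \<ge> 0" and \<theta>: "\<theta> \<ge> 0"
    and bdd: "bdd_below (upper_val p \<epsilon> f x ` {c_lo p \<epsilon>..c_hi p \<epsilon>})"
    and S: "\<And>c. c \<in> {c_lo p \<epsilon>..c_hi p \<epsilon>} \<Longrightarrow>
      \<bar>(SUP y\<in>ball x (\<epsilon>\<^sup>2 * c powr (1 - alpha p)). f y) - (f x + \<epsilon>\<^sup>2 * c powr (1 - alpha p) * a)\<bar>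
        \<le> K * (\<epsilon>\<^sup>2 * c powr (1 - alpha p))\<^sup>2 / 2"
    and M: "\<And>c. c \<in> {c_lo p \<epsilon>..c_hi p \<epsilon>} \<Longrightarrow>
      \<bar>mean_op p (\<epsilon> * c powr (- alpha p / 2)) f x - (f x + (\<epsilon> * c powr (- alpha p / 2))\<^sup>2 * L)\<bar>
        \<le> (\<epsilon> * c powr (- alpha p / 2))\<^sup>2 * \<eta> + \<epsilon>\<^sup>2 * \<theta>"
  defines "\<delta> \<equiv> K / 2 * \<epsilon> powr (2 - 4 / p) + \<theta>"
  shows "f x + \<epsilon>\<^sup>2 * (a powr alpha p * pos_powr (L - \<eta>) (1 - alpha p) - \<delta>) \<le> upper_part p \<epsilon> f x"
    and "upper_part p \<epsilon> f x \<le> f x + \<epsilon>\<^sup>2 * (a powr alpha p * pos_powr (L + \<eta>) (1 - alpha p)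
      + \<epsilon> powr (2 / (3 * p - 4)) * a + \<epsilon> powr (2 - 4 / p) * max (L + \<eta>) 0 + \<delta>)"
proof -
  define \<alpha> where "\<alpha> = alpha p"
  define \<Psi> where "\<Psi> b c = \<alpha> * (c powr (1 - \<alpha>) * a) + (1 - \<alpha>) * (c powr (- \<alpha>) * b)" for b c
  note al = alpha_bounds(1,2)[OF p, folded \<alpha>_def]
  note cc = c_lo_le_c_hi[OF p \<epsilon>]
  have val: "f x + \<epsilon>\<^sup>2 * (\<Psi> (L - \<eta>) c - \<delta>) \<le> upper_val p \<epsilon> f x c \<and>
      upper_val p \<epsilon> f x c \<le> f x + \<epsilon>\<^sup>2 * (\<Psi> (L + \<eta>) c + \<delta>)"
    if c: "c \<in> {c_lo p \<epsilon>..c_hi p \<epsilon>}" for c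
  proof -
    have c0: "c > 0" using c cc by auto
    define s where "s = (SUP y\<in>ball x (\<epsilon>\<^sup>2 * c powr (1 - \<alpha>)). f y) - f x - \<epsilon>\<^sup>2 * c powr (1 - \<alpha>) * a"
    define q where "q = mean_op p (\<epsilon> * c powr (- \<alpha> / 2)) f x - f x - \<epsilon>\<^sup>2 * c powr (- \<alpha>) * L"
    have "\<bar>s\<bar> \<le> K * (\<epsilon>\<^sup>2 * c powr (1 - alpha p))\<^sup>2 / 2"
      using S[OF c] by (simp add: s_def \<alpha>_def algebra_simps)
    also have "\<dots> \<le> K * (\<epsilon>\<^sup>2 * \<epsilon> powr (2 - 4 / p)) / 2"
      using sup_radius_sq_le[OF p \<epsilon> c] K by (intro divide_right_mono mult_left_mono) auto
    finally have s: "\<bar>s\<bar> \<le> \<epsilon>\<^sup>2 * (K / 2 * \<epsilon> powr (2 - 4 / p))" by (simp add: mult_ac)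
    have q: "\<bar>q\<bar> \<le> \<epsilon>\<^sup>2 * c powr (- \<alpha>) * \<eta> + \<epsilon>\<^sup>2 * \<theta>"
      using M[OF c] unfolding mean_radius_sq[OF c0] by (simp add: q_def \<alpha>_def algebra_simps)
    have s1: "\<alpha> * \<bar>s\<bar> \<le> \<epsilon>\<^sup>2 * (K / 2 * \<epsilon> powr (2 - 4 / p))"
    proof -
      have "\<alpha> * \<bar>s\<bar> \<le> 1 * \<bar>s\<bar>" using al by (intro mult_right_mono) auto
      then show ?thesis using s by simp
    qed
    have q1: "(1 - \<alpha>) * \<bar>q\<bar> \<le> (1 - \<alpha>) * (\<epsilon>\<^sup>2 * c powr (- \<alpha>) * \<eta>) + \<epsilon>\<^sup>2 * \<theta>"
    proof -
      have "(1 - \<alpha>) * \<bar>q\<bar> \<le> (1 - \<alpha>) * (\<epsilon>\<^sup>2 * c powr (- \<alpha>) * \<eta> + \<epsilon>\<^sup>2 * \<theta>)"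
        using q al by (intro mult_left_mono) auto
      moreover have "(1 - \<alpha>) * (\<epsilon>\<^sup>2 * \<theta>) \<le> 1 * (\<epsilon>\<^sup>2 * \<theta>)"
        using al \<theta> by (intro mult_right_mono) auto
      ultimately show ?thesis by (simp add: distrib_left)
    qed
    have "upper_val p \<epsilon> f x c = f x + \<epsilon>\<^sup>2 * \<Psi> L c + \<alpha> * s + (1 - \<alpha>) * q"
      by (simp add: upper_val_def \<Psi>_def s_def q_def \<alpha>_def algebra_simps)
    moreover have "\<epsilon>\<^sup>2 * \<Psi> (L - \<eta>) c = \<epsilon>\<^sup>2 * \<Psi> L c - (1 - \<alpha>) * (\<epsilon>\<^sup>2 * c powr (- \<alpha>) * \<eta>)"
      "\<epsilon>\<^sup>2 * \<Psi> (L + \<eta>) c = \<epsilon>\<^sup>2 * \<Psi> L c + (1 - \<alpha>) * (\<epsilon>\<^sup>2 * c powr (- \<alpha>) * \<eta>)"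
      by (simp_all add: \<Psi>_def algebra_simps)
    moreover have "\<bar>\<alpha> * s\<bar> = \<alpha> * \<bar>s\<bar>" "\<bar>(1 - \<alpha>) * q\<bar> = (1 - \<alpha>) * \<bar>q\<bar>"
      using al by (simp_all add: abs_mult)
    ultimately show ?thesis using s1 q1
      unfolding \<delta>_def distrib_left right_diff_distrib by linarith
  qed
  have \<delta>: "\<delta> \<ge> 0" using K \<theta> by (simp add: \<delta>_def)
  show "f x + \<epsilon>\<^sup>2 * (a powr alpha p * pos_powr (L - \<eta>) (1 - alpha p) - \<delta>) \<le> upper_part p \<epsilon> f x"
  \<comment> \<open>If L - \<eta> \<le> 0, the power of the positive part is 0 and the maximum with
    \<open>f x\<close> suffices. Otherwise L - \<eta> is its own positive part and Young's
    inequality applies to it.\<close>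
  proof (cases "L - \<eta> \<le> 0")
    case True
    then have "f x + \<epsilon>\<^sup>2 * (a powr alpha p * pos_powr (L - \<eta>) (1 - alpha p) - \<delta>) \<le> f x"
      using \<delta> by (simp add: pos_powr_def max_def)
    then show ?thesis by (simp add: upper_part_def)
  next
    case False
    have "f x + \<epsilon>\<^sup>2 * (a powr alpha p * pos_powr (L - \<eta>) (1 - alpha p) - \<delta>)
        \<le> (INF c\<in>{c_lo p \<epsilon>..c_hi p \<epsilon>}. upper_val p \<epsilon> f x c)"
    proof (rule cINF_greatest)
      fix c assume c: "c \<in> {c_lo p \<epsilon>..c_hi p \<epsilon>}"
      then have "c > 0" using cc by auto
      have "a powr alpha p * pos_powr (L - \<eta>) (1 - alpha p) \<le> \<Psi> (L - \<eta>) c"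
        using weighted_young[OF al \<open>c > 0\<close> a, of "L - \<eta>"] False by (simp add: \<Psi>_def \<alpha>_def max_def)
      then have "\<epsilon>\<^sup>2 * (a powr alpha p * pos_powr (L - \<eta>) (1 - alpha p) - \<delta>) \<le> \<epsilon>\<^sup>2 * (\<Psi> (L - \<eta>) c - \<delta>)"
        by (intro mult_left_mono) auto
      then show "f x + \<epsilon>\<^sup>2 * (a powr alpha p * pos_powr (L - \<eta>) (1 - alpha p) - \<delta>) \<le> upper_val p \<epsilon> f x c"
        using val[OF c] by linarith
    qed (use cc in auto)
    then show ?thesis by (simp add: upper_part_def)
  qed
  obtain c where c: "c \<in> {c_lo p \<epsilon>..c_hi p \<epsilon>}" and "\<Psi> (L + \<eta>) c \<le>
      a powr \<alpha> * pos_powr (L + \<eta>) (1 - \<alpha>) + c_lo p \<epsilon> powr (1 - \<alpha>) * a + c_hi p \<epsilon> powr (- \<alpha>) * max (L + \<eta>) 0"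
    using weighted_young_truncated[OF al cc(2,1) a] unfolding \<Psi>_def by blast
  then have "\<Psi> (L + \<eta>) c + \<delta> \<le> a powr alpha p * pos_powr (L + \<eta>) (1 - alpha p)
      + \<epsilon> powr (2 / (3 * p - 4)) * a + \<epsilon> powr (2 - 4 / p) * max (L + \<eta>) 0 + \<delta>"
    using \<epsilon> p by (simp add: \<alpha>_def c_lo_powr c_hi_powr)
  then have "\<epsilon>\<^sup>2 * (\<Psi> (L + \<eta>) c + \<delta>) \<le> \<epsilon>\<^sup>2 * (a powr alpha p * pos_powr (L + \<eta>) (1 - alpha p)
      + \<epsilon> powr (2 / (3 * p - 4)) * a + \<epsilon> powr (2 - 4 / p) * max (L + \<eta>) 0 + \<delta>)"
    by (rule mult_left_mono) simp
  moreover have "(INF c\<in>{c_lo p \<epsilon>..c_hi p \<epsilon>}. upper_val p \<epsilon> f x c) \<le> upper_val p \<epsilon> f x c"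
    by (rule cINF_lower[OF bdd c])
  \<comment> \<open>The upper bound has to dominate \<open>f x\<close> as well, the other argument
    of the maximum.\<close>
  moreover have "0 \<le> \<epsilon>\<^sup>2 * (a powr alpha p * pos_powr (L + \<eta>) (1 - alpha p)
      + \<epsilon> powr (2 / (3 * p - 4)) * a + \<epsilon> powr (2 - 4 / p) * max (L + \<eta>) 0 + \<delta>)"
    using a \<delta> by (simp add: pos_powr_nonneg)
  ultimately show "upper_part p \<epsilon> f x \<le> f x + \<epsilon>\<^sup>2 * (a powr alpha p * pos_powr (L + \<eta>) (1 - alpha p)
      + \<epsilon> powr (2 / (3 * p - 4)) * a + \<epsilon> powr (2 - 4 / p) * max (L + \<eta>) 0 + \<delta>)"
    using val[OF c] unfolding upper_part_def by simp
qed

text \<open>A lower bound for A pairs the lower bound for f with the upper bound for -f, where L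
  becomes -L. The arguments L - \<eta> and -L + \<eta> are opposite, so the two positive parts
  combine into a single signed power; likewise with L + \<eta> for the upper bound.\<close>

lemma A_op_expansion:
  fixes f :: "'a::euclidean_space \<Rightarrow> real"
  assumes p: "p > 2" and \<epsilon>: "0 < \<epsilon>" "\<epsilon> < 1"
    and a: "a \<ge> 0" and K: "K \<ge> 0" and \<eta>: "\<eta> \<ge> 0" and \<theta>: "\<theta> \<ge> 0"
    and wd: "A_well_defined p \<epsilon> R f x"
    and S: "\<And>c. c \<in> {c_lo p \<epsilon>..c_hi p \<epsilon>} \<Longrightarrow>
      \<bar>(SUP y\<in>ball x (\<epsilon>\<^sup>2 * c powr (1 - alpha p)). f y) - (f x + \<epsilon>\<^sup>2 * c powr (1 - alpha p) * a)\<bar>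
        \<le> K * (\<epsilon>\<^sup>2 * c powr (1 - alpha p))\<^sup>2 / 2"
    and I: "\<And>c. c \<in> {c_lo p \<epsilon>..c_hi p \<epsilon>} \<Longrightarrow>
      \<bar>(INF y\<in>ball x (\<epsilon>\<^sup>2 * c powr (1 - alpha p)). f y) - (f x - \<epsilon>\<^sup>2 * c powr (1 - alpha p) * a)\<bar>
        \<le> K * (\<epsilon>\<^sup>2 * c powr (1 - alpha p))\<^sup>2 / 2"
    and M: "\<And>c. c \<in> {c_lo p \<epsilon>..c_hi p \<epsilon>} \<Longrightarrow>
      \<bar>mean_op p (\<epsilon> * c powr (- alpha p / 2)) f x - (f x + (\<epsilon> * c powr (- alpha p / 2))\<^sup>2 * L)\<bar>
        \<le> (\<epsilon> * c powr (- alpha p / 2))\<^sup>2 * \<eta> + \<epsilon>\<^sup>2 * \<theta>"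
  defines "\<kappa> \<equiv> \<epsilon> powr (2 / (3 * p - 4)) * a + \<epsilon> powr (2 - 4 / p) * (\<bar>L\<bar> + \<eta> + K) + 2 * \<theta>"
  shows "\<epsilon>\<^sup>2 / 2 * (a powr alpha p * signed_power (L - \<eta>) (1 - alpha p) - \<kappa>) \<le> A_op p \<epsilon> f x - f x"
    and "A_op p \<epsilon> f x - f x \<le> \<epsilon>\<^sup>2 / 2 * (a powr alpha p * signed_power (L + \<eta>) (1 - alpha p) + \<kappa>)"
proof -
  have bu: "bdd_below (upper_val p \<epsilon> f x ` {c_lo p \<epsilon>..c_hi p \<epsilon>})"
    using wd bounded_imp_bdd_below by (auto simp: A_well_defined_def)
  have "bdd_above (lower_val p \<epsilon> f x ` {c_lo p \<epsilon>..c_hi p \<epsilon>})"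
    using wd bounded_imp_bdd_above by (auto simp: A_well_defined_def)
  then have "bdd_below (uminus ` (lower_val p \<epsilon> f x ` {c_lo p \<epsilon>..c_hi p \<epsilon>}))"
    by (simp add: bdd_below_uminus)
  then have bl: "bdd_below (upper_val p \<epsilon> (\<lambda>y. - f y) x ` {c_lo p \<epsilon>..c_hi p \<epsilon>})"
    by (simp add: image_image lower_val_eq)
  have S': "\<bar>(SUP y\<in>ball x (\<epsilon>\<^sup>2 * c powr (1 - alpha p)). - f y) - (- f x + \<epsilon>\<^sup>2 * c powr (1 - alpha p) * a)\<bar>
        \<le> K * (\<epsilon>\<^sup>2 * c powr (1 - alpha p))\<^sup>2 / 2" if "c \<in> {c_lo p \<epsilon>..c_hi p \<epsilon>}" for c
    using I[OF that] unfolding INF_eq_uminus_SUP by (simp only: abs_le_iff) linarith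
  have M': "\<bar>mean_op p (\<epsilon> * c powr (- alpha p / 2)) (\<lambda>y. - f y) x - (- f x + (\<epsilon> * c powr (- alpha p / 2))\<^sup>2 * - L)\<bar>
        \<le> (\<epsilon> * c powr (- alpha p / 2))\<^sup>2 * \<eta> + \<epsilon>\<^sup>2 * \<theta>" if "c \<in> {c_lo p \<epsilon>..c_hi p \<epsilon>}" for c
    using M[OF that] by (simp add: abs_le_iff mean_op_uminus algebra_simps)
  define \<delta> where "\<delta> = K / 2 * \<epsilon> powr (2 - 4 / p) + \<theta>"
  define P where "P b = a powr alpha p * pos_powr b (1 - alpha p)" for b
  have sp: "a powr alpha p * signed_power b (1 - alpha p) = P b - P (- b)" for b
    by (simp add: signed_power_eq_pos_powr P_def algebra_simps)
  note up = upper_part_expansion[OF p \<epsilon> a K \<eta> \<theta> bu S M, folded \<delta>_def P_def]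
  note lo = upper_part_expansion[OF p \<epsilon> a K \<eta> \<theta> bl S' M', folded \<delta>_def P_def]
  have e: "\<epsilon> powr (2 - 4 / p) * max b 0 \<le> \<epsilon> powr (2 - 4 / p) * (\<bar>L\<bar> + \<eta>)" if "b \<le> \<bar>L\<bar> + \<eta>" for b
    using that \<eta> by (intro mult_left_mono) auto
  \<comment> \<open>In each final estimate one half contributes \<kappa> - \<delta> and the other
    \<delta>, together \<kappa>.\<close>
  have e': "\<epsilon>\<^sup>2 * (u + \<epsilon> powr (2 / (3 * p - 4)) * a + \<epsilon> powr (2 - 4 / p) * max b 0 + \<delta>) \<le> \<epsilon>\<^sup>2 * (u + \<kappa> - \<delta>)"
    if "b \<le> \<bar>L\<bar> + \<eta>" for b u
    using e[OF that] unfolding \<kappa>_def \<delta>_def by (intro mult_left_mono) (auto simp: algebra_simps)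
  have *: "upper_part p \<epsilon> f x \<le> f x + \<epsilon>\<^sup>2 * (P (L + \<eta>) + \<kappa> - \<delta>)"
    "upper_part p \<epsilon> (\<lambda>y. - f y) x \<le> - f x + \<epsilon>\<^sup>2 * (P (- L + \<eta>) + \<kappa> - \<delta>)"
    using up(2) lo(2) e'[of "L + \<eta>" "P (L + \<eta>)"] e'[of "- L + \<eta>" "P (- L + \<eta>)"] by force+
  have "- (L + \<eta>) = - L - \<eta>" "- (L - \<eta>) = - L + \<eta>" by auto
  note sp' = sp[of "L + \<eta>", unfolded this(1)] sp[of "L - \<eta>", unfolded this(2)]
  show "\<epsilon>\<^sup>2 / 2 * (a powr alpha p * signed_power (L - \<eta>) (1 - alpha p) - \<kappa>) \<le> A_op p \<epsilon> f x - f x"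
    using up(1) *(2) unfolding sp' A_op_eq_upper_part
    by (simp add: algebra_simps add_divide_distrib diff_divide_distrib)
  show "A_op p \<epsilon> f x - f x \<le> \<epsilon>\<^sup>2 / 2 * (a powr alpha p * signed_power (L + \<eta>) (1 - alpha p) + \<kappa>)"
    using lo(1) *(1) unfolding sp' A_op_eq_upper_part
    by (simp add: algebra_simps add_divide_distrib diff_divide_distrib)
qed

text \<open>\<open>r\<close> is kept apart from \<open>R\<close> because a C^2 function may be
  unbounded on the open ball of radius \<open>R\<close> but is bounded on smaller ones. For bounded
  measurable functions the lemma is used with \<open>r = R\<close>.\<close>

lemma A_well_definedI:
  fixes f :: "'a::euclidean_space \<Rightarrow> real"
  assumes p: "p > 2" and \<epsilon>: "0 < \<epsilon>" "\<epsilon> < 1" and r: "r \<le> R" and balls: "balls_inside p \<epsilon> x r"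
    and bdd: "bounded (f ` ball x r)" and meas: "f \<in> borel_measurable (restrict_space borel (ball x r))"
  shows "A_well_defined p \<epsilon> R f x"
proof -
  note cc = c_lo_le_c_hi[OF p \<epsilon>]
  obtain B where B: "\<And>y. y \<in> ball x r \<Longrightarrow> \<bar>f y\<bar> \<le> B"
    using bdd unfolding bounded_iff by (metis imageI real_norm_def)
  have int: "set_integrable lborel (ball x s) f" if "ball x s \<subseteq> ball x r" for s
  proof -
    have "(\<lambda>y. indicator (ball x r) y *\<^sub>R f y) \<in> borel_measurable borel"
      using meas by (subst (asm) borel_measurable_restrict_space_iff) auto
    then have "integrable lborel (\<lambda>y. indicator (ball x s) y *\<^sub>R (indicator (ball x r) y *\<^sub>R f y))"
    proof (intro integrableI_bounded_set_indicator[where B = B])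
      show "emeasure lborel (ball x s) < \<infinity>" by (rule emeasure_lborel_ball_finite)
      have "norm (indicator (ball x r) y *\<^sub>R f y) \<le> B" if "y \<in> ball x s" for y
        using B[of y] that \<open>ball x s \<subseteq> ball x r\<close> by (auto simp: indicator_def)
      then show "AE y in lborel. y \<in> ball x s \<longrightarrow> norm (indicator (ball x r) y *\<^sub>R f y) \<le> B" by simp
    qed auto
    also have "(\<lambda>y. indicator (ball x s) y *\<^sub>R (indicator (ball x r) y *\<^sub>R f y)) = (\<lambda>y. indicator (ball x s) y *\<^sub>R f y)"
      using that by (auto simp: indicator_def fun_eq_iff subset_iff)
    finally show ?thesis by (simp add: set_integrable_def)
  qed
  have inside: "ball x (\<epsilon>\<^sup>2 * c powr (1 - alpha p)) \<subseteq> ball x r"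
    "ball x (gamma DIM('a) p * (\<epsilon> * c powr (- alpha p / 2))) \<subseteq> ball x r"
    if "c \<in> {c_lo p \<epsilon>..c_hi p \<epsilon>}" for c
    using balls that by (auto simp: balls_inside_def)
  have rad: "0 < \<epsilon>\<^sup>2 * c powr (1 - alpha p)" "0 < \<epsilon> * c powr (- alpha p / 2)"
      "0 < gamma DIM('a) p * (\<epsilon> * c powr (- alpha p / 2))"
    if "c \<in> {c_lo p \<epsilon>..c_hi p \<epsilon>}" for c
    using that cc \<epsilon> p by (auto simp: gamma_def)
  obtain \<nu> :: 'a where "\<nu> \<in> Basis" using nonempty_Basis by blast
  then have \<nu>: "norm \<nu> = 1" by simp
  \<comment> \<open>A function bounded by \<open>B\<close> is within \<open>B\<close> of the zero
    polynomial, so the expansions with zero coefficients bound supremum, infimum and mean by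
    \<open>B\<close>.\<close>
  have Bf: "\<bar>f (x + v) - (0 + 0 * (\<nu> \<bullet> v) + bilinear_form (\<lambda>_ _. 0) v v / 2)\<bar> \<le> B"
    if "norm v < s" "ball x s \<subseteq> ball x r" for v s
  proof -
    have "x + v \<in> ball x s" using that by (simp add: dist_norm)
    then show ?thesis using that B[of "x + v"] by (auto simp: bilinear_form_def)
  qed
  have bf0: "\<bar>bilinear_form (\<lambda>_ _. 0) v w\<bar> \<le> 0 * norm v * norm w" for v w :: 'a
    by (simp add: bilinear_form_def)
  have "\<bar>upper_val p \<epsilon> f x c\<bar> \<le> B \<and> \<bar>lower_val p \<epsilon> f x c\<bar> \<le> B" if c: "c \<in> {c_lo p \<epsilon>..c_hi p \<epsilon>}" for c
  proof -
    let ?S = "SUP y\<in>ball x (\<epsilon>\<^sup>2 * c powr (1 - alpha p)). f y" and ?I = "INF y\<in>ball x (\<epsilon>\<^sup>2 * c powr (1 - alpha p)). f y"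
    let ?M = "mean_op p (\<epsilon> * c powr (- alpha p / 2)) f x"
    have S: "\<bar>?S\<bar> \<le> B"
      using SUP_ball_expansion[OF rad(1)[OF c] bilinear_bilinear_form bf0 \<nu> _ _ Bf] inside[OF c]
      by (simp add: bilinear_form_def)
    have I: "\<bar>?I\<bar> \<le> B"
      using INF_ball_expansion[OF rad(1)[OF c] bilinear_bilinear_form bf0 \<nu> _ _ Bf] inside[OF c]
      by (simp add: bilinear_form_def)
    have M: "\<bar>?M\<bar> \<le> B"
      using mean_op_expansion[OF p rad(2)[OF c] int bf0 \<nu> _ _ Bf] inside[OF c]
      by (simp add: bilinear_form_def)
    have convex: "\<bar>alpha p * u + (1 - alpha p) * ?M\<bar> \<le> B" if "\<bar>u\<bar> \<le> B" for u
      using that M convex_bound_le[of u B ?M "alpha p" "1 - alpha p"]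
        convex_bound_le[of "- u" B "- ?M" "alpha p" "1 - alpha p"] alpha_bounds(1,2)[OF p]
      by (auto simp: abs_le_iff algebra_simps)
    show ?thesis unfolding upper_val_def lower_val_def using convex S I by blast
  qed
  then have "bounded (upper_val p \<epsilon> f x ` {c_lo p \<epsilon>..c_hi p \<epsilon>})" "bounded (lower_val p \<epsilon> f x ` {c_lo p \<epsilon>..c_hi p \<epsilon>})"
    unfolding bounded_iff by (auto intro!: exI[of _ B])
  moreover have "bounded (f ` ball x s)" if "ball x s \<subseteq> ball x r" for s
    by (rule bounded_subset[OF bdd]) (use that in auto)
  moreover have "ball x r \<subseteq> ball x R" using r by (rule subset_ball)
  ultimately show ?thesis
    unfolding A_well_defined_def balls_inside_def 
    using cc(1) rad int inside inside[THEN subset_trans] by simp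
qed



subsection \<open>Calculus of \<open>C\<^sup>k\<close> functions\<close>

text \<open>\<open>frechet_derivative\<close> is a choice among derivatives, so the two agree once
  both functions have the same derivatives within \<open>S\<close>.\<close>

lemma frechet_derivative_cong:
  assumes "z \<in> S" "\<And>y. y \<in> S \<Longrightarrow> f y = g y"
  shows "frechet_derivative f (at z within S) = frechet_derivative g (at z within S)"
proof -
  have "(f has_derivative D) (at z within S) \<longleftrightarrow> (g has_derivative D) (at z within S)" for D
    using assms has_derivative_transform[of z S f g D] has_derivative_transform[of z S g f D] by auto
  then show ?thesis by (simp add: frechet_derivative_def)
qed

lemma C_k_on_cong:
  assumes "\<And>y. y \<in> S \<Longrightarrow> f y = g y"
  shows "C_k_on k S f \<longleftrightarrow> C_k_on k S g"
  using assms
proof (induction k arbitrary: f g)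
  case 0
  then show ?case by (simp cong: continuous_on_cong)
next
  case (Suc k)
  have "f differentiable_on S \<longleftrightarrow> g differentiable_on S"
    using Suc.prems unfolding differentiable_on_def differentiable_def
    by (metis has_derivative_transform)
  moreover have "C_k_on k S (\<lambda>z. frechet_derivative f (at z within S) b) \<longleftrightarrow>
      C_k_on k S (\<lambda>z. frechet_derivative g (at z within S) b)" for b
    by (intro Suc.IH) (use frechet_derivative_cong[of _ S f g] Suc.prems in auto)
  ultimately show ?case by simp
qed

lemma C_k_on_open_Suc:
  assumes "open S"
  shows "C_k_on (Suc k) S f \<longleftrightarrow> (\<forall>z\<in>S. f differentiable at z) \<and> (\<forall>b\<in>Basis. C_k_on k S (pd b f))"
proof -
  have "C_k_on k S (\<lambda>z. frechet_derivative f (at z within S) b) \<longleftrightarrow> C_k_on k S (pd b f)" for b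
    by (rule C_k_on_cong) (simp add: pd_def at_within_open[OF _ assms])
  moreover have "f differentiable_on S \<longleftrightarrow> (\<forall>z\<in>S. f differentiable at z)"
    by (simp add: differentiable_on_def at_within_open[OF _ assms])
  ultimately show ?thesis by simp
qed

text \<open>At a point of the open set \<open>T\<close>, derivatives within \<open>S\<close>, within
  \<open>T\<close> and unrestricted ones coincide. This leads from the closed time interval to the
  open one, where \<open>pd\<close> and \<open>deriv\<close> can be used.\<close>

lemma C_k_on_open_subset:
  assumes "open T" "T \<subseteq> S" "C_k_on k S f"
  shows "C_k_on k T f"
  using assms(3)
proof (induction k arbitrary: f)
  case 0
  then show ?case using assms by (auto intro: continuous_on_subset)
next
  case (Suc k)
  have at: "at z within S = at z" "at z within T = at z" if "z \<in> T" for z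
    using that assms at_within_open_subset at_within_open by blast+
  have "f differentiable_on T"
    using Suc.prems assms by (auto intro: differentiable_on_subset)
  moreover have "C_k_on k T (\<lambda>z. frechet_derivative f (at z within T) b)" if "b \<in> Basis" for b
  proof -
    have "C_k_on k T (\<lambda>z. frechet_derivative f (at z within S) b)"
      using Suc that by auto
    then show ?thesis using at by (subst C_k_on_cong) auto
  qed
  ultimately show ?case by simp
qed

text \<open>Since the constant derivative \<open>J\<close> sends basis vectors to basis vectors, a
  partial derivative of the composition is again a partial derivative of \<open>f\<close> composed
  with \<open>j\<close>, and the induction closes.\<close>

lemma C_k_on_compose_affine:
  fixes j :: "'c::euclidean_space \<Rightarrow> 'd::euclidean_space"
  assumes U: "open U" and T: "open T" and j: "\<And>y. y \<in> U \<Longrightarrow> j y \<in> T"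
    and J: "\<And>y. (j has_derivative J) (at y)" "\<And>b. b \<in> Basis \<Longrightarrow> J b \<in> Basis"
    and f: "C_k_on k T f"
  shows "C_k_on k U (\<lambda>y. f (j y))"
  using f
proof (induction k arbitrary: f)
  case 0
  have "continuous_on U j" using J(1) by (intro continuous_at_imp_continuous_on) (auto intro: has_derivative_continuous)
  then show ?case using 0 j by (auto intro: continuous_on_compose2)
next
  case (Suc k)
  have D: "((\<lambda>y. f (j y)) has_derivative (\<lambda>v. frechet_derivative f (at (j y)) (J v))) (at y)" if "y \<in> U" for y
    using Suc.prems j[OF that] T by (intro has_derivative_compose[OF J(1)])
      (auto simp: C_k_on_open_Suc frechet_derivative_works[symmetric] simp del: C_k_on.simps)
  have "C_k_on k U (pd b (\<lambda>y. f (j y)))" if b: "b \<in> Basis" for b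
  proof -
    have "C_k_on k U (\<lambda>y. pd (J b) f (j y))"
      using Suc.prems J(2)[OF b] T by (intro Suc.IH) (auto simp: C_k_on_open_Suc simp del: C_k_on.simps)
    then show ?thesis
      by (subst C_k_on_cong[where g = "\<lambda>y. pd (J b) f (j y)"])
        (auto simp: pd_def frechet_derivative_at[OF D, symmetric])
  qed
  then show ?case using D by (auto simp: C_k_on_open_Suc[OF U] differentiable_def simp del: C_k_on.simps)
qed

section \<open>Gradient, Hessian and Taylor's formula along segments\<close>

lemma grad_inner_Basis: "b \<in> Basis \<Longrightarrow> grad f y \<bullet> b = pd b f y"
  by (simp add: grad_def)

lemma grad_inner: "grad f y \<bullet> v = (\<Sum>b\<in>Basis. (v \<bullet> b) * pd b f y)"
  by (simp add: grad_def inner_commute[of _ v] inner_sum_right mult.commute)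

lemma has_derivative_grad:
  assumes "f differentiable at y"
  shows "(f has_derivative (\<lambda>v. grad f y \<bullet> v)) (at y)"
proof -
  have D: "(f has_derivative frechet_derivative f (at y)) (at y)"
    using assms by (simp add: frechet_derivative_works)
  then have lin: "linear (frechet_derivative f (at y))" by (rule has_derivative_linear)
  have "frechet_derivative f (at y) v = grad f y \<bullet> v" for v
  proof -
    have "frechet_derivative f (at y) v = frechet_derivative f (at y) (\<Sum>b\<in>Basis. (v \<bullet> b) *\<^sub>R b)"
      by (simp add: euclidean_representation)
    then show ?thesis by (simp add: linear_sum[OF lin] linear_scale[OF lin] grad_inner pd_def)
  qed
  then show ?thesis using D by presburger
qed

lemma has_real_derivative_line:
  assumes "f differentiable at (x + u *\<^sub>R v)"
  shows "((\<lambda>u. f (x + u *\<^sub>R v)) has_real_derivative (\<Sum>b\<in>Basis. (v \<bullet> b) * pd b f (x + u *\<^sub>R v))) (at u)"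
proof -
  have "((\<lambda>u. f (x + u *\<^sub>R v)) has_derivative (\<lambda>h. grad f (x + u *\<^sub>R v) \<bullet> (h *\<^sub>R v))) (at u)"
    by (rule has_derivative_compose[where g = f and f = "\<lambda>u. x + u *\<^sub>R v", OF _ has_derivative_grad[OF assms]]) (auto intro!: derivative_eq_intros)
  then show ?thesis unfolding has_field_derivative_def grad_inner[symmetric]
    by (rule has_derivative_eq_rhs) (simp add: fun_eq_iff)
qed

abbreviation hess :: "('a::euclidean_space \<Rightarrow> real) \<Rightarrow> 'a \<Rightarrow> 'a \<Rightarrow> 'a \<Rightarrow> real" where
  "hess f y b c \<equiv> pd b (pd c f) y"

lemma C_2_on_open:
  assumes "C_k_on 2 U f" "open U"
  shows "\<And>y. y \<in> U \<Longrightarrow> f differentiable at y" 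
    "\<And>y b. y \<in> U \<Longrightarrow> b \<in> Basis \<Longrightarrow> pd b f differentiable at y"
    "\<And>b. b \<in> Basis \<Longrightarrow> continuous_on U (pd b f)"
    "\<And>b c. b \<in> Basis \<Longrightarrow> c \<in> Basis \<Longrightarrow> continuous_on U (\<lambda>y. hess f y b c)"
proof -
  show f: "\<And>y. y \<in> U \<Longrightarrow> f differentiable at y" and
    *: "\<And>y b. y \<in> U \<Longrightarrow> b \<in> Basis \<Longrightarrow> pd b f differentiable at y" and
    "\<And>b c. b \<in> Basis \<Longrightarrow> c \<in> Basis \<Longrightarrow> continuous_on U (\<lambda>y. hess f y b c)"
    using assms by (auto simp: numeral_2_eq_2 C_k_on_open_Suc simp del: C_k_on.simps(2))
  show "\<And>b. b \<in> Basis \<Longrightarrow> continuous_on U (pd b f)"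
    using * by (intro continuous_at_imp_continuous_on) (auto intro: differentiable_imp_continuous_within)
qed

lemma C_3_on_open:
  assumes "C_k_on 3 U f" "open U"
  shows "C_k_on 2 U f" "\<And>y b c. y \<in> U \<Longrightarrow> b \<in> Basis \<Longrightarrow> c \<in> Basis \<Longrightarrow> pd b (pd c f) differentiable at y"
    "\<And>a b c. a \<in> Basis \<Longrightarrow> b \<in> Basis \<Longrightarrow> c \<in> Basis \<Longrightarrow> continuous_on U (\<lambda>y. pd a (pd b (pd c f)) y)"
proof -
  show d: "\<And>y b c. y \<in> U \<Longrightarrow> b \<in> Basis \<Longrightarrow> c \<in> Basis \<Longrightarrow> pd b (pd c f) differentiable at y" and
    "\<And>a b c. a \<in> Basis \<Longrightarrow> b \<in> Basis \<Longrightarrow> c \<in> Basis \<Longrightarrow> continuous_on U (\<lambda>y. pd a (pd b (pd c f)) y)"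
    using assms by (auto simp: numeral_3_eq_3 C_k_on_open_Suc simp del: C_k_on.simps(2))
  have "continuous_on U (pd b (pd c f))" if "b \<in> Basis" "c \<in> Basis" for b c
    using d that by (intro continuous_at_imp_continuous_on) (auto intro: differentiable_imp_continuous_within)
  then show "C_k_on 2 U f"
    using assms by (auto simp: numeral_2_eq_2 numeral_3_eq_3 C_k_on_open_Suc simp del: C_k_on.simps(2))
qed

text \<open>Maclaurin's formula on [0, 1] for u \<mapsto> f(x + u v), whose successive derivatives
  are listed by \<open>D\<close>.\<close>

lemma Taylor_2:
  fixes f :: "'a::euclidean_space \<Rightarrow> real"
  assumes f: "C_k_on 2 (ball x r) f" and v: "norm v < r"
  shows "\<exists>\<xi>. 0 < \<xi> \<and> \<xi> < 1 \<and>
    f (x + v) = f x + grad f x \<bullet> v + bilinear_form (hess f (x + \<xi> *\<^sub>R v)) v v / 2"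
proof -
  note C = C_2_on_open[OF f open_ball]
  have in_ball: "x + u *\<^sub>R v \<in> ball x r" if "0 \<le> u" "u \<le> 1" for u
    using that v mult_right_mono[OF that(2), of "norm v"] by (simp add: dist_norm)
  define D where "D m u = (if m = (0::nat) then f (x + u *\<^sub>R v)
    else if m = 1 then \<Sum>b\<in>Basis. (v \<bullet> b) * pd b f (x + u *\<^sub>R v)
    else bilinear_form (hess f (x + u *\<^sub>R v)) v v)" for m u
  have "DERIV (D m) u :> D (Suc m) u" if m: "m < 2" and u: "0 \<le> u" "u \<le> 1" for m u
  proof -
    consider "m = 0" | "m = 1" using m by linarith
    then show ?thesis
    proof cases
      case 1
      then show ?thesis using has_real_derivative_line[OF C(1)[OF in_ball[OF u]]]
        by (simp add: D_def[abs_def])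
    next
      case 2
      have "((\<lambda>u. \<Sum>c\<in>Basis. (v \<bullet> c) * pd c f (x + u *\<^sub>R v)) has_real_derivative
          (\<Sum>c\<in>Basis. (v \<bullet> c) * (\<Sum>b\<in>Basis. (v \<bullet> b) * hess f (x + u *\<^sub>R v) b c))) (at u)"
        by (intro DERIV_sum DERIV_cmult has_real_derivative_line C(2) in_ball u)
      also have "(\<Sum>c\<in>Basis. (v \<bullet> c) * (\<Sum>b\<in>Basis. (v \<bullet> b) * hess f (x + u *\<^sub>R v) b c))
          = bilinear_form (hess f (x + u *\<^sub>R v)) v v"
        unfolding bilinear_form_def sum_distrib_left by (subst sum.swap) (simp add: mult_ac)
      finally show ?thesis using 2 by (simp add: D_def[abs_def])
    qed
  qed
  then have "\<exists>\<xi>. 0 < \<xi> \<and> \<xi> < 1 \<and> D 0 1 = (\<Sum>m<2. D m 0 / fact m * 1 ^ m) + D 2 \<xi> / fact 2 * 1 ^ 2"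
    by (intro Maclaurin) auto
  then show ?thesis by (simp add: D_def numeral_2_eq_2 grad_inner add.assoc)
qed

lemma Taylor_3:
  fixes f :: "'a::euclidean_space \<Rightarrow> real"
  assumes f: "C_k_on 3 (ball x r) f" and v: "norm v < r"
  shows "\<exists>\<xi>. 0 < \<xi> \<and> \<xi> < 1 \<and>
    f (x + v) = f x + grad f x \<bullet> v + bilinear_form (hess f x) v v / 2
      + (\<Sum>a\<in>Basis. \<Sum>b\<in>Basis. \<Sum>c\<in>Basis. (v \<bullet> a) * (v \<bullet> b) * (v \<bullet> c) * pd a (pd b (pd c f)) (x + \<xi> *\<^sub>R v)) / 6"
proof -
  note C3 = C_3_on_open[OF f open_ball]
  note C = C_2_on_open[OF C3(1) open_ball]
  have in_ball: "x + u *\<^sub>R v \<in> ball x r" if "0 \<le> u" "u \<le> 1" for u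
    using that v mult_right_mono[OF that(2), of "norm v"] by (simp add: dist_norm)
  define D where "D m u = (if m = (0::nat) then f (x + u *\<^sub>R v)
    else if m = 1 then \<Sum>b\<in>Basis. (v \<bullet> b) * pd b f (x + u *\<^sub>R v)
    else if m = 2 then bilinear_form (hess f (x + u *\<^sub>R v)) v v
    else (\<Sum>a\<in>Basis. \<Sum>b\<in>Basis. \<Sum>c\<in>Basis. (v \<bullet> a) * (v \<bullet> b) * (v \<bullet> c) * pd a (pd b (pd c f)) (x + u *\<^sub>R v)))" for m u
  have "DERIV (D m) u :> D (Suc m) u" if m: "m < 3" and u: "0 \<le> u" "u \<le> 1" for m u
  proof -
    consider "m = 0" | "m = 1" | "m = 2" using m by linarith
    then show ?thesis
    proof cases
      case 1
      then show ?thesis using has_real_derivative_line[OF C(1)[OF in_ball[OF u]]]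
        by (simp add: D_def[abs_def])
    next
      case 2
      have "((\<lambda>u. \<Sum>c\<in>Basis. (v \<bullet> c) * pd c f (x + u *\<^sub>R v)) has_real_derivative
          (\<Sum>c\<in>Basis. (v \<bullet> c) * (\<Sum>b\<in>Basis. (v \<bullet> b) * hess f (x + u *\<^sub>R v) b c))) (at u)"
        by (intro DERIV_sum DERIV_cmult has_real_derivative_line C(2) in_ball u)
      also have "(\<Sum>c\<in>Basis. (v \<bullet> c) * (\<Sum>b\<in>Basis. (v \<bullet> b) * hess f (x + u *\<^sub>R v) b c))
          = bilinear_form (hess f (x + u *\<^sub>R v)) v v"
        unfolding bilinear_form_def sum_distrib_left by (subst sum.swap) (simp add: mult_ac)
      finally show ?thesis using 2 by (simp add: D_def[abs_def])
    next
      case 3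
      have "((\<lambda>u. bilinear_form (hess f (x + u *\<^sub>R v)) v v) has_real_derivative
          (\<Sum>b\<in>Basis. \<Sum>c\<in>Basis. (v \<bullet> b) * (v \<bullet> c) * (\<Sum>a\<in>Basis. (v \<bullet> a) * pd a (pd b (pd c f)) (x + u *\<^sub>R v)))) (at u)"
        unfolding bilinear_form_def
        by (intro DERIV_sum DERIV_cmult has_real_derivative_line C3(2) in_ball u)
      also have "(\<Sum>b\<in>Basis. \<Sum>c\<in>Basis. (v \<bullet> b) * (v \<bullet> c) * (\<Sum>a\<in>Basis. (v \<bullet> a) * pd a (pd b (pd c f)) (x + u *\<^sub>R v)))
          = (\<Sum>b\<in>Basis. \<Sum>a\<in>Basis. \<Sum>c\<in>Basis. (v \<bullet> a) * (v \<bullet> b) * (v \<bullet> c) * pd a (pd b (pd c f)) (x + u *\<^sub>R v))"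
        unfolding sum_distrib_left by (rule sum.cong[OF refl], subst sum.swap) (simp add: mult_ac)
      also have "\<dots> = (\<Sum>a\<in>Basis. \<Sum>b\<in>Basis. \<Sum>c\<in>Basis. (v \<bullet> a) * (v \<bullet> b) * (v \<bullet> c) * pd a (pd b (pd c f)) (x + u *\<^sub>R v))"
        by (rule sum.swap)
      finally show ?thesis using 3 by (simp add: D_def[abs_def])
    qed
  qed
  then have "\<exists>\<xi>. 0 < \<xi> \<and> \<xi> < 1 \<and> D 0 1 = (\<Sum>m<3. D m 0 / fact m * 1 ^ m) + D 3 \<xi> / fact 3 * 1 ^ 3"
    by (intro Maclaurin) auto
  then show ?thesis by (simp add: D_def numeral_3_eq_3 numeral_2_eq_2 grad_inner add.assoc)
qed

section \<open>Bounds for quadratic and cubic forms by Frobenius norms\<close>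

lemma sum_mult_le_sqrt:
  fixes u w :: "'i \<Rightarrow> real"
  shows "\<bar>\<Sum>i\<in>I. u i * w i\<bar> \<le> sqrt (\<Sum>i\<in>I. (u i)\<^sup>2) * sqrt (\<Sum>i\<in>I. (w i)\<^sup>2)"
  using Cauchy_Schwarz_ineq_sum[of u w I]
  by (metis real_sqrt_abs real_sqrt_le_mono real_sqrt_mult)

lemma sum_Basis_inner_sq: "(\<Sum>b\<in>Basis. (v \<bullet> b)\<^sup>2) = (norm v)\<^sup>2"
  unfolding power2_norm_eq_inner by (subst euclidean_inner) (simp add: power2_eq_square)

text \<open>Cauchy-Schwarz over pairs of basis vectors, where the sum of the squares of (v \<bullet>
  b) (w \<bullet> c) factorizes.\<close>

lemma bilinear_form_le:
  "\<bar>bilinear_form H v w\<bar> \<le> sqrt (\<Sum>b\<in>Basis. \<Sum>c\<in>Basis. (H b c)\<^sup>2) * norm v * norm w"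
proof -
  have "\<bar>bilinear_form H v w\<bar> = \<bar>\<Sum>(b,c)\<in>Basis \<times> Basis. ((v \<bullet> b) * (w \<bullet> c)) * H b c\<bar>"
    unfolding bilinear_form_def by (simp add: sum.cartesian_product)
  also have "\<dots> \<le> sqrt (\<Sum>(b,c)\<in>Basis \<times> Basis. ((v \<bullet> b) * (w \<bullet> c))\<^sup>2) * sqrt (\<Sum>(b,c)\<in>Basis \<times> Basis. (H b c)\<^sup>2)"
    using sum_mult_le_sqrt[of "\<lambda>(b,c). (v \<bullet> b) * (w \<bullet> c)" "\<lambda>(b,c). H b c" "Basis \<times> Basis"]
    by (simp add: case_prod_unfold)
  also have "(\<Sum>(b,c)\<in>Basis \<times> Basis. ((v \<bullet> b) * (w \<bullet> c))\<^sup>2) = (norm v)\<^sup>2 * (norm w)\<^sup>2"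
    unfolding sum.cartesian_product[symmetric] power_mult_distrib sum_product[symmetric] sum_Basis_inner_sq ..
  also have "sqrt ((norm v)\<^sup>2 * (norm w)\<^sup>2) = norm v * norm w" by (simp add: real_sqrt_mult)
  finally show ?thesis unfolding sum.cartesian_product[symmetric] by (simp only: mult_ac)
qed

lemma bilinear_form_hess_le: "\<bar>bilinear_form (hess f y) v w\<bar> \<le> norm_D2 f y * norm v * norm w"
  unfolding norm_D2_def by (rule bilinear_form_le)

lemma trace_hess_le: "\<bar>\<Sum>b\<in>Basis. hess f y b b\<bar> \<le> DIM('a) * norm_D2 f y" for y :: "'a::euclidean_space"
proof -
  have "\<bar>\<Sum>b\<in>Basis. hess f y b b\<bar> \<le> (\<Sum>b\<in>(Basis :: 'a set). norm_D2 f y)"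
  proof (rule order_trans[OF sum_abs sum_mono])
    fix b :: 'a assume b: "b \<in> Basis"
    \<comment> \<open>A diagonal entry is the value of the form at the unit vector \<open>b\<close>,
      so the bound for forms applies to it.\<close>
    have "bilinear_form (hess f y) b b = (\<Sum>i\<in>Basis. \<Sum>j\<in>Basis. if i = b then if j = b then hess f y b b else 0 else 0)"
      unfolding bilinear_form_def using b by (intro sum.cong refl) (auto simp: inner_Basis)
    also have "\<dots> = (\<Sum>i\<in>Basis. if i = b then \<Sum>j\<in>Basis. if j = b then hess f y b b else 0 else 0)"
      by (intro sum.cong refl) auto
    also have "\<dots> = hess f y b b" using b by simp
    finally show "\<bar>hess f y b b\<bar> \<le> norm_D2 f y"
      using bilinear_form_hess_le[of f y b b] b by simp
  qed
  then show ?thesis by simp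
qed

lemma trilinear_form_le:
  fixes f :: "'a::euclidean_space \<Rightarrow> real"
  shows "\<bar>\<Sum>a\<in>Basis. \<Sum>b\<in>Basis. \<Sum>c\<in>Basis. (v \<bullet> a) * (v \<bullet> b) * (v \<bullet> c) * pd a (pd b (pd c f)) y\<bar> \<le> norm_D3 f y * norm v ^ 3"
proof -
  define W where "W a = bilinear_form (\<lambda>b c. pd a (pd b (pd c f)) y) v v" for a
  have eq: "(\<Sum>a\<in>Basis. \<Sum>b\<in>Basis. \<Sum>c\<in>Basis. (v \<bullet> a) * (v \<bullet> b) * (v \<bullet> c) * pd a (pd b (pd c f)) y) = (\<Sum>a\<in>Basis. (v \<bullet> a) * W a)"
    by (simp add: W_def bilinear_form_def sum_distrib_left mult_ac)
  have "(W a)\<^sup>2 \<le> (\<Sum>b\<in>Basis. \<Sum>c\<in>Basis. (pd a (pd b (pd c f)) y)\<^sup>2) * (norm v) ^ 4" for a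
  proof -
    have "(W a)\<^sup>2 \<le> (sqrt (\<Sum>b\<in>Basis. \<Sum>c\<in>Basis. (pd a (pd b (pd c f)) y)\<^sup>2) * norm v * norm v)\<^sup>2"
      unfolding abs_le_square_iff[symmetric] W_def using bilinear_form_le[of "\<lambda>b c. pd a (pd b (pd c f)) y" v v]
      by (simp add: abs_mult sum_nonneg)
    then show ?thesis by (simp add: power_mult_distrib sum_nonneg power2_eq_square[of "norm v"] power4_eq_xxxx mult_ac)
  qed
  then have "(\<Sum>a\<in>Basis. (W a)\<^sup>2) \<le> (\<Sum>a\<in>Basis. (\<Sum>b\<in>Basis. \<Sum>c\<in>Basis. (pd a (pd b (pd c f)) y)\<^sup>2)) * (norm v) ^ 4"
    unfolding sum_distrib_right[of _ Basis] by (intro sum_mono)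
  then have "sqrt (\<Sum>a\<in>Basis. (W a)\<^sup>2) \<le> sqrt ((\<Sum>a\<in>Basis. (\<Sum>b\<in>Basis. \<Sum>c\<in>Basis. (pd a (pd b (pd c f)) y)\<^sup>2)) * ((norm v)\<^sup>2)\<^sup>2)"
    by (intro real_sqrt_le_mono) simp
  also have "\<dots> = norm_D3 f y * (norm v)\<^sup>2" by (simp only: real_sqrt_mult real_sqrt_abs abs_power2 norm_D3_def)
  finally have W: "sqrt (\<Sum>a\<in>Basis. (W a)\<^sup>2) \<le> norm_D3 f y * (norm v)\<^sup>2" .
  have "\<bar>\<Sum>a\<in>Basis. (v \<bullet> a) * W a\<bar> \<le> sqrt (\<Sum>a\<in>Basis. (v \<bullet> a)\<^sup>2) * sqrt (\<Sum>a\<in>Basis. (W a)\<^sup>2)"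
    by (rule sum_mult_le_sqrt)
  also have "\<dots> \<le> norm v * (norm_D3 f y * (norm v)\<^sup>2)"
    unfolding sum_Basis_inner_sq using W by (simp add: mult_left_mono)
  finally show ?thesis unfolding eq by (simp add: power2_eq_square power3_eq_cube mult_ac)
qed



subsection \<open>The \<open>p\<close>-Laplacian\<close>

lemma pd_eqI: "(F has_derivative F') (at x) \<Longrightarrow> pd b F x = F' b"
  using frechet_derivative_at[of F F' x] by (simp add: pd_def)

text \<open>Writing |\<nabla>f|^(p-2) as N^q with N = |\<nabla>f|^2 makes the base a polynomial in
  the partial derivatives that is positive at \<open>x\<close>, so product and chain rule
  apply.\<close>

lemma p_laplacian_eq:
  fixes f :: "'a::euclidean_space \<Rightarrow> real"
  assumes d: "\<And>c. c \<in> Basis \<Longrightarrow> pd c f differentiable at x" and g: "grad f x \<noteq> 0"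
  shows "p_laplacian p f x = norm (grad f x) powr (p - 2) *
    ((\<Sum>b\<in>Basis. hess f x b b) + (p - 2) * bilinear_form (hess f x) (sgn (grad f x)) (sgn (grad f x)))"
proof -
  define N where "N z = (\<Sum>c\<in>Basis. (pd c f z)\<^sup>2)" for z
  define q where "q = (p - 2) / 2"
  have N: "N z = (norm (grad f z))\<^sup>2" for z
    unfolding N_def sum_Basis_inner_sq[symmetric] by (simp add: grad_inner_Basis)
  have Nx: "N x > 0" using g by (simp add: N)
  have Nq: "norm (grad f z) powr (p - 2) = N z powr q" for z
  proof -
    have "2 * q = p - 2" by (simp add: q_def)
    then have "((norm (grad f z)) powr 2) powr q = norm (grad f z) powr (p - 2)"
      unfolding powr_powr by (simp only:)
    then show ?thesis by (cases "grad f z = 0") (simp_all add: N)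
  qed
  define N' where "N' h = (\<Sum>c\<in>Basis. 2 * pd c f x * (grad (pd c f) x \<bullet> h))" for h
  have "(N has_derivative N') (at x)"
  proof (rule has_derivative_eq_rhs)
    show "(N has_derivative (\<lambda>h. \<Sum>c\<in>Basis. pd c f x * (grad (pd c f) x \<bullet> h) + (grad (pd c f) x \<bullet> h) * pd c f x)) (at x)"
      unfolding N_def power2_eq_square by (intro has_derivative_sum has_derivative_mult has_derivative_grad d)
  qed (simp add: N'_def fun_eq_iff mult_ac)
  then have Npow: "((\<lambda>z. N z powr q) has_derivative (\<lambda>h. N' h * (q * N x powr (q - 1)))) (at x)"
    by (rule DERIV_compose_FDERIV[where f = "\<lambda>z. z powr q" and g = N, OF has_real_derivative_powr[OF Nx]])
  have D: "pd b (\<lambda>z. norm (grad f z) powr (p - 2) * (grad f z \<bullet> b)) x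
      = N x powr q * hess f x b b + N' b * (q * N x powr (q - 1)) * pd b f x" if b: "b \<in> Basis" for b
  proof -
    have "((\<lambda>z. N z powr q * pd b f z) has_derivative
       (\<lambda>h. N x powr q * (grad (pd b f) x \<bullet> h) + N' h * (q * N x powr (q - 1)) * pd b f x)) (at x)"
      by (rule has_derivative_mult[OF Npow has_derivative_grad[OF d[OF b]]])
    from pd_eqI[OF this, of b] show ?thesis using b by (simp add: Nq grad_inner_Basis)
  qed
  have N'b: "N' b = (\<Sum>c\<in>Basis. 2 * pd c f x * hess f x b c)" if "b \<in> Basis" for b
    using that by (simp add: N'_def grad_inner_Basis)
  have "p_laplacian p f x = (\<Sum>b\<in>Basis. N x powr q * hess f x b b + N' b * (q * N x powr (q - 1)) * pd b f x)"
    by (simp add: p_laplacian_def divergence_def D)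
  also have "\<dots> = N x powr q * (\<Sum>b\<in>Basis. hess f x b b) + 2 * q * N x powr (q - 1) * bilinear_form (hess f x) (grad f x) (grad f x)"
    by (simp add: sum.distrib sum_distrib_left bilinear_form_def N'b grad_inner_Basis sum_distrib_right mult_ac)
  also have "N x powr (q - 1) = N x powr q / N x" using Nx by (simp add: powr_diff)
  also have "bilinear_form (hess f x) (grad f x) (grad f x) = N x * bilinear_form (hess f x) (sgn (grad f x)) (sgn (grad f x))"
    using g by (simp add: sgn_div_norm N bilinear_lmul[OF bilinear_bilinear_form] bilinear_rmul[OF bilinear_bilinear_form] field_simps power2_eq_square)
  also have "2 * q * (N x powr q / N x) * (N x * bilinear_form (hess f x) (sgn (grad f x)) (sgn (grad f x)))
      = N x powr q * ((p - 2) * bilinear_form (hess f x) (sgn (grad f x)) (sgn (grad f x)))"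
    using Nx by (simp add: q_def)
  finally show ?thesis by (simp add: Nq distrib_left)
qed

text \<open>For 2 < p < 3 the factor |\<nabla>f|^(p-2) need not be differentiable at a critical
  point, which rules out the usual product rule. As both factors vanish, continuity of one is
  enough: w(x + h) is O(|h|) while u(x + h) tends to 0.\<close>

lemma has_derivative_mult_vanishing:
  fixes u w :: "'a::real_normed_vector \<Rightarrow> real"
  assumes u: "isCont u x" "u x = 0" and w: "(w has_derivative w') (at x)" "w x = 0"
  shows "((\<lambda>z. u z * w z) has_derivative (\<lambda>_. 0)) (at x)"
proof -
  obtain k where k: "\<And>h. norm (w' h) \<le> norm h * k"
    using bounded_linear.bounded[OF has_derivative_bounded_linear[OF w(1)]] by blast
  have lim: "((\<lambda>h. norm (w (x + h) - w x - w' h) / norm h) \<longlongrightarrow> 0) (at 0)"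
    using w(1) by (simp add: has_derivative_at)
  have u0: "((\<lambda>h. u (x + h)) \<longlongrightarrow> 0) (at 0)"
    using u by (simp add: isCont_iff)
  have "((\<lambda>h. \<bar>u (x + h)\<bar> * (norm (w (x + h) - w x - w' h) / norm h + k)) \<longlongrightarrow> \<bar>0\<bar> * (0 + k)) (at 0)"
    by (intro tendsto_intros u0 lim)
  then have *: "((\<lambda>h. \<bar>u (x + h)\<bar> * (norm (w (x + h) - w x - w' h) / norm h + k)) \<longlongrightarrow> 0) (at 0)" by simp
  have "((\<lambda>h. norm (u (x + h) * w (x + h)) / norm h) \<longlongrightarrow> 0) (at 0)"
  proof (rule tendsto_sandwich[OF _ _ tendsto_const *])
    have "norm (u (x + h) * w (x + h)) / norm h \<le> \<bar>u (x + h)\<bar> * (norm (w (x + h) - w x - w' h) / norm h + k)" if "h \<noteq> 0" for h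
    proof -
      have "\<bar>w (x + h)\<bar> \<le> norm (w (x + h) - w x - w' h) + norm h * k"
        using k[of h] w(2) by (simp add: abs_le_iff) linarith
      then have "\<bar>w (x + h)\<bar> / norm h \<le> norm (w (x + h) - w x - w' h) / norm h + k"
        using that by (simp add: field_simps)
      from mult_left_mono[OF this, of "\<bar>u (x + h)\<bar>"] show ?thesis by (simp add: abs_mult)
    qed
    then show "\<forall>\<^sub>F h in at 0. norm (u (x + h) * w (x + h)) / norm h \<le> \<bar>u (x + h)\<bar> * (norm (w (x + h) - w x - w' h) / norm h + k)"
      by (auto simp: eventually_at_filter)
  qed simp
  then show ?thesis using u w by (simp add: has_derivative_at)
qed

lemma p_laplacian_eq_0:
  fixes f :: "'a::euclidean_space \<Rightarrow> real"
  assumes p: "p > 2" and d: "\<And>c. c \<in> Basis \<Longrightarrow> pd c f differentiable at x" and g: "grad f x = 0"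
  shows "p_laplacian p f x = 0"
proof -
  have cont: "isCont (grad f) x"
    unfolding grad_def by (intro continuous_intros differentiable_imp_continuous_within d)
  have "isCont (\<lambda>z. norm (grad f z) powr (p - 2)) x"
    unfolding isCont_def using p g cont
    by (intro tendsto_powr') (auto simp: isCont_def intro!: tendsto_eq_intros)
  then have "pd b (\<lambda>z. norm (grad f z) powr (p - 2) * pd b f z) x = 0" if "b \<in> Basis" for b
    using grad_inner_Basis[OF that, of f x] g
    by (intro pd_eqI[OF has_derivative_mult_vanishing[OF _ _ has_derivative_grad[OF d[OF that]]]]) auto
  then show ?thesis by (simp add: p_laplacian_def divergence_def grad_inner_Basis)
qed

text \<open>The exponent \<alpha> arises as (p - 2) / (p - 1). At a critical point both sides are 0,
  the right one because \<open>0 powr alpha p = 0\<close>, so a single formula serves every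
  gradient.\<close>

lemma signed_power_p_laplacian:
  fixes f :: "'a::euclidean_space \<Rightarrow> real"
  assumes p: "p > 2" and d: "\<And>c. c \<in> Basis \<Longrightarrow> pd c f differentiable at x"
  shows "signed_power (p_laplacian p f x) (1 / (p - 1)) = norm (grad f x) powr alpha p *
    signed_power ((\<Sum>b\<in>Basis. hess f x b b) + (p - 2) * bilinear_form (hess f x) (sgn (grad f x)) (sgn (grad f x))) (1 - alpha p)"
proof (cases "grad f x = 0")
  case True
  then show ?thesis using p_laplacian_eq_0[OF p d True] by (simp add: signed_power_def)
next
  case False
  have "(p - 2) * (1 / (p - 1)) = alpha p" by (simp add: alpha_def)
  then have "(norm (grad f x) powr (p - 2)) powr (1 / (p - 1)) = norm (grad f x) powr alpha p"
    unfolding powr_powr by (simp only:)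
  moreover have "p_laplacian p f x = norm (grad f x) powr (p - 2) * ((\<Sum>b\<in>Basis. hess f x b b)
      + (p - 2) * bilinear_form (hess f x) (sgn (grad f x)) (sgn (grad f x)))"
    by (rule p_laplacian_eq[OF d False])
  ultimately show ?thesis unfolding alpha_bounds(3)[OF p] using False
    by (simp add: signed_power_def sgn_mult abs_mult powr_mult)
qed

subsection \<open>Supremum norms and increments in time\<close>

text \<open>If |g| exceeded the essential supremum at a point of the open set \<open>U\<close>, it
  would do so on a whole ball, which has positive measure. \<open>U\<close> is separate from
  \<open>S\<close> so that closed intervals can be treated at their interior points.\<close>

lemma abs_le_Linf_norm:
  fixes g :: "'a::euclidean_space \<Rightarrow> real"
  assumes S: "S \<in> sets borel" and g: "continuous_on S g" and B: "\<And>y. y \<in> S \<Longrightarrow> \<bar>g y\<bar> \<le> B"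
    and U: "open U" "U \<subseteq> S" and y: "y \<in> U"
  shows "\<bar>g y\<bar> \<le> Linf_norm S g"
proof -
  let ?M = "restrict_space lborel S"
  define T where "T = esssup ?M (\<lambda>y. ereal \<bar>g y\<bar>)"
  have "(\<lambda>y. \<bar>g y\<bar>) \<in> borel_measurable (restrict_space borel S)"
    using g by (intro borel_measurable_continuous_on_restrict continuous_intros)
  then have meas: "(\<lambda>y. ereal \<bar>g y\<bar>) \<in> borel_measurable ?M"
    by (subst measurable_cong_sets[where N = borel and M' = "restrict_space borel S"])
      (auto simp: sets_restrict_space)
  have AE: "AE z in lborel. z \<in> S \<longrightarrow> ereal \<bar>g z\<bar> \<le> T"
    using esssup_AE[where M = ?M and f = "\<lambda>y. ereal \<bar>g y\<bar>"] S by (simp add: AE_restrict_space_iff T_def)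
  have "T \<le> ereal B" unfolding T_def using meas B S
    by (intro esssup_I) (auto simp: AE_restrict_space_iff)
  have le: "ereal \<bar>g y\<bar> \<le> T"
  proof (rule ccontr)
    assume "\<not> ?thesis"
    then have less: "T < ereal \<bar>g y\<bar>" by simp
    have "continuous_on U (\<lambda>z. ereal \<bar>g z\<bar>)"
      using continuous_on_subset[OF g U(2)] by (intro continuous_intros)
    then have "open (U \<inter> (\<lambda>z. ereal \<bar>g z\<bar>) -` {T<..})"
      using U by (intro continuous_open_preimage) auto
    moreover have "y \<in> U \<inter> (\<lambda>z. ereal \<bar>g z\<bar>) -` {T<..}" using y less by simp
    ultimately obtain e where e: "e > 0" "ball y e \<subseteq> U \<inter> (\<lambda>z. ereal \<bar>g z\<bar>) -` {T<..}"
      by (metis open_contains_ball)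
    from AE have "AE z in lborel. z \<notin> ball y e"
    proof eventually_elim
      case (elim z)
      show ?case
      proof
        assume "z \<in> ball y e"
        then have "z \<in> U" "T < ereal \<bar>g z\<bar>" using e(2) by auto
        then show False using elim U(2) by auto
      qed
    qed
    then have "emeasure lborel (ball y e) = 0" by (subst (asm) AE_iff_measurable[of "ball y e"]) auto
    then have "measure lborel (ball y e) = 0" by (simp add: measure_def)
    then show False using e(1) by simp
  qed
  \<comment> \<open>\<open>real_of_ereal\<close> maps infinite values to 0; the bounds 0 \<le> T
    \<le> B exclude that case.\<close>
  then have "ereal 0 \<le> T" by (rule order_trans[rotated]) simp
  then have "T = ereal (real_of_ereal T)" using \<open>T \<le> ereal B\<close> by (cases T) auto
  then show ?thesis using le unfolding Linf_norm_def T_def[symmetric] by (metis ereal_less_eq(3))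
qed

lemma abs_le_Linf_norm_ball:
  fixes g :: "'a::euclidean_space \<Rightarrow> real"
  assumes g: "continuous_on (ball x R) g" and r: "r < R" and y: "y \<in> ball x r"
  shows "\<bar>g y\<bar> \<le> Linf_norm (ball x r) g"
proof -
  have "cball x r \<subseteq> ball x R" using r by auto
  then have "bounded (g ` cball x r)"
    using g by (intro compact_imp_bounded compact_continuous_image) (auto intro: continuous_on_subset)
  then obtain B where "\<And>y. y \<in> cball x r \<Longrightarrow> \<bar>g y\<bar> \<le> B"
    unfolding bounded_iff by (metis imageI real_norm_def)
  then show ?thesis using r y
    by (intro abs_le_Linf_norm[where U = "ball x r" and B = B]) (auto intro: continuous_on_subset[OF g])
qed

section \<open>Taylor's formula in time\<close>

lemma C_k_on_deriv:
  fixes h :: "real \<Rightarrow> real"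
  assumes S: "open S" and h: "C_k_on (Suc k) S h"
  shows "C_k_on k S (deriv h)" "\<And>s. s \<in> S \<Longrightarrow> (h has_real_derivative deriv h s) (at s)"
proof -
  show D: "\<And>s. s \<in> S \<Longrightarrow> (h has_real_derivative deriv h s) (at s)"
    using h by (auto simp: C_k_on_open_Suc[OF S] DERIV_deriv_iff_real_differentiable simp del: C_k_on.simps)
  have "pd 1 h s = deriv h s" if "s \<in> S" for s
    using pd_eqI[OF D[OF that, unfolded has_field_derivative_def], of 1] by simp
  moreover have "C_k_on k S (pd 1 h)" using h by (simp add: C_k_on_open_Suc[OF S] del: C_k_on.simps)
  ultimately show "C_k_on k S (deriv h)" using C_k_on_cong[of S "deriv h" "pd 1 h" k] by simp
qed

lemma Taylor_2_real:
  fixes h :: "real \<Rightarrow> real"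
  assumes S: "open S" and h: "C_k_on 2 S h" and k: "k > 0" and sub: "{t..t + k} \<subseteq> S"
    and T: "\<And>s. s \<in> {t<..<t + k} \<Longrightarrow> \<bar>deriv (deriv h) s\<bar> \<le> T"
  shows "\<bar>h (t + k) - h t - k * deriv h t\<bar> \<le> k\<^sup>2 / 2 * T"
proof -
  have h2: "C_k_on (Suc (Suc 0)) S h" using h unfolding numeral_2_eq_2 .
  note d1 = C_k_on_deriv[OF S h2] and d2 = C_k_on_deriv(2)[OF S C_k_on_deriv(1)[OF S h2]]
  define D where "D m u = (if m = (0::nat) then h (t + u) else if m = 1 then deriv h (t + u) else deriv (deriv h) (t + u))" for m u
  have "DERIV (D m) u :> D (Suc m) u" if m: "m < 2" and u: "0 \<le> u" "u \<le> k" for m u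
  proof -
    have "t + u \<in> S" using u sub by auto
    then have *: "DERIV h (t + u) :> deriv h (t + u)" "DERIV (deriv h) (t + u) :> deriv (deriv h) (t + u)"
      using d1 d2 by auto
    have sh: "DERIV (\<lambda>u. h (t + u)) u :> deriv h (t + u)" "DERIV (\<lambda>u. deriv h (t + u)) u :> deriv (deriv h) (t + u)"
      using * unfolding add.commute[of t] DERIV_shift by auto
    consider "m = 0" | "m = 1" using m by linarith
    then show ?thesis by cases (simp_all add: D_def[abs_def] sh)
  qed
  then have "\<exists>\<xi>. 0 < \<xi> \<and> \<xi> < k \<and> D 0 k = (\<Sum>m<2. D m 0 / fact m * k ^ m) + D 2 \<xi> / fact 2 * k ^ 2"
    using k by (intro Maclaurin) auto
  then obtain \<xi> where \<xi>: "0 < \<xi>" "\<xi> < k" and eq: "h (t + k) = h t + deriv h t * k + deriv (deriv h) (t + \<xi>) / 2 * k\<^sup>2"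
    by (auto simp: D_def numeral_2_eq_2)
  have "\<bar>h (t + k) - h t - k * deriv h t\<bar> = k\<^sup>2 / 2 * \<bar>deriv (deriv h) (t + \<xi>)\<bar>"
    unfolding eq by (simp add: abs_mult)
  also have "\<dots> \<le> k\<^sup>2 / 2 * T" using \<xi> by (intro mult_left_mono T) auto
  finally show ?thesis .
qed



subsection \<open>Error estimates\<close>

lemma abs_signed_power: "\<bar>signed_power s q\<bar> = \<bar>s\<bar> powr q"
  by (auto simp: signed_power_def abs_mult sgn_if)

lemma tendsto_powr_at_right_0:
  fixes q :: real
  assumes "q > 0"
  shows "((\<lambda>\<epsilon>. \<epsilon> powr q) \<longlongrightarrow> 0) (at_right 0)"
proof -
  have "((\<lambda>\<epsilon>::real. \<epsilon> powr q) \<longlongrightarrow> 0 powr q) (at_right 0)"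
    by (rule tendsto_powr')
      (use assms in \<open>auto intro!: tendsto_eq_intros
         intro: eventually_at_right_less[THEN eventually_mono]\<close>)
  then show ?thesis using assms by simp
qed

text \<open>The expansions over balls require a unit vector even at a critical point, where any one
  will do.\<close>

lemma unit_direction:
  fixes g :: "'a::euclidean_space"
  obtains \<nu> where "norm \<nu> = 1" "g = norm g *\<^sub>R \<nu>" "g \<noteq> 0 \<Longrightarrow> \<nu> = sgn g"
proof (cases "g = 0")
  case True
  obtain b :: 'a where "b \<in> Basis" using nonempty_Basis by blast
  then show ?thesis using that[of b] True by simp
next
  case False
  then show ?thesis using that[of "sgn g"] by (simp add: sgn_div_norm)
qed

lemma A_well_defined_C2:
  fixes f :: "'a::euclidean_space \<Rightarrow> real"
  assumes p: "p > 2" and \<epsilon>: "0 < \<epsilon>" "\<epsilon> < 1" and r: "r < R" and balls: "balls_inside p \<epsilon> x r"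
    and f: "C_k_on 2 (ball x R) f"
  shows "A_well_defined p \<epsilon> R f x"
proof (rule A_well_definedI[OF p \<epsilon> less_imp_le[OF r] balls])
  have cont: "continuous_on (ball x R) f"
    using C_2_on_open(1)[OF f open_ball]
    by (intro continuous_at_imp_continuous_on) (auto intro: differentiable_imp_continuous_within)
  have sub: "cball x r \<subseteq> ball x R" using r by auto
  have "bounded (f ` cball x r)"
    using cont sub by (intro compact_imp_bounded compact_continuous_image) (auto intro: continuous_on_subset)
  then show "bounded (f ` ball x r)" by (rule bounded_subset) (auto intro: image_mono)
  show "f \<in> borel_measurable (restrict_space borel (ball x r))"
    using cont sub ball_subset_cball by (intro borel_measurable_continuous_on_restrict) (blast intro: continuous_on_subset)
qed

lemma Taylor_first_order:
  fixes f :: "'a::euclidean_space \<Rightarrow> real"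
  assumes f: "C_k_on 2 (ball x r) f" and K: "\<And>y. y \<in> ball x r \<Longrightarrow> norm_D2 f y \<le> K"
    and v: "norm v < r"
  shows "\<bar>f (x + v) - (f x + grad f x \<bullet> v)\<bar> \<le> K / 2 * (norm v)\<^sup>2"
proof -
  obtain \<xi> where \<xi>: "0 < \<xi>" "\<xi> < 1"
    and eq: "f (x + v) = f x + grad f x \<bullet> v + bilinear_form (hess f (x + \<xi> *\<^sub>R v)) v v / 2"
    using Taylor_2[OF f v] by blast
  have "x + \<xi> *\<^sub>R v \<in> ball x r"
    using \<xi> v mult_right_mono[of \<xi> 1 "norm v"] by (simp add: dist_norm)
  then have "norm_D2 f (x + \<xi> *\<^sub>R v) * (norm v)\<^sup>2 \<le> K * (norm v)\<^sup>2"
    by (intro mult_right_mono K) auto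
  then have "\<bar>bilinear_form (hess f (x + \<xi> *\<^sub>R v)) v v\<bar> \<le> K * (norm v)\<^sup>2"
    using bilinear_form_hess_le[of f "x + \<xi> *\<^sub>R v" v v] by (simp add: power2_eq_square mult.assoc)
  then show ?thesis unfolding eq by simp
qed

text \<open>The outer supremum and infimum are expanded only to first order in all three parts, with
  error K/2 times the squared radius. The parts differ just in how the average is estimated, which
  therefore stays a hypothesis.\<close>

lemma A_op_expansion_C2:
  fixes f :: "'a::euclidean_space \<Rightarrow> real"
  assumes p: "p > 2" and \<epsilon>: "0 < \<epsilon>" "\<epsilon> < 1" and r: "r > 0" and balls: "balls_inside p \<epsilon> x r"
    and wd: "A_well_defined p \<epsilon> R f x"
    and f: "C_k_on 2 (ball x r) f" and K: "\<And>y. y \<in> ball x r \<Longrightarrow> norm_D2 f y \<le> K"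
    and \<eta>: "\<eta> \<ge> 0" and \<theta>: "\<theta> \<ge> 0"
    and M: "\<And>c. c \<in> {c_lo p \<epsilon>..c_hi p \<epsilon>} \<Longrightarrow>
      \<bar>mean_op p (\<epsilon> * c powr (- alpha p / 2)) f x - (f x + (\<epsilon> * c powr (- alpha p / 2))\<^sup>2 * L)\<bar>
        \<le> (\<epsilon> * c powr (- alpha p / 2))\<^sup>2 * \<eta> + \<epsilon>\<^sup>2 * \<theta>"
  defines "a \<equiv> norm (grad f x)"
  defines "\<kappa> \<equiv> \<epsilon> powr (2 / (3 * p - 4)) * a + \<epsilon> powr (2 - 4 / p) * (\<bar>L\<bar> + \<eta> + K) + 2 * \<theta>"
  shows "\<epsilon>\<^sup>2 / 2 * (a powr alpha p * signed_power (L - \<eta>) (1 - alpha p) - \<kappa>) \<le> A_op p \<epsilon> f x - f x"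
    and "A_op p \<epsilon> f x - f x \<le> \<epsilon>\<^sup>2 / 2 * (a powr alpha p * signed_power (L + \<eta>) (1 - alpha p) + \<kappa>)"
proof -
  obtain \<nu> where \<nu>: "norm \<nu> = 1" and g: "grad f x = a *\<^sub>R \<nu>"
    unfolding a_def by (rule unit_direction)
  have a: "a \<ge> 0" by (simp add: a_def)
  have "0 \<le> norm_D2 f x" by (simp add: norm_D2_def sum_nonneg)
  also have "\<dots> \<le> K" using r by (intro K) auto
  finally have K0: "K \<ge> 0" .
  let ?Q = "bilinear_form (\<lambda>_ _. 0) :: 'a \<Rightarrow> 'a \<Rightarrow> real"
  have Q0: "?Q v w = 0" for v w by (simp add: bilinear_form_def)
  have rad: "\<epsilon>\<^sup>2 * c powr (1 - alpha p) > 0" "ball x (\<epsilon>\<^sup>2 * c powr (1 - alpha p)) \<subseteq> ball x r"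
    if "c \<in> {c_lo p \<epsilon>..c_hi p \<epsilon>}" for c
    using that balls c_lo_le_c_hi(2)[OF p \<epsilon>] \<epsilon> by (auto simp: balls_inside_def)
  have T: "\<bar>f (x + v) - (f x + a * (\<nu> \<bullet> v) + ?Q v v / 2)\<bar> \<le> K * s\<^sup>2 / 2"
    if v: "norm v < s" and s: "ball x s \<subseteq> ball x r" for v s
  proof -
    have "x + v \<in> ball x s" using v by (simp add: dist_norm)
    then have "x + v \<in> ball x r" using s by blast
    then have "norm v < r" by (simp add: dist_norm)
    then have "\<bar>f (x + v) - (f x + a * (\<nu> \<bullet> v))\<bar> \<le> K / 2 * (norm v)\<^sup>2"
      using Taylor_first_order[OF f K] by (simp add: g)
    also have "\<dots> \<le> K / 2 * s\<^sup>2" using v K0 by (intro mult_left_mono power_mono) auto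
    finally show ?thesis by (simp add: Q0)
  qed
  have Qh: "\<bar>?Q v w\<bar> \<le> 0 * norm v * norm w" for v w by (simp add: Q0)
  have ex: "\<bar>(SUP y\<in>ball x (\<epsilon>\<^sup>2 * c powr (1 - alpha p)). f y) - (f x + \<epsilon>\<^sup>2 * c powr (1 - alpha p) * a)\<bar>
        \<le> K * (\<epsilon>\<^sup>2 * c powr (1 - alpha p))\<^sup>2 / 2"
      "\<bar>(INF y\<in>ball x (\<epsilon>\<^sup>2 * c powr (1 - alpha p)). f y) - (f x - \<epsilon>\<^sup>2 * c powr (1 - alpha p) * a)\<bar>
        \<le> K * (\<epsilon>\<^sup>2 * c powr (1 - alpha p))\<^sup>2 / 2"
    if c: "c \<in> {c_lo p \<epsilon>..c_hi p \<epsilon>}" for c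
    using SUP_ball_expansion[OF rad(1)[OF c] bilinear_bilinear_form Qh \<nu> a refl T[OF _ rad(2)[OF c]]]
      INF_ball_expansion[OF rad(1)[OF c] bilinear_bilinear_form Qh \<nu> a refl T[OF _ rad(2)[OF c]]]
    by (simp_all add: Q0)
  show "\<epsilon>\<^sup>2 / 2 * (a powr alpha p * signed_power (L - \<eta>) (1 - alpha p) - \<kappa>) \<le> A_op p \<epsilon> f x - f x"
    "A_op p \<epsilon> f x - f x \<le> \<epsilon>\<^sup>2 / 2 * (a powr alpha p * signed_power (L + \<eta>) (1 - alpha p) + \<kappa>)"
    unfolding \<kappa>_def using A_op_expansion[OF p \<epsilon> a K0 \<eta> \<theta> wd ex M] by blast+
qed

lemma abs_normalized_p_laplacian_le:
  fixes f :: "'a::euclidean_space \<Rightarrow> real"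
  assumes p: "p > 2"
  shows "\<bar>(\<Sum>b\<in>Basis. hess f x b b) + (p - 2) * bilinear_form (hess f x) (sgn g) (sgn g)\<bar>
    \<le> (p + DIM('a) - 1) * norm_D2 f x"
proof -
  have D2: "norm_D2 f x \<ge> 0" by (simp add: norm_D2_def sum_nonneg)
  have "\<bar>bilinear_form (hess f x) (sgn g) (sgn g)\<bar> \<le> norm_D2 f x"
    using bilinear_form_hess_le[of f x "sgn g" "sgn g"] D2 by (cases "g = 0") (auto simp: norm_sgn)
  then have "\<bar>(p - 2) * bilinear_form (hess f x) (sgn g) (sgn g)\<bar> \<le> (p - 2) * norm_D2 f x"
    using p by (simp add: abs_mult mult_left_mono)
  then have "\<bar>(\<Sum>b\<in>Basis. hess f x b b) + (p - 2) * bilinear_form (hess f x) (sgn g) (sgn g)\<bar>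
      \<le> real DIM('a) * norm_D2 f x + (p - 2) * norm_D2 f x"
    using trace_hess_le[of f x] by linarith
  also have "\<dots> \<le> (p + DIM('a) - 1) * norm_D2 f x" using D2 by (simp add: algebra_simps)
  finally show ?thesis .
qed

lemma gamma_sq: "p > 2 \<Longrightarrow> (gamma d p)\<^sup>2 = 2 * (p + real d)"
  by (simp add: gamma_def)

lemma mean_radius_inside:
  fixes x :: "'a::euclidean_space"
  assumes p: "p > 2" and \<epsilon>: "0 < \<epsilon>" "\<epsilon> < 1" and balls: "balls_inside p \<epsilon> x r"
    and c: "c \<in> {c_lo p \<epsilon>..c_hi p \<epsilon>}"
  defines "s \<equiv> gamma DIM('a) p * (\<epsilon> * c powr (- alpha p / 2))"
  shows "0 < \<epsilon> * c powr (- alpha p / 2)" "0 < s" "ball x s \<subseteq> ball x r" "s \<le> r"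
proof -
  show \<rho>: "0 < \<epsilon> * c powr (- alpha p / 2)" using \<epsilon> c c_lo_le_c_hi(2)[OF p \<epsilon>] by simp
  have "gamma DIM('a) p > 0" using p by (simp add: gamma_def)
  then show s: "0 < s" unfolding s_def using \<rho> by (rule mult_pos_pos)
  show sub: "ball x s \<subseteq> ball x r" using balls c by (auto simp: balls_inside_def s_def)
  show "s \<le> r" using sub s by (simp add: ball_subset_ball_iff)
qed

text \<open>No cancellation is sought: the increment of the operator and the p-Laplacian term are
  bounded separately. Since L = 0 is expanded with \<eta> proportional to K, both are controlled by
  a^\<alpha> K^(1/(p-1)) up to the two rates.\<close>

lemma A_op_error_C2:
  fixes f :: "'a::euclidean_space \<Rightarrow> real"
  assumes p: "p > 2" and \<epsilon>: "0 < \<epsilon>" "\<epsilon> < 1" and r: "r > 0" and balls: "balls_inside p \<epsilon> x r"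
    and wd: "A_well_defined p \<epsilon> R f x"
    and f: "C_k_on 2 (ball x r) f" and K: "\<And>y. y \<in> ball x r \<Longrightarrow> norm_D2 f y \<le> K"
  defines "a \<equiv> norm (grad f x)"
  shows "\<bar>A_op p \<epsilon> f x - f x - \<epsilon>\<^sup>2 / 2 * signed_power (p_laplacian p f x) (1 / (p - 1))\<bar>
    \<le> \<epsilon>\<^sup>2 * ((p + DIM('a) + 1) * (K powr (1 / (p - 1)) * a powr alpha p
        + \<epsilon> powr (2 - 4 / p) * K + \<epsilon> powr (2 / (3 * p - 4)) * a))"
proof -
  obtain \<nu> where \<nu>: "norm \<nu> = 1" and g: "grad f x = a *\<^sub>R \<nu>"
    unfolding a_def by (rule unit_direction)
  have a: "a \<ge> 0" by (simp add: a_def)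
  have D2: "0 \<le> norm_D2 f x" by (simp add: norm_D2_def sum_nonneg)
  also have D2K: "norm_D2 f x \<le> K" using r by (intro K) auto
  finally have K0: "K \<ge> 0" .
  define C where "C = p + DIM('a)"
  have C: "C \<ge> 1" using p by (simp add: C_def)
  define q where "q = 1 / (p - 1)"
  have q: "1 - alpha p = q" "0 < q" "q \<le> 1" using p by (auto simp: q_def alpha_bounds(3)[OF p])
  let ?Q = "bilinear_form (\<lambda>_ _. 0) :: 'a \<Rightarrow> 'a \<Rightarrow> real"
  have Q0: "?Q v w = 0" for v w by (simp add: bilinear_form_def)
  have Qh: "\<bar>?Q v w\<bar> \<le> 0 * norm v * norm w" for v w by (simp add: Q0)
  \<comment> \<open>By s^2 = 2 (p + d) \<rho>^2 the first-order Taylor error K s^2 / 2 equals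
    \<rho>^2 (p + d) K.\<close>
  have M: "\<bar>mean_op p (\<epsilon> * c powr (- alpha p / 2)) f x - (f x + (\<epsilon> * c powr (- alpha p / 2))\<^sup>2 * 0)\<bar>
      \<le> (\<epsilon> * c powr (- alpha p / 2))\<^sup>2 * (C * K) + \<epsilon>\<^sup>2 * 0" if c: "c \<in> {c_lo p \<epsilon>..c_hi p \<epsilon>}" for c
  proof -
    define \<rho> where "\<rho> = \<epsilon> * c powr (- alpha p / 2)"
    define s where "s = gamma DIM('a) p * \<rho>"
    note rad = mean_radius_inside[OF p \<epsilon> balls c, folded \<rho>_def, folded s_def]
    have int: "set_integrable lborel (ball x s) f"
      using wd c by (auto simp: A_well_defined_def s_def \<rho>_def)
    have T: "\<bar>f (x + v) - (f x + a * (\<nu> \<bullet> v) + ?Q v v / 2)\<bar> \<le> K * s\<^sup>2 / 2" if v: "norm v < s" for v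
    proof -
      have "\<bar>f (x + v) - (f x + a * (\<nu> \<bullet> v))\<bar> \<le> K / 2 * (norm v)\<^sup>2"
        using Taylor_first_order[OF f K, of v] v rad by (simp add: g)
      also have "\<dots> \<le> K / 2 * s\<^sup>2" using v K0 by (intro mult_left_mono power_mono) auto
      finally show ?thesis by (simp add: Q0)
    qed
    have "\<bar>mean_op p \<rho> f x - f x\<bar> \<le> K * s\<^sup>2 / 2"
      using mean_op_expansion[OF p rad(1) int[unfolded s_def] Qh \<nu> a refl T[unfolded s_def]]
      by (simp add: Q0 s_def)
    also have "\<dots> = \<rho>\<^sup>2 * (C * K)" using p by (simp add: s_def power_mult_distrib gamma_sq C_def)
    finally show ?thesis by (simp add: \<rho>_def)
  qed
  have CK: "C * K \<ge> 0" using C K0 by simp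
  note ex = A_op_expansion_C2[OF p \<epsilon> r balls wd f K CK order_refl M, folded a_def, unfolded q(1)]
  define sp where "sp = signed_power (p_laplacian p f x) q"
  define X where "X = a powr alpha p * (C * K) powr q"
  define Y where "Y = \<epsilon> powr (2 / (3 * p - 4)) * a + \<epsilon> powr (2 - 4 / p) * (C * K + K)"
  have s1: "signed_power (C * K) q = (C * K) powr q" "signed_power (- (C * K)) q = - ((C * K) powr q)"
    using CK by (auto simp: signed_power_def sgn_if)
  have "\<bar>A_op p \<epsilon> f x - f x\<bar> \<le> \<epsilon>\<^sup>2 / 2 * (X + Y)"
    using ex by (simp add: s1 X_def Y_def abs_le_iff algebra_simps)
  moreover have "\<bar>sp\<bar> \<le> X"
  proof -
    define L where "L = (\<Sum>b\<in>Basis. hess f x b b) + (p - 2) * bilinear_form (hess f x) (sgn (grad f x)) (sgn (grad f x))"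
    have "sp = a powr alpha p * signed_power L q"
      unfolding sp_def q_def L_def a_def using signed_power_p_laplacian[OF p C_2_on_open(2)[OF f open_ball], of x] r
      by (simp add: alpha_bounds(3)[OF p])
    then have "\<bar>sp\<bar> = a powr alpha p * \<bar>L\<bar> powr q" by (simp add: abs_mult abs_signed_power)
    also have "\<bar>L\<bar> \<le> C * K"
    proof -
      have "\<bar>L\<bar> \<le> (C - 1) * norm_D2 f x"
        using abs_normalized_p_laplacian_le[OF p, of f x] by (simp add: L_def C_def)
      also have "\<dots> \<le> C * K" using D2 D2K C by (intro mult_mono) auto
      finally show ?thesis .
    qed
    then have "a powr alpha p * \<bar>L\<bar> powr q \<le> X" unfolding X_def using q by (intro mult_left_mono powr_mono2) auto
    finally show ?thesis .
  qed
  then have "\<bar>\<epsilon>\<^sup>2 / 2 * sp\<bar> \<le> \<epsilon>\<^sup>2 / 2 * X" by (simp add: abs_mult mult_left_mono)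
  ultimately have 1: "\<bar>A_op p \<epsilon> f x - f x - \<epsilon>\<^sup>2 / 2 * sp\<bar> \<le> \<epsilon>\<^sup>2 * (X + Y / 2)"
    by (simp add: algebra_simps add_divide_distrib)
  \<comment> \<open>C \<ge> 1 and q \<le> 1 allow the constant to be taken out of the power as
    \<open>C\<close>.\<close>
  have "C powr q \<le> C powr 1" using C q by (intro powr_mono) auto
  then have "a powr alpha p * (C powr q * K powr q) \<le> a powr alpha p * (C * K powr q)"
    using C by (intro mult_left_mono mult_right_mono) auto
  then have X: "X \<le> C * (K powr q * a powr alpha p)" unfolding X_def using C K0 by (simp add: powr_mult mult_ac)
  have Y: "Y = \<epsilon> powr (2 / (3 * p - 4)) * a + (C + 1) * (\<epsilon> powr (2 - 4 / p) * K)"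
    by (simp add: Y_def algebra_simps)
  define u where "u = K powr q * a powr alpha p"
  define v where "v = \<epsilon> powr (2 - 4 / p) * K"
  define w where "w = \<epsilon> powr (2 / (3 * p - 4)) * a"
  have uvw: "u \<ge> 0" "v \<ge> 0" "w \<ge> 0" using a K0 by (auto simp: u_def v_def w_def)
  have "X + Y / 2 \<le> C * u + (w + (C + 1) * v) / 2" using X Y by (simp add: u_def v_def w_def)
  also have "\<dots> \<le> (C + 1) * (u + v + w)"
  proof -
    have "0 \<le> u + (C + 1) * v / 2 + (C + 1 / 2) * w" using uvw C by simp
    then show ?thesis by (simp add: algebra_simps add_divide_distrib)
  qed
  finally have "\<epsilon>\<^sup>2 * (X + Y / 2) \<le> \<epsilon>\<^sup>2 * ((C + 1) * (u + v + w))" by (rule mult_left_mono) simp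
  with 1 show ?thesis by (simp add: sp_def q_def C_def u_def v_def w_def)
qed

lemma A_op_error_C3:
  fixes f :: "'a::euclidean_space \<Rightarrow> real"
  assumes p: "p > 2" and \<epsilon>: "0 < \<epsilon>" "\<epsilon> < 1" and r: "r > 0" and balls: "balls_inside p \<epsilon> x r"
    and wd: "A_well_defined p \<epsilon> R f x"
    and f: "C_k_on 3 (ball x r) f" and K: "\<And>y. y \<in> ball x r \<Longrightarrow> norm_D2 f y \<le> K"
    and K3: "\<And>y. y \<in> ball x r \<Longrightarrow> norm_D3 f y \<le> K3"
    and g0: "grad f x \<noteq> 0" and K1: "norm (grad f x) \<le> K1"
  shows "\<bar>A_op p \<epsilon> f x - f x - \<epsilon>\<^sup>2 / 2 * signed_power (p_laplacian p f x) (1 / (p - 1))\<bar>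
    \<le> \<epsilon>\<^sup>2 * ((p + DIM('a)) * \<epsilon> powr (2 - 4 / p) * K
      + (1 + 2 * gamma DIM('a) p ^ 3) * \<epsilon> powr (2 / (3 * p - 4)) * (K1 + K3 + (norm_D2 f x)\<^sup>2 / norm (grad f x)))"
proof -
  define a where "a = norm (grad f x)"
  define \<nu> where "\<nu> = sgn (grad f x)"
  have a: "a > 0" using g0 by (simp add: a_def)
  have \<nu>: "norm \<nu> = 1" and g: "grad f x = a *\<^sub>R \<nu>" using g0 by (simp_all add: \<nu>_def a_def norm_sgn sgn_div_norm)
  have f2: "C_k_on 2 (ball x r) f" using C_3_on_open(1)[OF f open_ball] .
  have D2: "0 \<le> norm_D2 f x" by (simp add: norm_D2_def sum_nonneg)
  have "0 \<le> norm_D3 f x" by (simp add: norm_D3_def sum_nonneg)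
  also have "\<dots> \<le> K3" using r by (intro K3) auto
  finally have K30: "K3 \<ge> 0" .
  have D2K: "norm_D2 f x \<le> K" using r by (intro K) auto
  define h where "h = norm_D2 f x"
  define z where "z = h\<^sup>2 / a"
  define L where "L = (\<Sum>b\<in>Basis. hess f x b b) + (p - 2) * bilinear_form (hess f x) \<nu> \<nu>"
  define G where "G = gamma DIM('a) p ^ 3"
  have G: "G \<ge> 0" using p by (simp add: G_def gamma_def)
  define e where "e = \<epsilon> powr (2 / (3 * p - 4))"
  have e: "e \<ge> 0" by (simp add: e_def)
  \<comment> \<open>K3/6 comes from the third-order Taylor remainder, 2 z from maximizing off the
    gradient direction. Both carry s^3 = gamma^3 \<rho>^3, which \<open>mean_radius_cube_le\<close>
    turns into at most gamma^3 \<epsilon>^2 \<open>e\<close>.\<close>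
  define \<theta> where "\<theta> = e * (G * (K3 / 6 + 2 * z))"
  have H: "K3 / 6 + 2 * z \<ge> 0" using K30 a by (simp add: z_def)
  have \<theta>: "\<theta> \<ge> 0" unfolding \<theta>_def using e G H by (intro mult_nonneg_nonneg)
  have M: "\<bar>mean_op p (\<epsilon> * c powr (- alpha p / 2)) f x - (f x + (\<epsilon> * c powr (- alpha p / 2))\<^sup>2 * L)\<bar>
      \<le> (\<epsilon> * c powr (- alpha p / 2))\<^sup>2 * 0 + \<epsilon>\<^sup>2 * \<theta>" if c: "c \<in> {c_lo p \<epsilon>..c_hi p \<epsilon>}" for c
  proof -
    define \<rho> where "\<rho> = \<epsilon> * c powr (- alpha p / 2)"
    define s where "s = gamma DIM('a) p * \<rho>"
    note rad = mean_radius_inside[OF p \<epsilon> balls c, folded \<rho>_def, folded s_def]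
    have int: "set_integrable lborel (ball x s) f"
      using wd c by (auto simp: A_well_defined_def s_def \<rho>_def)
    have T: "\<bar>f (x + v) - (f x + a * (\<nu> \<bullet> v) + bilinear_form (hess f x) v v / 2)\<bar> \<le> K3 / 6 * s ^ 3" if v: "norm v < s" for v
    proof -
      have vr: "norm v < r" using v rad by simp
      define t where "t y = (\<Sum>a\<in>Basis. \<Sum>b\<in>Basis. \<Sum>c\<in>Basis. (v \<bullet> a) * (v \<bullet> b) * (v \<bullet> c) * pd a (pd b (pd c f)) y)" for y
      obtain \<xi> where \<xi>: "0 < \<xi>" "\<xi> < 1"
        and eq: "f (x + v) = f x + grad f x \<bullet> v + bilinear_form (hess f x) v v / 2 + t (x + \<xi> *\<^sub>R v) / 6"
        using Taylor_3[OF f vr] unfolding t_def by blast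
      have "x + \<xi> *\<^sub>R v \<in> ball x r"
        using \<xi> vr mult_right_mono[of \<xi> 1 "norm v"] by (simp add: dist_norm)
      then have "norm_D3 f (x + \<xi> *\<^sub>R v) * norm v ^ 3 \<le> K3 * s ^ 3"
        using K30 v by (intro mult_mono power_mono K3) auto
      then have "\<bar>t (x + \<xi> *\<^sub>R v)\<bar> \<le> K3 * s ^ 3"
        using trilinear_form_le[of v f "x + \<xi> *\<^sub>R v"] unfolding t_def by linarith
      then show ?thesis unfolding eq by (simp add: g)
    qed
    have "\<bar>mean_op p \<rho> f x - (f x + \<rho>\<^sup>2 * L)\<bar> \<le> K3 / 6 * s ^ 3 + 2 * s ^ 3 * h\<^sup>2 / a"
      unfolding L_def s_def
      by (rule mean_op_expansion[OF p rad(1) int[unfolded s_def] _ \<nu> less_imp_le[OF a] _ T[unfolded s_def]])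
        (use a bilinear_form_hess_le in \<open>auto simp: h_def\<close>)
    also have "\<dots> = \<rho> ^ 3 * (G * (K3 / 6 + 2 * z))" by (simp add: s_def G_def z_def power_mult_distrib algebra_simps)
    also have "\<dots> \<le> (\<epsilon>\<^sup>2 * e) * (G * (K3 / 6 + 2 * z))"
      using mean_radius_cube_le[OF p \<epsilon> c] G H unfolding \<rho>_def e_def by (intro mult_right_mono mult_nonneg_nonneg)
    finally show ?thesis by (simp add: \<rho>_def \<theta>_def mult_ac)
  qed
  note ex = A_op_expansion_C2[OF p \<epsilon> r balls wd f2 K order_refl \<theta> M, folded a_def]
  define sp where "sp = signed_power (p_laplacian p f x) (1 / (p - 1))"
  have sp: "a powr alpha p * signed_power L (1 - alpha p) = sp"
    unfolding sp_def L_def a_def \<nu>_def using signed_power_p_laplacian[OF p C_2_on_open(2)[OF f2 open_ball], of x] r by simp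
  define \<kappa> where "\<kappa> = e * a + \<epsilon> powr (2 - 4 / p) * (\<bar>L\<bar> + K) + 2 * \<theta>"
  have 1: "\<bar>A_op p \<epsilon> f x - f x - \<epsilon>\<^sup>2 / 2 * sp\<bar> \<le> \<epsilon>\<^sup>2 / 2 * \<kappa>"
  proof -
    have "\<epsilon>\<^sup>2 / 2 * (sp - \<kappa>) \<le> A_op p \<epsilon> f x - f x" "A_op p \<epsilon> f x - f x \<le> \<epsilon>\<^sup>2 / 2 * (sp + \<kappa>)"
      using ex by (simp_all add: sp \<kappa>_def e_def)
    then show ?thesis unfolding right_diff_distrib distrib_left by linarith
  qed
  have "\<bar>L\<bar> \<le> (p + DIM('a) - 1) * norm_D2 f x"
    using abs_normalized_p_laplacian_le[OF p, of f x] by (simp add: L_def \<nu>_def)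
  also have "\<dots> \<le> (p + DIM('a) - 1) * K" using p D2K by (intro mult_left_mono) auto
  finally have "\<bar>L\<bar> + K \<le> (p + DIM('a)) * K" by (simp add: algebra_simps)
  then have L: "\<epsilon> powr (2 - 4 / p) * (\<bar>L\<bar> + K) \<le> \<epsilon> powr (2 - 4 / p) * ((p + DIM('a)) * K)"
    by (intro mult_left_mono) auto
  have "K \<ge> 0" using D2 D2K by simp
  then have PK: "0 \<le> \<epsilon> powr (2 - 4 / p) * ((p + DIM('a)) * K)" using p by simp
  have z: "z \<ge> 0" using a by (simp add: z_def)
  \<comment> \<open>The coefficient 4 G of \<open>z\<close> on the left dictates the shape 1 + 2 G
    of the constant.\<close>
  have "a + 2 * (G * (K3 / 6 + 2 * z)) \<le> 2 * (1 + 2 * G) * (K1 + K3 + z)"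
  proof -
    have "0 \<le> G * K1" "0 \<le> G * K3" "0 \<le> G * z"
      by (rule mult_nonneg_nonneg[OF G]; rule order_trans[OF norm_ge_zero K1] K30 z)+
    moreover have "a \<le> K1" "0 \<le> a" using K1 a by (auto simp: a_def)
    ultimately show ?thesis using K30 z by (simp add: algebra_simps)
  qed
  from mult_left_mono[OF this e]
  have "\<kappa> / 2 \<le> \<epsilon> powr (2 - 4 / p) * ((p + DIM('a)) * K) + e * ((1 + 2 * G) * (K1 + K3 + z))"
    using L PK unfolding \<kappa>_def \<theta>_def by (simp add: algebra_simps)
  from mult_left_mono[OF this, of "\<epsilon>\<^sup>2"] 1
  show ?thesis by (simp add: sp_def e_def z_def h_def a_def G_def mult_ac)
qed


section \<open>The limit for C^2 functions\<close>

lemma hess_remainder: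
  fixes f :: "'a::euclidean_space \<Rightarrow> real"
  assumes f: "C_k_on 2 (ball x r) f" and r: "r > 0" and \<mu>: "\<mu> > 0"
  shows "\<exists>s>0. s \<le> r \<and> (\<forall>v. norm v < s \<longrightarrow>
    \<bar>f (x + v) - (f x + grad f x \<bullet> v + bilinear_form (hess f x) v v / 2)\<bar> \<le> \<mu> / 2 * (norm v)\<^sup>2)"
proof -
  \<comment> \<open>\<open>F\<close> is continuous and vanishes at \<open>x\<close>, so near
    \<open>x\<close> the intermediate point in Taylor's formula may be replaced by \<open>x\<close>
    at the price of \<mu>.\<close>
  define F where "F y = sqrt (\<Sum>b\<in>Basis. \<Sum>c\<in>Basis. (hess f y b c - hess f x b c)\<^sup>2)" for y
  have "continuous_on (ball x r) F"
    unfolding F_def by (intro continuous_intros C_2_on_open(4)[OF f open_ball])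
  then have "isCont F x" using r by (simp add: continuous_on_eq_continuous_at)
  then have "(F \<longlongrightarrow> F x) (nhds x)" unfolding isCont_def tendsto_at_iff_tendsto_nhds .
  moreover have "F x < \<mu>" using \<mu> by (simp add: F_def)
  ultimately have "eventually (\<lambda>y. F y < \<mu>) (nhds x)" by (rule order_tendstoD(2))
  then obtain s0 where s0: "s0 > 0" "\<And>y. dist y x < s0 \<Longrightarrow> F y < \<mu>"
    unfolding eventually_nhds_metric by blast
  show ?thesis
  proof (intro exI[of _ "min s0 r"] conjI allI impI)
    fix v :: 'a assume v: "norm v < min s0 r"
    then obtain \<xi> where \<xi>: "0 < \<xi>" "\<xi> < 1"
      and eq: "f (x + v) = f x + grad f x \<bullet> v + bilinear_form (hess f (x + \<xi> *\<^sub>R v)) v v / 2"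
      using Taylor_2[OF f, of v] by auto
    have "norm (\<xi> *\<^sub>R v) \<le> norm v" using \<xi> mult_right_mono[of \<xi> 1 "norm v"] by simp
    then have "F (x + \<xi> *\<^sub>R v) < \<mu>" using v by (intro s0(2)) (simp add: dist_norm)
    then have "F (x + \<xi> *\<^sub>R v) * (norm v)\<^sup>2 \<le> \<mu> * (norm v)\<^sup>2" by (intro mult_right_mono) auto
    moreover have "bilinear_form (hess f (x + \<xi> *\<^sub>R v)) v v - bilinear_form (hess f x) v v
        = bilinear_form (\<lambda>b c. hess f (x + \<xi> *\<^sub>R v) b c - hess f x b c) v v"
      by (simp add: bilinear_form_def sum_subtractf algebra_simps)
    ultimately have "\<bar>bilinear_form (hess f (x + \<xi> *\<^sub>R v)) v v - bilinear_form (hess f x) v v\<bar> \<le> \<mu> * (norm v)\<^sup>2"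
      using bilinear_form_le[of "\<lambda>b c. hess f (x + \<xi> *\<^sub>R v) b c - hess f x b c" v v]
      by (simp add: F_def power2_eq_square mult.assoc)
    then show "\<bar>f (x + v) - (f x + grad f x \<bullet> v + bilinear_form (hess f x) v v / 2)\<bar> \<le> \<mu> / 2 * (norm v)\<^sup>2"
      unfolding eq by (simp only: abs_le_iff) linarith
  qed (use s0 r in auto)
qed

lemma norm_D2_bounded:
  fixes f :: "'a::euclidean_space \<Rightarrow> real"
  assumes f: "C_k_on 2 (ball x R) f" and r: "r < R" and y: "y \<in> ball x r"
  shows "norm_D2 f y \<le> Linf_norm (ball x r) (norm_D2 f)"
proof -
  have "continuous_on (ball x R) (norm_D2 f)"
    unfolding norm_D2_def by (intro continuous_intros C_2_on_open(4)[OF f open_ball])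
  from abs_le_Linf_norm_ball[OF this r y] show ?thesis by simp
qed

lemma A_op_limit:
  fixes f :: "'a::euclidean_space \<Rightarrow> real"
  assumes p: "p > 2" and R: "R > 0" and f: "C_k_on 2 (ball x R) f"
  shows "((\<lambda>\<epsilon>. (A_op p \<epsilon> f x - f x) / \<epsilon>\<^sup>2) \<longlongrightarrow> signed_power (p_laplacian p f x) (1 / (p - 1)) / 2) (at_right 0)"
proof -
  define r where "r = R / 2"
  have r: "0 < r" "r < R" using R by (auto simp: r_def)
  have fr: "C_k_on 2 (ball x r) f" by (rule C_k_on_open_subset[OF open_ball subset_ball f]) (use r in simp)
  define K where "K = Linf_norm (ball x r) (norm_D2 f)"
  have K: "\<And>y. y \<in> ball x r \<Longrightarrow> norm_D2 f y \<le> K" unfolding K_def using norm_D2_bounded[OF f r(2)] .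
  define a where "a = norm (grad f x)"
  define sp where "sp = signed_power (p_laplacian p f x) (1 / (p - 1))"
  define A where "A \<epsilon> = A_op p \<epsilon> f x - f x" for \<epsilon>
  have ev1: "eventually (\<lambda>\<epsilon>::real. 0 < \<epsilon> \<and> \<epsilon> < 1) (at_right 0)"
    unfolding eventually_at_right_field by (intro exI[of _ 1]) auto
  have lim1: "((\<lambda>\<epsilon>::real. \<epsilon> powr (2 - 4 / p)) \<longlongrightarrow> 0) (at_right 0)"
    by (rule tendsto_powr_at_right_0) (use p in \<open>simp add: field_simps\<close>)
  have lim2: "((\<lambda>\<epsilon>::real. \<epsilon> powr (2 / (3 * p - 4))) \<longlongrightarrow> 0) (at_right 0)"
    by (rule tendsto_powr_at_right_0) (use p in simp)
  have wd: "A_well_defined p \<epsilon> R f x" if "0 < \<epsilon>" "\<epsilon> < 1" "balls_inside p \<epsilon> x r" for \<epsilon>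
    using A_well_defined_C2[OF p that(1,2) r(2) that(3) f] .
  have "((\<lambda>\<epsilon>. A \<epsilon> / \<epsilon>\<^sup>2) \<longlongrightarrow> sp / 2) (at_right 0)"
  \<comment> \<open>At a critical point \<open>A_op_error_C2\<close> is already sharp enough: its
    terms with a factor \<open>a\<close> vanish and the remaining one tends to 0.\<close>
  proof (cases "grad f x = 0")
    case True
    then have "sp = 0"
      unfolding sp_def using p_laplacian_eq_0[OF p C_2_on_open(2)[OF fr open_ball], of x] r by (simp add: signed_power_def)
    define X where "X \<epsilon> = (p + DIM('a) + 1) * (\<epsilon> powr (2 - 4 / p) * K)" for \<epsilon>
    have "(X \<longlongrightarrow> (p + DIM('a) + 1) * (0 * K)) (at_right 0)"
      unfolding X_def by (intro tendsto_intros lim1)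
    then have X: "(X \<longlongrightarrow> 0) (at_right 0)" by simp
    have "eventually (\<lambda>\<epsilon>. norm (A \<epsilon> / \<epsilon>\<^sup>2) \<le> X \<epsilon>) (at_right 0)"
      using ev1 eventually_balls_inside[OF p r(1), of x]
    proof eventually_elim
      case (elim \<epsilon>)
      then have "\<bar>A \<epsilon>\<bar> \<le> \<epsilon>\<^sup>2 * X \<epsilon>"
        using A_op_error_C2[OF p _ _ r(1) _ wd fr K, of \<epsilon>] True \<open>sp = 0\<close>
        by (simp add: A_def X_def sp_def)
      then show ?case using elim by (simp add: divide_simps mult.commute)
    qed
    then show ?thesis using X \<open>sp = 0\<close> by (simp add: Lim_null_comparison)
  next
    case False
    define \<nu> where "\<nu> = sgn (grad f x)"
    have a: "a > 0" using False by (simp add: a_def)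
    have \<nu>: "norm \<nu> = 1" and g: "grad f x = a *\<^sub>R \<nu>" using False by (simp_all add: \<nu>_def a_def norm_sgn sgn_div_norm)
    define h where "h = norm_D2 f x"
    define L where "L = (\<Sum>b\<in>Basis. hess f x b b) + (p - 2) * bilinear_form (hess f x) \<nu> \<nu>"
    define P where "P b = a powr alpha p * signed_power b (1 - alpha p)" for b
    have sp: "P L = sp"
      unfolding sp_def L_def a_def \<nu>_def P_def
      using signed_power_p_laplacian[OF p C_2_on_open(2)[OF fr open_ball], of x] r by simp
    have P: "((\<lambda>\<eta>. P (k \<eta>)) \<longlongrightarrow> P L) (at_right 0)" if "(k \<longlongrightarrow> L) (at_right 0)" for k :: "real \<Rightarrow> real"
      unfolding P_def signed_power_eq_pos_powr using alpha_bounds(2)[OF p] that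
      by (intro tendsto_intros tendsto_pos_powr) auto
    have P2: "((\<lambda>\<eta>. P (L + \<eta>)) \<longlongrightarrow> P L) (at_right 0)" "((\<lambda>\<eta>. P (L - \<eta>)) \<longlongrightarrow> P L) (at_right 0)"
    proof -
      have "((\<lambda>\<eta>. L + \<eta>) \<longlongrightarrow> L + 0) (at_right 0)" "((\<lambda>\<eta>. L - \<eta>) \<longlongrightarrow> L - 0) (at_right 0)"
        by (intro tendsto_intros)+
      then show "((\<lambda>\<eta>. P (L + \<eta>)) \<longlongrightarrow> P L) (at_right 0)" "((\<lambda>\<eta>. P (L - \<eta>)) \<longlongrightarrow> P L) (at_right 0)"
        using P by simp_all
    qed
    show ?thesis
    proof (rule tendstoI)
      fix e :: real assume e: "e > 0"
      have "eventually (\<lambda>\<eta>. dist (P (L + \<eta>)) (P L) < e \<and> dist (P (L - \<eta>)) (P L) < e \<and> 0 < \<eta>) (at_right 0)"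
        using tendstoD[OF P2(1) e] tendstoD[OF P2(2) e] eventually_at_right_less by eventually_elim auto
      then obtain \<eta> where \<eta>: "\<bar>P (L + \<eta>) - P L\<bar> < e" "\<bar>P (L - \<eta>) - P L\<bar> < e" "0 < \<eta>"
        unfolding dist_real_def using eventually_happens[of _ "at_right (0::real)"] by auto
      define C where "C = p + DIM('a)"
      have C: "C > 0" using p by (simp add: C_def)
      \<comment> \<open>Half of \<eta> pays for the Hessian remainder: with s^2 = 2 C \<rho>^2, the
        error \<eta> / (2 C) / 2 times s^2 is \<rho>^2 \<eta> / 2.\<close>
      obtain s0 where s0: "s0 > 0" "s0 \<le> r" and T: "\<And>v. norm v < s0 \<Longrightarrow>
          \<bar>f (x + v) - (f x + grad f x \<bullet> v + bilinear_form (hess f x) v v / 2)\<bar> \<le> \<eta> / (2 * C) / 2 * (norm v)\<^sup>2"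
        using hess_remainder[OF fr r(1), of "\<eta> / (2 * C)"] \<eta> C by auto
      \<comment> \<open>The other half pays for 2 s^3 h^2 / a = 4 C s (h^2 / a) \<rho>^2, small for
        s \<le> s1. The summand 1 keeps the denominator positive if \<open>h = 0\<close>.\<close>
      define s1 where "s1 = min s0 (\<eta> / (8 * C * (h\<^sup>2 / a + 1)))"
      have ha: "h\<^sup>2 / a + 1 > 0" using a by (simp add: add_nonneg_pos)
      have s1: "s1 > 0" "s1 \<le> s0" using s0 \<eta> C ha by (auto simp: s1_def)
      have s1h: "4 * C * s1 * (h\<^sup>2 / a) \<le> \<eta> / 2"
      proof -
        have "s1 * (8 * C * (h\<^sup>2 / a + 1)) \<le> \<eta>"
          using C ha by (intro pos_le_divide_eq[THEN iffD1]) (auto simp: s1_def)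
        moreover have "s1 * (8 * C) \<ge> 0" using s1 C by simp
        ultimately show ?thesis by (simp add: algebra_simps)
      qed
      define \<kappa> where "\<kappa> \<epsilon> = \<epsilon> powr (2 / (3 * p - 4)) * a + \<epsilon> powr (2 - 4 / p) * (\<bar>L\<bar> + \<eta> + K)" for \<epsilon>
      have "(\<kappa> \<longlongrightarrow> 0 * a + 0 * (\<bar>L\<bar> + \<eta> + K)) (at_right 0)"
        unfolding \<kappa>_def by (intro tendsto_intros lim1 lim2)
      then have "eventually (\<lambda>\<epsilon>. \<kappa> \<epsilon> < e) (at_right 0)"
        using e by (intro order_tendstoD(2)) auto
      then show "eventually (\<lambda>\<epsilon>. dist (A \<epsilon> / \<epsilon>\<^sup>2) (sp / 2) < e) (at_right 0)"
        using ev1 eventually_balls_inside[OF p r(1), of x] eventually_balls_inside[OF p s1(1), of x]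
      proof eventually_elim
        \<comment> \<open>\<eta> and \<open>s1\<close> are fixed before \<epsilon>. The balls fit
          into radius \<open>r\<close>, where \<open>K\<close> is valid, and for small \<epsilon>
          also into radius \<open>s1\<close>, where the average is accurate.\<close>
        case (elim \<epsilon>)
        then have \<epsilon>: "0 < \<epsilon>" "\<epsilon> < 1" by auto
        note wd' = wd[OF \<epsilon> elim(3)]
        have M: "\<bar>mean_op p (\<epsilon> * c powr (- alpha p / 2)) f x - (f x + (\<epsilon> * c powr (- alpha p / 2))\<^sup>2 * L)\<bar>
            \<le> (\<epsilon> * c powr (- alpha p / 2))\<^sup>2 * \<eta> + \<epsilon>\<^sup>2 * 0" if c: "c \<in> {c_lo p \<epsilon>..c_hi p \<epsilon>}" for c
        proof -
          define \<rho> where "\<rho> = \<epsilon> * c powr (- alpha p / 2)"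
          define s where "s = gamma DIM('a) p * \<rho>"
          note rad = mean_radius_inside[OF p \<epsilon> elim(4) c, folded \<rho>_def, folded s_def]
          have int: "set_integrable lborel (ball x s) f"
            using wd' c by (auto simp: A_well_defined_def s_def \<rho>_def)
          have s2: "s\<^sup>2 = 2 * C * \<rho>\<^sup>2" using p by (simp add: s_def power_mult_distrib gamma_sq C_def)
          have Ts: "\<bar>f (x + v) - (f x + a * (\<nu> \<bullet> v) + bilinear_form (hess f x) v v / 2)\<bar> \<le> \<eta> / (2 * C) / 2 * s\<^sup>2"
            if v: "norm v < s" for v
          proof -
            have "\<eta> / (2 * C) / 2 * (norm v)\<^sup>2 \<le> \<eta> / (2 * C) / 2 * s\<^sup>2"
              using v \<eta> C by (intro mult_left_mono power_mono) auto
            then show ?thesis using T[of v] v rad s1 by (simp add: g)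
          qed
          have "\<bar>mean_op p \<rho> f x - (f x + \<rho>\<^sup>2 * L)\<bar> \<le> \<eta> / (2 * C) / 2 * s\<^sup>2 + 2 * s ^ 3 * h\<^sup>2 / a"
            unfolding L_def s_def
            by (rule mean_op_expansion[OF p rad(1) int[unfolded s_def] _ \<nu> less_imp_le[OF a] _ Ts[unfolded s_def]])
              (use a bilinear_form_hess_le in \<open>auto simp: h_def\<close>)
          also have "\<eta> / (2 * C) / 2 * s\<^sup>2 = \<rho>\<^sup>2 * (\<eta> / 2)" using C by (simp add: s2)
          also have "2 * s ^ 3 * h\<^sup>2 / a = \<rho>\<^sup>2 * (4 * C * s * (h\<^sup>2 / a))"
            using s2 by (simp add: power3_eq_cube power2_eq_square)
          also have "4 * C * s * (h\<^sup>2 / a) \<le> 4 * C * s1 * (h\<^sup>2 / a)"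
            using rad C a by (intro mult_right_mono mult_left_mono) auto
          then have "\<rho>\<^sup>2 * (4 * C * s * (h\<^sup>2 / a)) \<le> \<rho>\<^sup>2 * (\<eta> / 2)"
            using s1h by (intro mult_left_mono) auto
          finally show ?thesis by (simp add: \<rho>_def mult.commute)
        qed
        note ex = A_op_expansion_C2[OF p \<epsilon> r(1) elim(3) wd' fr K less_imp_le[OF \<eta>(3)] order_refl M,
            folded a_def, folded P_def A_def]
        have "\<epsilon>\<^sup>2 / 2 * (P (L - \<eta>) - \<kappa> \<epsilon>) \<le> A \<epsilon>" "A \<epsilon> \<le> \<epsilon>\<^sup>2 / 2 * (P (L + \<eta>) + \<kappa> \<epsilon>)"
          using ex by (simp_all add: \<kappa>_def)
        then have B: "(P (L - \<eta>) - \<kappa> \<epsilon>) / 2 \<le> A \<epsilon> / \<epsilon>\<^sup>2" "A \<epsilon> / \<epsilon>\<^sup>2 \<le> (P (L + \<eta>) + \<kappa> \<epsilon>) / 2"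
          using \<epsilon> by (simp_all add: pos_le_divide_eq pos_divide_le_eq mult.commute)
        \<comment> \<open>The factor 1/2 of the operator makes room for both errors: (e + e) / 2 =
          e.\<close>
        have close: "\<bar>q - P L / 2\<bar> < e" if "(P (L - \<eta>) - k) / 2 \<le> q" "q \<le> (P (L + \<eta>) + k) / 2" "k < e" for q k
          using that \<eta>(1,2) unfolding abs_less_iff by (elim conjE, intro conjI; simp add: field_simps)
        show ?case unfolding sp[symmetric] dist_real_def by (rule close[OF B elim(1)])
      qed
    qed
  qed
  then show ?thesis by (simp add: A_def sp_def)
qed


section \<open>Slices in space and time, and the final assembly\<close>

lemma balls_inside_mono: "balls_inside p \<epsilon> x r \<Longrightarrow> r \<le> R \<Longrightarrow> balls_inside p \<epsilon> x R"
  unfolding balls_inside_def by (meson subset_ball subset_trans)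

text \<open>The embedding y \<mapsto> (y, t) has derivative v \<mapsto> (v, 0), which preserves
  basis vectors. Restricting first to the open time interval makes the product domain open.\<close>

lemma C_k_on_space_slice:
  fixes \<phi> :: "'a::euclidean_space \<times> real \<Rightarrow> real"
  assumes \<phi>: "C_k_on k (ball x R \<times> {t - \<tau>..t + \<tau>}) \<phi>" and \<tau>: "\<tau> > 0"
  shows "C_k_on k (ball x R) (\<lambda>y. \<phi> (y, t))"
proof (rule C_k_on_compose_affine[where J = "\<lambda>v. (v, 0)"])
  show "C_k_on k (ball x R \<times> {t - \<tau><..<t + \<tau>}) \<phi>"
    by (rule C_k_on_open_subset[OF _ _ \<phi>]) (auto intro: open_Times)
  show "((\<lambda>y. (y, t)) has_derivative (\<lambda>v. (v, 0))) (at y)" for y :: 'a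
    by (auto intro!: derivative_eq_intros)
qed (use \<tau> in \<open>auto intro: open_Times simp: Basis_prod_def\<close>)

lemma C_k_on_time_slice:
  fixes \<phi> :: "'a::euclidean_space \<times> real \<Rightarrow> real"
  assumes \<phi>: "C_k_on k (ball x R \<times> {t - \<tau>..t + \<tau>}) \<phi>" and R: "R > 0"
  shows "C_k_on k {t - \<tau><..<t + \<tau>} (\<lambda>s. \<phi> (x, s))"
proof (rule C_k_on_compose_affine[where J = "\<lambda>v. (0, v)"])
  show "C_k_on k (ball x R \<times> {t - \<tau><..<t + \<tau>}) \<phi>"
    by (rule C_k_on_open_subset[OF _ _ \<phi>]) (auto intro: open_Times)
  show "((\<lambda>s. (x, s)) has_derivative (\<lambda>v. (0, v))) (at s)" for s :: real
    by (auto intro!: derivative_eq_intros)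
qed (use R in \<open>auto intro: open_Times simp: Basis_prod_def\<close>)

text \<open>As \<delta> < \<tau>, the closed interval is compact inside the domain, so the second
  time derivative is bounded there and its essential supremum bounds it at every interior
  time.\<close>

lemma time_increment_error:
  fixes h :: "real \<Rightarrow> real"
  assumes h: "C_k_on 2 {t - \<tau><..<t + \<tau>} h" and \<delta>: "0 < \<delta>" "\<delta> < \<tau>" and k: "0 < k" "k \<le> \<delta>"
  shows "\<bar>h (t + k) - h t - k * deriv h t\<bar> \<le> k\<^sup>2 / 2 * Linf_norm {t - \<delta>..t + \<delta>} (deriv (deriv h))"
    and "0 \<le> Linf_norm {t - \<delta>..t + \<delta>} (deriv (deriv h))"
proof -
  let ?S = "{t - \<tau><..<t + \<tau>}" and ?I = "{t - \<delta>..t + \<delta>}"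
  have sub: "?I \<subseteq> ?S" using \<delta> by auto
  have h2: "C_k_on (Suc (Suc 0)) ?S h" using h unfolding numeral_2_eq_2 .
  have "C_k_on (Suc 0) ?S (deriv h)" by (rule C_k_on_deriv(1)[OF _ h2]) simp
  then have "C_k_on 0 ?S (deriv (deriv h))" by (rule C_k_on_deriv(1)[rotated]) simp
  then have cont: "continuous_on ?I (deriv (deriv h))" using sub by (auto intro: continuous_on_subset)
  then have "bounded (deriv (deriv h) ` ?I)"
    by (intro compact_imp_bounded compact_continuous_image) auto
  then obtain B where B: "\<And>s. s \<in> ?I \<Longrightarrow> \<bar>deriv (deriv h) s\<bar> \<le> B"
    unfolding bounded_iff by (metis imageI real_norm_def)
  have T: "\<bar>deriv (deriv h) s\<bar> \<le> Linf_norm ?I (deriv (deriv h))" if "s \<in> {t - \<delta><..<t + \<delta>}" for s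
    by (rule abs_le_Linf_norm[where U = "{t - \<delta><..<t + \<delta>}", OF _ cont B]) (use that in auto)
  show "\<bar>h (t + k) - h t - k * deriv h t\<bar> \<le> k\<^sup>2 / 2 * Linf_norm ?I (deriv (deriv h))"
    by (rule Taylor_2_real[OF _ h k(1)]) (use \<delta> k in \<open>auto intro!: T\<close>)
  show "0 \<le> Linf_norm ?I (deriv (deriv h))"
    using T[of t] \<delta> by simp
qed

lemma measurable_space_slice:
  fixes \<phi> :: "'a::euclidean_space \<times> real \<Rightarrow> real"
  assumes \<phi>: "\<phi> \<in> borel_measurable (restrict_space borel (S \<times> I))" and t: "t \<in> I"
  shows "(\<lambda>y. \<phi> (y, t)) \<in> borel_measurable (restrict_space borel S)"
proof (rule measurable_compose[OF _ \<phi>])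
  show "(\<lambda>y. (y, t)) \<in> restrict_space borel S \<rightarrow>\<^sub>M restrict_space borel (S \<times> I)"
    using t by (intro measurable_restrict_space2 measurable_restrict_space1 borel_measurable_continuous_onI continuous_intros)
      (auto simp: space_restrict_space)
qed

text \<open>The averaging radius reaches the order \<epsilon>^((2p-2)/(3p-4)), with exponent below
  1, so for \<epsilon> close to \<open>\<epsilon>\<^sub>0\<close> the averaging balls need not lie
  in the ball of radius \<open>\<epsilon>\<^sub>0\<close>. Hence the norms in (b) and (c) are taken
  over a ball of radius \<open>r \<ge> \<epsilon>\<^sub>0\<close> that contains all balls of the
  operator; for all small \<epsilon> the choice \<open>r = \<epsilon>\<^sub>0\<close> is
  admissible.\<close>

theorem theorem2p6:
  fixes p :: real
  assumes "p > 2"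
  shows "\<exists>k1>0. \<exists>k2>0. \<exists>k3>0.
    \<forall>(x :: real ^ 'n) (t :: real) (R :: real) (\<tau> :: real).
      t > 0 \<longrightarrow> R \<in> {0<..<1} \<longrightarrow> \<tau> \<in> {0<..<t} \<longrightarrow>
      (\<exists>\<epsilon>\<^sub>0 \<in> {0<..<min R \<tau>}.
         (\<forall>\<epsilon> \<in> {0<..<\<epsilon>\<^sub>0}. balls_inside p \<epsilon> x R \<and>
            (\<forall>\<phi> :: (real ^ 'n) \<times> real \<Rightarrow> real.
               bounded (\<phi> ` (ball x R \<times> {t - \<tau>..t + \<tau>})) \<longrightarrow>
               \<phi> \<in> borel_measurable (restrict_space borel (ball x R \<times> {t - \<tau>..t + \<tau>})) \<longrightarrow>
               A_well_defined p \<epsilon> R (\<lambda>y. \<phi> (y, t)) x)) \<and>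
         (\<forall>\<phi> :: (real ^ 'n) \<times> real \<Rightarrow> real.
            C_k_on 2 (ball x R \<times> {t - \<tau>..t + \<tau>}) \<phi> \<longrightarrow>
            (let f = (\<lambda>y. \<phi> (y, t));
                 h = (\<lambda>s. \<phi> (x, s));
                 T = Linf_norm {t - \<epsilon>\<^sub>0\<^sup>2 / 2..t + \<epsilon>\<^sub>0\<^sup>2 / 2} (deriv (deriv h))
             in \<exists>E :: real \<Rightarrow> real.
                  (\<forall>\<epsilon> \<in> {0<..<\<epsilon>\<^sub>0}. A_well_defined p \<epsilon> R f x \<and>
                     A_op p \<epsilon> f x = \<phi> (x, t + \<epsilon>\<^sup>2 / 2)
                       + \<epsilon>\<^sup>2 / 2 * (signed_power (p_laplacian p f x) (1 / (p - 1)) - deriv h t)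
                       + \<epsilon>\<^sup>2 * E \<epsilon>) \<and>
                  (E \<longlongrightarrow> 0) (at_right 0) \<and>
                  (C_k_on 3 (ball x R \<times> {t - \<tau>..t + \<tau>}) \<phi> \<longrightarrow> grad f x \<noteq> 0 \<longrightarrow>
                     (\<forall>\<epsilon> \<in> {0<..<\<epsilon>\<^sub>0}. \<forall>r \<in> {\<epsilon>\<^sub>0..<R}. balls_inside p \<epsilon> x r \<longrightarrow>
                        \<bar>E \<epsilon>\<bar> \<le> \<epsilon>\<^sup>2 * T
                          + k1 * \<epsilon> powr (2 - 4 / p) * Linf_norm (ball x r) (norm_D2 f)
                          + k2 * \<epsilon> powr (2 / (3 * p - 4)) *
                              (Linf_norm (ball x r) (\<lambda>y. norm (grad f y)) + Linf_norm (ball x r) (norm_D3 f)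
                               + (norm_D2 f x)\<^sup>2 / norm (grad f x)))) \<and>
                  (\<forall>\<epsilon> \<in> {0<..<\<epsilon>\<^sub>0}. \<forall>r \<in> {\<epsilon>\<^sub>0..<R}. balls_inside p \<epsilon> x r \<longrightarrow>
                     \<bar>E \<epsilon>\<bar> \<le> \<epsilon>\<^sup>2 * T
                       + k3 * (Linf_norm (ball x r) (norm_D2 f) powr (1 / (p - 1)) *
                                 norm (grad f x) powr ((p - 2) / (p - 1))
                               + \<epsilon> powr (2 - 4 / p) * Linf_norm (ball x r) (norm_D2 f)
                               + \<epsilon> powr (2 / (3 * p - 4)) * norm (grad f x))))))"
proof -
  note p = assms
  define C where "C = p + DIM(real ^ 'n)"
  define G where "G = 1 + 2 * gamma DIM(real ^ 'n) p ^ 3"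
  have C: "C > 0" using p by (simp add: C_def)
  have "gamma DIM(real ^ 'n) p \<ge> 0" using p by (simp add: gamma_def)
  then have G: "G > 0" unfolding G_def by (intro add_pos_nonneg) auto
  have al: "(p - 2) / (p - 1) = alpha p" by (simp add: alpha_def)
  show ?thesis
  proof (rule exI[of _ C], rule conjI[OF C], rule exI[of _ G], rule conjI[OF G],
      rule exI[of _ "C + 1"], rule conjI, use C in simp, intro allI impI)
    fix x :: "real ^ 'n" and t R \<tau> :: real
    assume t: "t > 0" and "R \<in> {0<..<1}" and "\<tau> \<in> {0<..<t}"
    then have R: "0 < R" "R < 1" and \<tau>: "0 < \<tau>" by auto
    \<comment> \<open>R / 2 leaves room for a compact ball on which every C^2 function is
      bounded.\<close>
    obtain b where b: "b > 0" "\<And>\<epsilon>. 0 < \<epsilon> \<Longrightarrow> \<epsilon> < b \<Longrightarrow> balls_inside p \<epsilon> x (R / 2)"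
      using eventually_balls_inside[OF p, of "R / 2" x] R unfolding eventually_at_right_field by auto
    \<comment> \<open>Halving makes the inequalities strict; since e0 < 1, also e0^2 / 2 < \<tau>,
      so the interval of the norm in time lies inside the domain.\<close>
    define e0 where "e0 = min b (min R \<tau>) / 2"
    have e0: "0 < e0" "e0 < R" "e0 < \<tau>" "e0 < b" "e0 < 1" "e0\<^sup>2 / 2 < \<tau>"
    proof -
      show *: "0 < e0" "e0 < R" "e0 < \<tau>" "e0 < b" using b R \<tau> by (auto simp: e0_def min_def)
      then show "e0 < 1" using R by simp
      then have "e0\<^sup>2 \<le> e0" using * by (simp add: power2_eq_square mult_le_cancel_left1)
      then show "e0\<^sup>2 / 2 < \<tau>" using * by simp
    qed
    have \<epsilon>: "0 < \<epsilon>" "\<epsilon> < 1" "balls_inside p \<epsilon> x (R / 2)" "balls_inside p \<epsilon> x R" if "\<epsilon> \<in> {0<..<e0}" for \<epsilon>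
      using that e0 b(2)[of \<epsilon>] balls_inside_mono[of p \<epsilon> x "R / 2" R] R by auto
    have wd_bounded: "A_well_defined p \<epsilon> R (\<lambda>y. \<phi> (y, t)) x"
      if "\<epsilon> \<in> {0<..<e0}" "bounded (\<phi> ` (ball x R \<times> {t - \<tau>..t + \<tau>}))"
        "\<phi> \<in> borel_measurable (restrict_space borel (ball x R \<times> {t - \<tau>..t + \<tau>}))" for \<epsilon> \<phi>
    proof (rule A_well_definedI[OF p \<epsilon>(1,2)[OF that(1)] order_refl \<epsilon>(4)[OF that(1)]])
      show "bounded ((\<lambda>y. \<phi> (y, t)) ` ball x R)"
        by (rule bounded_subset[OF that(2)]) (use \<tau> in auto)
      show "(\<lambda>y. \<phi> (y, t)) \<in> borel_measurable (restrict_space borel (ball x R))"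
        by (rule measurable_space_slice[OF that(3)]) (use \<tau> in auto)
    qed
    have expansion: "let f = (\<lambda>y. \<phi> (y, t));
                 h = (\<lambda>s. \<phi> (x, s));
                 T = Linf_norm {t - e0\<^sup>2 / 2..t + e0\<^sup>2 / 2} (deriv (deriv h))
             in \<exists>E :: real \<Rightarrow> real.
                  (\<forall>\<epsilon> \<in> {0<..<e0}. A_well_defined p \<epsilon> R f x \<and>
                     A_op p \<epsilon> f x = \<phi> (x, t + \<epsilon>\<^sup>2 / 2)
                       + \<epsilon>\<^sup>2 / 2 * (signed_power (p_laplacian p f x) (1 / (p - 1)) - deriv h t)
                       + \<epsilon>\<^sup>2 * E \<epsilon>) \<and>
                  (E \<longlongrightarrow> 0) (at_right 0) \<and>
                  (C_k_on 3 (ball x R \<times> {t - \<tau>..t + \<tau>}) \<phi> \<longrightarrow> grad f x \<noteq> 0 \<longrightarrow>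
                     (\<forall>\<epsilon> \<in> {0<..<e0}. \<forall>r \<in> {e0..<R}. balls_inside p \<epsilon> x r \<longrightarrow>
                        \<bar>E \<epsilon>\<bar> \<le> \<epsilon>\<^sup>2 * T
                          + C * \<epsilon> powr (2 - 4 / p) * Linf_norm (ball x r) (norm_D2 f)
                          + G * \<epsilon> powr (2 / (3 * p - 4)) *
                              (Linf_norm (ball x r) (\<lambda>y. norm (grad f y)) + Linf_norm (ball x r) (norm_D3 f)
                               + (norm_D2 f x)\<^sup>2 / norm (grad f x)))) \<and>
                  (\<forall>\<epsilon> \<in> {0<..<e0}. \<forall>r \<in> {e0..<R}. balls_inside p \<epsilon> x r \<longrightarrow>
                     \<bar>E \<epsilon>\<bar> \<le> \<epsilon>\<^sup>2 * T
                       + (C + 1) * (Linf_norm (ball x r) (norm_D2 f) powr (1 / (p - 1)) *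
                                 norm (grad f x) powr ((p - 2) / (p - 1))
                               + \<epsilon> powr (2 - 4 / p) * Linf_norm (ball x r) (norm_D2 f)
                               + \<epsilon> powr (2 / (3 * p - 4)) * norm (grad f x)))"
      if \<phi>: "C_k_on 2 (ball x R \<times> {t - \<tau>..t + \<tau>}) \<phi>" for \<phi>
    proof -
      define f where "f = (\<lambda>y. \<phi> (y, t))"
      define h where "h = (\<lambda>s. \<phi> (x, s))"
      define T where "T = Linf_norm {t - e0\<^sup>2 / 2..t + e0\<^sup>2 / 2} (deriv (deriv h))"
      define sp where "sp = signed_power (p_laplacian p f x) (1 / (p - 1))"
      define A where "A \<epsilon> = A_op p \<epsilon> f x - f x" for \<epsilon>
      define H where "H \<epsilon> = h (t + \<epsilon>\<^sup>2 / 2) - h t - \<epsilon>\<^sup>2 / 2 * deriv h t" for \<epsilon>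
      \<comment> \<open>\<open>E\<close> is obtained by solving the expansion for it, which makes
        \<open>eq\<close> an identity; \<open>H\<close> is the second-order remainder in
        time.\<close>
      define E where "E \<epsilon> = (A \<epsilon> - \<epsilon>\<^sup>2 / 2 * sp - H \<epsilon>) / \<epsilon>\<^sup>2" for \<epsilon>
      have f: "C_k_on 2 (ball x R) f" unfolding f_def by (rule C_k_on_space_slice[OF \<phi> \<tau>])
      have h: "C_k_on 2 {t - \<tau><..<t + \<tau>} h" unfolding h_def by (rule C_k_on_time_slice[OF \<phi> R(1)])
      have ht: "h t = f x" by (simp add: h_def f_def)
      have wd: "A_well_defined p \<epsilon> R f x" if "\<epsilon> \<in> {0<..<e0}" for \<epsilon>
        by (rule A_well_defined_C2[OF p \<epsilon>(1,2)[OF that] _ \<epsilon>(3)[OF that] f]) (use R in simp)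
      have fr: "C_k_on k (ball x r) f" if "C_k_on k (ball x R) f" "r < R" for k r
        by (rule C_k_on_open_subset[OF open_ball subset_ball that(1)]) (use that in simp)
      have e02: "0 < e0\<^sup>2 / 2" using e0 by simp
      have T: "T \<ge> 0"
        unfolding T_def by (rule time_increment_error(2)[OF h e02 e0(6) e02 order_refl])
      have H: "\<bar>H \<epsilon>\<bar> / \<epsilon>\<^sup>2 \<le> \<epsilon>\<^sup>2 * T" if "\<epsilon> \<in> {0<..<e0}" for \<epsilon>
      proof -
        have "\<epsilon>\<^sup>2 \<le> e0\<^sup>2" using that by (intro power_mono) auto
        then have "\<bar>H \<epsilon>\<bar> \<le> (\<epsilon>\<^sup>2 / 2)\<^sup>2 / 2 * T"
          unfolding H_def T_def using that by (intro time_increment_error(1)[OF h e02 e0(6)]) auto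
        \<comment> \<open>Taylor's formula with time step \<epsilon>^2 / 2 gives the constant 1/8,
          which is rounded up to 1.\<close>
        also have "\<dots> = (\<epsilon>\<^sup>2 * T * \<epsilon>\<^sup>2) / 8" by (simp add: power2_eq_square)
        also have "\<dots> \<le> \<epsilon>\<^sup>2 * T * \<epsilon>\<^sup>2" using T by simp
        finally show ?thesis using that by (simp add: pos_divide_le_eq)
      qed
      have E_bound: "\<bar>E \<epsilon>\<bar> \<le> \<epsilon>\<^sup>2 * T + X" if "\<epsilon> \<in> {0<..<e0}" "\<bar>A \<epsilon> - \<epsilon>\<^sup>2 / 2 * sp\<bar> \<le> \<epsilon>\<^sup>2 * X" for \<epsilon> X
      proof -
        have "\<bar>E \<epsilon>\<bar> \<le> \<bar>A \<epsilon> - \<epsilon>\<^sup>2 / 2 * sp\<bar> / \<epsilon>\<^sup>2 + \<bar>H \<epsilon>\<bar> / \<epsilon>\<^sup>2"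
          unfolding E_def by (simp add: divide_right_mono flip: add_divide_distrib)
        moreover have "\<bar>A \<epsilon> - \<epsilon>\<^sup>2 / 2 * sp\<bar> / \<epsilon>\<^sup>2 \<le> X" using that by (simp add: pos_divide_le_eq mult.commute)
        ultimately show ?thesis using H[OF that(1)] by linarith
      qed
      have eq: "A_op p \<epsilon> f x = \<phi> (x, t + \<epsilon>\<^sup>2 / 2) + \<epsilon>\<^sup>2 / 2 * (sp - deriv h t) + \<epsilon>\<^sup>2 * E \<epsilon>"
        if "\<epsilon> \<in> {0<..<e0}" for \<epsilon>
      proof -
        have "\<epsilon>\<^sup>2 * E \<epsilon> = A \<epsilon> - \<epsilon>\<^sup>2 / 2 * sp - H \<epsilon>" using that by (simp add: E_def)
        then show ?thesis by (simp add: A_def H_def ht right_diff_distrib) (simp add: h_def)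
      qed
      have lim: "(E \<longlongrightarrow> 0) (at_right 0)"
      proof -
        have sq: "((\<lambda>\<epsilon>::real. \<epsilon>\<^sup>2 * T) \<longlongrightarrow> 0) (at_right 0)"
          by (auto intro!: tendsto_eq_intros)
        have ev: "eventually (\<lambda>\<epsilon>. \<epsilon> \<in> {0<..<e0}) (at_right 0)"
          unfolding eventually_at_right_field using e0 by auto
        have limH: "((\<lambda>\<epsilon>. H \<epsilon> / \<epsilon>\<^sup>2) \<longlongrightarrow> 0) (at_right 0)"
          by (rule Lim_null_comparison[OF _ sq]) (use ev H in \<open>auto elim!: eventually_mono\<close>)
        have limA: "((\<lambda>\<epsilon>. A \<epsilon> / \<epsilon>\<^sup>2) \<longlongrightarrow> sp / 2) (at_right 0)"
          unfolding A_def sp_def by (rule A_op_limit[OF p R(1) f])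
        have "((\<lambda>\<epsilon>. A \<epsilon> / \<epsilon>\<^sup>2 - sp / 2 - H \<epsilon> / \<epsilon>\<^sup>2) \<longlongrightarrow> sp / 2 - sp / 2 - 0) (at_right 0)"
          by (rule tendsto_diff[OF tendsto_diff[OF limA tendsto_const] limH])
        moreover have "eventually (\<lambda>\<epsilon>. A \<epsilon> / \<epsilon>\<^sup>2 - sp / 2 - H \<epsilon> / \<epsilon>\<^sup>2 = E \<epsilon>) (at_right 0)"
          using ev by eventually_elim (simp add: E_def diff_divide_distrib)
        ultimately show ?thesis by (simp add: tendsto_cong)
      qed
      have b3: "\<bar>E \<epsilon>\<bar> \<le> \<epsilon>\<^sup>2 * T + C * \<epsilon> powr (2 - 4 / p) * Linf_norm (ball x r) (norm_D2 f)
          + G * \<epsilon> powr (2 / (3 * p - 4)) * (Linf_norm (ball x r) (\<lambda>y. norm (grad f y)) + Linf_norm (ball x r) (norm_D3 f)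
             + (norm_D2 f x)\<^sup>2 / norm (grad f x))"
        if \<phi>3: "C_k_on 3 (ball x R \<times> {t - \<tau>..t + \<tau>}) \<phi>" and g: "grad f x \<noteq> 0"
          and e: "\<epsilon> \<in> {0<..<e0}" and r: "r \<in> {e0..<R}" and balls: "balls_inside p \<epsilon> x r" for \<epsilon> r
      proof -
        have rr: "0 < r" "r < R" using r e0 by auto
        have f3: "C_k_on 3 (ball x R) f" unfolding f_def by (rule C_k_on_space_slice[OF \<phi>3 \<tau>])
        have c3: "continuous_on (ball x R) (norm_D3 f)"
          unfolding norm_D3_def by (intro continuous_intros C_3_on_open(3)[OF f3 open_ball])
        have K3: "norm_D3 f y \<le> Linf_norm (ball x r) (norm_D3 f)" if "y \<in> ball x r" for y
          using abs_le_Linf_norm_ball[OF c3 rr(2) that] by simp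
        have c1: "continuous_on (ball x R) (\<lambda>y. norm (grad f y))"
          unfolding grad_def by (intro continuous_intros C_2_on_open(3)[OF f open_ball])
        have K1: "norm (grad f x) \<le> Linf_norm (ball x r) (\<lambda>y. norm (grad f y))"
          using abs_le_Linf_norm_ball[OF c1 rr(2), of x] rr by simp
        from E_bound[OF e A_op_error_C3[OF p \<epsilon>(1,2)[OF e] rr(1) balls wd[OF e] fr[OF f3 rr(2)]
              norm_D2_bounded[OF f rr(2)] K3 g K1, folded A_def sp_def C_def G_def]]
        show ?thesis by (simp only: add.assoc)
      qed
      have b2: "\<bar>E \<epsilon>\<bar> \<le> \<epsilon>\<^sup>2 * T + (C + 1) * (Linf_norm (ball x r) (norm_D2 f) powr (1 / (p - 1)) *
            norm (grad f x) powr ((p - 2) / (p - 1))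
          + \<epsilon> powr (2 - 4 / p) * Linf_norm (ball x r) (norm_D2 f) + \<epsilon> powr (2 / (3 * p - 4)) * norm (grad f x))"
        if e: "\<epsilon> \<in> {0<..<e0}" and r: "r \<in> {e0..<R}" and balls: "balls_inside p \<epsilon> x r" for \<epsilon> r
      proof -
        have rr: "0 < r" "r < R" using r e0 by auto
        show ?thesis unfolding al
          by (rule E_bound[OF e A_op_error_C2[OF p \<epsilon>(1,2)[OF e] rr(1) balls wd[OF e] fr[OF f rr(2)]
                norm_D2_bounded[OF f rr(2)], folded A_def sp_def C_def]])
      qed
      show ?thesis
        unfolding Let_def f_def[symmetric] h_def[symmetric] T_def[symmetric] sp_def[symmetric]
        by (rule exI[of _ E]) (use wd eq lim b3 b2 in blast)
    qed
    show "\<exists>\<epsilon>\<^sub>0 \<in> {0<..<min R \<tau>}.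
         (\<forall>\<epsilon> \<in> {0<..<\<epsilon>\<^sub>0}. balls_inside p \<epsilon> x R \<and>
            (\<forall>\<phi> :: (real ^ 'n) \<times> real \<Rightarrow> real.
               bounded (\<phi> ` (ball x R \<times> {t - \<tau>..t + \<tau>})) \<longrightarrow>
               \<phi> \<in> borel_measurable (restrict_space borel (ball x R \<times> {t - \<tau>..t + \<tau>})) \<longrightarrow>
               A_well_defined p \<epsilon> R (\<lambda>y. \<phi> (y, t)) x)) \<and>
         (\<forall>\<phi> :: (real ^ 'n) \<times> real \<Rightarrow> real.
            C_k_on 2 (ball x R \<times> {t - \<tau>..t + \<tau>}) \<phi> \<longrightarrow>
            (let f = (\<lambda>y. \<phi> (y, t));
                 h = (\<lambda>s. \<phi> (x, s));
                 T = Linf_norm {t - \<epsilon>\<^sub>0\<^sup>2 / 2..t + \<epsilon>\<^sub>0\<^sup>2 / 2} (deriv (deriv h))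
             in \<exists>E :: real \<Rightarrow> real.
                  (\<forall>\<epsilon> \<in> {0<..<\<epsilon>\<^sub>0}. A_well_defined p \<epsilon> R f x \<and>
                     A_op p \<epsilon> f x = \<phi> (x, t + \<epsilon>\<^sup>2 / 2)
                       + \<epsilon>\<^sup>2 / 2 * (signed_power (p_laplacian p f x) (1 / (p - 1)) - deriv h t)
                       + \<epsilon>\<^sup>2 * E \<epsilon>) \<and>
                  (E \<longlongrightarrow> 0) (at_right 0) \<and>
                  (C_k_on 3 (ball x R \<times> {t - \<tau>..t + \<tau>}) \<phi> \<longrightarrow> grad f x \<noteq> 0 \<longrightarrow>
                     (\<forall>\<epsilon> \<in> {0<..<\<epsilon>\<^sub>0}. \<forall>r \<in> {\<epsilon>\<^sub>0..<R}. balls_inside p \<epsilon> x r \<longrightarrow>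
                        \<bar>E \<epsilon>\<bar> \<le> \<epsilon>\<^sup>2 * T
                          + C * \<epsilon> powr (2 - 4 / p) * Linf_norm (ball x r) (norm_D2 f)
                          + G * \<epsilon> powr (2 / (3 * p - 4)) *
                              (Linf_norm (ball x r) (\<lambda>y. norm (grad f y)) + Linf_norm (ball x r) (norm_D3 f)
                               + (norm_D2 f x)\<^sup>2 / norm (grad f x)))) \<and>
                  (\<forall>\<epsilon> \<in> {0<..<\<epsilon>\<^sub>0}. \<forall>r \<in> {\<epsilon>\<^sub>0..<R}. balls_inside p \<epsilon> x r \<longrightarrow>
                     \<bar>E \<epsilon>\<bar> \<le> \<epsilon>\<^sup>2 * T
                       + (C + 1) * (Linf_norm (ball x r) (norm_D2 f) powr (1 / (p - 1)) *
                                 norm (grad f x) powr ((p - 2) / (p - 1))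
                               + \<epsilon> powr (2 - 4 / p) * Linf_norm (ball x r) (norm_D2 f)
                               + \<epsilon> powr (2 / (3 * p - 4)) * norm (grad f x)))))"
      by (rule bexI[of _ e0], intro conjI ballI allI impI expansion)
        (use e0 \<epsilon>(4) wd_bounded in auto)
  qed
qed

end
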